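(* Assume $\sup_{\ell\ge1}\ell|a_\ell|<\infty$. Suppose there exists $m\in\mathbb{N}$ such that $a_m>0$, $\sum_{\ell=1}^\infty|a_{\ell m}|<\infty$ and $a_{\ell m}\ne a_m$ for all $\ell>1$. Put $\kappa_m=2/a_m$ and $R_m(W)=\frac{a_m-2a_{2m}}{a_m-a_{2m}}$. If $R_m(W)>0$, there exists $\delta_m>0$ such that for every $\kappa\in(\kappa_m,\kappa_m+\delta_m]$ there are two non-trivial solutions of the stationary McKean-Vlasov equation $\partial_{\theta\theta}p=\kappa\,\partial_\theta(p\,\partial_\theta(W\star p))$ in $\mathbb{B}_{\delta_m}(p_0,H^1_s(\mathbb{S}^1))$ given by $$p^\pm_\kappa(\theta)=\frac1Z\exp\Big(\kappa\sum_{\ell=1}^\infty s^\pm(\kappa)^\ell\,\big(z_{\ell m}(\kappa)+r_{\ell m}(\kappa)\big)\,a_{\ell m}\cos\ell m\theta\Big),$$ where $Z$ is the normalizing factor; $\{z_{\ell m}(\kappa):\ell\ge1\}$ satisfy the recursive convolution equations $$z_m=1,\qquad \ell m(2-\kappa a_{\ell m})z_{\ell m}(\kappa)=\kappa\sum_{j=1}^{\ell-1}jm\,a_{jm}\,z_{jm}(\kappa)\,z_{(\ell-j)m}(\kappa),\quad\ell\ge2;$$ $r_{\ell m}(\kappa)=O(|\kappa a_m-2|)$ for each $\ell$; and $$s^\pm(\kappa)=\pm\sqrt{\frac{2(\kappa a_m-2)(2-\kappa a_{2m})}{\kappa^2a_m(a_m-2a_{2m})}}+O(|\kappa a_m-2|^{3/2}).$$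 In particular, this corresponds to a supercritical branch of non-trivial bifurcating solutions. The same representation holds when $R_m(W)<0$, but now for $\kappa\in[\kappa_m-\delta_m,\kappa_m)$ (a subcritical branch). Moreover, if $a_\ell\ne a_m$ for all $\ell\neq m$, these are the only possible non-trivial solutions $(p,\kappa)$ in $\mathbb{B}_{\delta_m}(p_0,H^1_s(\mathbb{S}^1))\times[\kappa_m-\delta_m,\kappa_m+\delta_m]$.
   Context: $\mathbb{S}^1=[0,2\pi)$. The potential $W(\theta)=\sum_{\ell\ge1}a_\ell\cos\ell\theta$ is even and square integrable, $a_\ell\in\mathbb{R}$; $\kappa>0$; $(W\star p)(\theta)=\frac1{2\pi}\int_0^{2\pi}W(\theta-\phi)p(\phi)\,d\phi$. Solutions are weak solutions that are probability densities with respect to $d\theta/2\pi$, i.e. $p\ge0$, $\frac1{2\pi}\int_0^{2\pi}p\,d\theta=1$ (this fixes $Z$). $H^1_s(\mathbb{S}^1)$ is the space of even functions on the circle with square integrable function and weak derivative, with norm $\|p\|_{H^1}^2=\int_0^{2\pi}(p^2+|p'|^2)\,d\theta$. $p_0\equiv1$ is the uniform density, a (trivial) solution for every $\kappa$; non-trivial means different from $p_0$. $\mathbb{B}_\delta(p_0,H^1_s(\mathbb{S}^1))$ is the $\delta$-ball around $p_0$ in $H^1_s(\mathbb{S}^1)$. The $O(\cdot)$ terms are as $\kappa\to\kappa_m$ within the relevant interval (for $r_{\ell m}$ the implied constant may depend on $\ell$). A branch bifurcating from $(p_0,\kappa_m)$ is supercritical (subcritical) if it exists locally for $\kappa>\kappa_m$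 (resp. $\kappa<\kappa_m$).
   Formalization: The single δ_m is replaced by two positive constants, a radius δ for the ball and a length η for the κ-interval, since the branch lies at H^1 distance of order |κ-κ_m|^{1/2} and one number cannot in general serve as both (e.g. a_1=A, a_2=3A/4, other a_l=0, A large). *)

theory Defs
  imports "HOL-Analysis.Analysis" "HOL-Library.Landau_Symbols"
begin

(* Functions on the circle are 2 pi-periodic functions on the real line.  Elements of L^2 and H^1
   are represented by Borel functions, and identities and inequalities between them are understood
   almost everywhere. *)

abbreviation circle_integral :: "(real \<Rightarrow> real) \<Rightarrow> real" where
  "circle_integral f \<equiv> set_lebesgue_integral lborel {0..<2*pi} f"

definition circle_periodic :: "(real \<Rightarrow> real) \<Rightarrow> bool" where
  "circle_periodic f \<longleftrightarrow> (\<forall>\<theta>. f (\<theta> + 2*pi) = f \<theta>)"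

definition circle_even :: "(real \<Rightarrow> real) \<Rightarrow> bool" where
  "circle_even f \<longleftrightarrow> (AE \<theta> in lborel. f (- \<theta>) = f \<theta>)"

definition circle_L2 :: "(real \<Rightarrow> real) \<Rightarrow> bool" where
  "circle_L2 f \<longleftrightarrow> circle_periodic f \<and> f \<in> borel_measurable borel \<and>
     set_integrable lborel {0..<2*pi} (\<lambda>\<theta>. (f \<theta>)\<^sup>2)"

definition circle_test :: "(real \<Rightarrow> real) \<Rightarrow> bool" where
  "circle_test \<phi> \<longleftrightarrow> circle_periodic \<phi> \<and>
     (\<forall>n \<theta>. ((deriv ^^ n) \<phi>) field_differentiable (at \<theta>))"

definition has_weak_deriv :: "(real \<Rightarrow> real) \<Rightarrow> (real \<Rightarrow> real) \<Rightarrow> bool" where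
  "has_weak_deriv f g \<longleftrightarrow> circle_L2 f \<and> circle_L2 g \<and>
     (\<forall>\<phi>. circle_test \<phi> \<longrightarrow>
        circle_integral (\<lambda>\<theta>. f \<theta> * deriv \<phi> \<theta>) = - circle_integral (\<lambda>\<theta>. g \<theta> * \<phi> \<theta>))"

definition circle_H1 :: "(real \<Rightarrow> real) \<Rightarrow> bool" where
  "circle_H1 f \<longleftrightarrow> (\<exists>g. has_weak_deriv f g)"

(* The weak derivative is unique up to null sets; all uses below are insensitive to the choice. *)
definition weak_deriv :: "(real \<Rightarrow> real) \<Rightarrow> real \<Rightarrow> real" where
  "weak_deriv f = (SOME g. has_weak_deriv f g)"

definition H1_norm :: "(real \<Rightarrow> real) \<Rightarrow> real" where
  "H1_norm f = sqrt (circle_integral (\<lambda>\<theta>. (f \<theta>)\<^sup>2 + (weak_deriv f \<theta>)\<^sup>2))"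

definition H1s :: "(real \<Rightarrow> real) set" where
  "H1s = {f. circle_H1 f \<and> circle_even f}"

definition H1s_ball :: "(real \<Rightarrow> real) \<Rightarrow> real \<Rightarrow> (real \<Rightarrow> real) set" where
  "H1s_ball q \<delta> = {p \<in> H1s. H1_norm (\<lambda>\<theta>. p \<theta> - q \<theta>) < \<delta>}"

abbreviation uniform_density :: "real \<Rightarrow> real" where
  "uniform_density \<equiv> (\<lambda>_. 1)"

definition cosine_potential :: "(real \<Rightarrow> real) \<Rightarrow> (nat \<Rightarrow> real) \<Rightarrow> bool" where
  "cosine_potential W a \<longleftrightarrow> circle_L2 W \<and> circle_even W \<and>
     (\<lambda>N. circle_integral (\<lambda>\<theta>. (W \<theta> - (\<Sum>l=1..N. a l * cos (real l * \<theta>)))\<^sup>2))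
       \<longlonglongrightarrow> 0"

definition circle_conv :: "(real \<Rightarrow> real) \<Rightarrow> (real \<Rightarrow> real) \<Rightarrow> real \<Rightarrow> real" where
  "circle_conv W p \<theta> = 1 / (2*pi) * circle_integral (\<lambda>\<phi>. W (\<theta> - \<phi>) * p \<phi>)"

definition circle_density :: "(real \<Rightarrow> real) \<Rightarrow> bool" where
  "circle_density p \<longleftrightarrow> (AE \<theta> in lborel. 0 \<le> p \<theta>) \<and> 1 / (2*pi) * circle_integral p = 1"

(* p'' = kappa (p (W * p)')' tested against smooth functions, all outer derivatives being moved
   to the test function. *)
definition stationary_solution :: "(real \<Rightarrow> real) \<Rightarrow> real \<Rightarrow> (real \<Rightarrow> real) \<Rightarrow> bool" where
  "stationary_solution W \<kappa> p \<longleftrightarrow>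
     circle_L2 p \<and> circle_density p \<and> circle_H1 (circle_conv W p) \<and>
     (\<forall>\<phi>. circle_test \<phi> \<longrightarrow>
        circle_integral (\<lambda>\<theta>. p \<theta> * deriv (deriv \<phi>) \<theta>)
        = - \<kappa> * circle_integral (\<lambda>\<theta>. p \<theta> * weak_deriv (circle_conv W p) \<theta> * deriv \<phi> \<theta>))"

definition nontrivial_solution :: "(real \<Rightarrow> real) \<Rightarrow> real \<Rightarrow> (real \<Rightarrow> real) \<Rightarrow> bool" where
  "nontrivial_solution W \<kappa> p \<longleftrightarrow>
     stationary_solution W \<kappa> p \<and> \<not> (AE \<theta> in lborel. p \<theta> = uniform_density \<theta>)"

definition kappa_crit :: "(nat \<Rightarrow> real) \<Rightarrow> nat \<Rightarrow> real" where
  "kappa_crit a m = 2 / a m"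

definition R_coeff :: "(nat \<Rightarrow> real) \<Rightarrow> nat \<Rightarrow> real" where
  "R_coeff a m = (a m - 2 * a (2*m)) / (a m - a (2*m))"

(* Families such as z and r are indexed by the full mode number l * m; the n-th term of the series
   belongs to l = Suc n. *)
definition exponent_term ::
  "(nat \<Rightarrow> real) \<Rightarrow> nat \<Rightarrow> (nat \<Rightarrow> real \<Rightarrow> real) \<Rightarrow> (nat \<Rightarrow> real \<Rightarrow> real) \<Rightarrow> (real \<Rightarrow> real)
    \<Rightarrow> real \<Rightarrow> real \<Rightarrow> nat \<Rightarrow> real" where
  "exponent_term a m z r s \<kappa> \<theta> n =
     s \<kappa> ^ Suc n * (z (Suc n * m) \<kappa> + r (Suc n * m) \<kappa>) * a (Suc n * m)
       * cos (real (Suc n * m) * \<theta>)"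

definition branch_density ::
  "(nat \<Rightarrow> real) \<Rightarrow> nat \<Rightarrow> (nat \<Rightarrow> real \<Rightarrow> real) \<Rightarrow> (nat \<Rightarrow> real \<Rightarrow> real) \<Rightarrow> (real \<Rightarrow> real)
    \<Rightarrow> real \<Rightarrow> real \<Rightarrow> real" where
  "branch_density a m z r s \<kappa> =
     (let E = (\<lambda>\<theta>. exp (\<kappa> * (\<Sum>n. exponent_term a m z r s \<kappa> \<theta> n)));
          Z = 1 / (2*pi) * circle_integral E
      in (\<lambda>\<theta>. 1 / Z * E \<theta>))"

definition convolution_recursion ::
  "(nat \<Rightarrow> real) \<Rightarrow> nat \<Rightarrow> real \<Rightarrow> (nat \<Rightarrow> real \<Rightarrow> real) \<Rightarrow> bool" where
  "convolution_recursion a m \<kappa> z \<longleftrightarrow> z m \<kappa> = 1 \<and>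
     (\<forall>l\<ge>2. real (l*m) * (2 - \<kappa> * a (l*m)) * z (l*m) \<kappa>
        = \<kappa> * (\<Sum>j=1..l-1. real (j*m) * a (j*m) * z (j*m) \<kappa> * z ((l-j)*m) \<kappa>))"

definition amplitude :: "(nat \<Rightarrow> real) \<Rightarrow> nat \<Rightarrow> real \<Rightarrow> real" where
  "amplitude a m \<kappa> =
     sqrt (2 * (\<kappa> * a m - 2) * (2 - \<kappa> * a (2*m)) / (\<kappa>\<^sup>2 * a m * (a m - 2 * a (2*m))))"

definition expansion_coefficients ::
  "(nat \<Rightarrow> real) \<Rightarrow> nat \<Rightarrow> real set \<Rightarrow> (nat \<Rightarrow> real \<Rightarrow> real) \<Rightarrow> (nat \<Rightarrow> real \<Rightarrow> real)
    \<Rightarrow> (real \<Rightarrow> real) \<Rightarrow> (real \<Rightarrow> real) \<Rightarrow> bool" where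
  "expansion_coefficients a m I z r sp sm \<longleftrightarrow>
     (\<forall>\<kappa>\<in>I. convolution_recursion a m \<kappa> z) \<and>
     (\<forall>l\<ge>1. (\<lambda>\<kappa>. r (l*m) \<kappa>) \<in> O[at (kappa_crit a m) within I](\<lambda>\<kappa>. \<bar>\<kappa> * a m - 2\<bar>)) \<and>
     (\<lambda>\<kappa>. sp \<kappa> - amplitude a m \<kappa>)
       \<in> O[at (kappa_crit a m) within I](\<lambda>\<kappa>. \<bar>\<kappa> * a m - 2\<bar> powr (3/2)) \<and>
     (\<lambda>\<kappa>. sm \<kappa> - (- amplitude a m \<kappa>))
       \<in> O[at (kappa_crit a m) within I](\<lambda>\<kappa>. \<bar>\<kappa> * a m - 2\<bar> powr (3/2))"

(* Convergence of the exponent series is stated separately, since suminf is total.  The radius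
   delta of the ball is independent of the length of the parameter interval I: the H^1 distance of
   the branch to the uniform density is of order sqrt |kappa - kappa_crit|, so one small number
   cannot serve as both. *)
definition two_solutions ::
  "(real \<Rightarrow> real) \<Rightarrow> (nat \<Rightarrow> real) \<Rightarrow> nat \<Rightarrow> real \<Rightarrow> real set \<Rightarrow> (nat \<Rightarrow> real \<Rightarrow> real)
    \<Rightarrow> (nat \<Rightarrow> real \<Rightarrow> real) \<Rightarrow> (real \<Rightarrow> real) \<Rightarrow> (real \<Rightarrow> real) \<Rightarrow> bool" where
  "two_solutions W a m \<delta> I z r sp sm \<longleftrightarrow>
     (\<forall>\<kappa>\<in>I.
        (\<forall>s\<in>{sp, sm}.
           (\<forall>\<theta>. summable (exponent_term a m z r s \<kappa> \<theta>)) \<and>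
           nontrivial_solution W \<kappa> (branch_density a m z r s \<kappa>) \<and>
           branch_density a m z r s \<kappa> \<in> H1s_ball uniform_density \<delta>) \<and>
        \<not> (AE \<theta> in lborel. branch_density a m z r sp \<kappa> \<theta> = branch_density a m z r sm \<kappa> \<theta>))"

(* A branch is a curve of non-trivial solutions, continuous in H^1 and emanating from the uniform
   density at kappa0. *)
definition bifurcating_branch ::
  "(real \<Rightarrow> real) \<Rightarrow> real \<Rightarrow> real set \<Rightarrow> (real \<Rightarrow> real \<Rightarrow> real) \<Rightarrow> bool" where
  "bifurcating_branch W \<kappa>0 I P \<longleftrightarrow>
     (\<forall>\<kappa>\<in>I. P \<kappa> \<in> H1s \<and> nontrivial_solution W \<kappa> (P \<kappa>) \<and>
        ((\<lambda>\<kappa>'. H1_norm (\<lambda>\<theta>. P \<kappa>' \<theta> - P \<kappa> \<theta>)) \<longlongrightarrow> 0) (at \<kappa> within I)) \<and>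
     ((\<lambda>\<kappa>'. H1_norm (\<lambda>\<theta>. P \<kappa>' \<theta> - uniform_density \<theta>)) \<longlongrightarrow> 0) (at \<kappa>0 within I)"

definition supercritical_branch ::
  "(real \<Rightarrow> real) \<Rightarrow> real \<Rightarrow> (real \<Rightarrow> real \<Rightarrow> real) \<Rightarrow> bool" where
  "supercritical_branch W \<kappa>0 P \<longleftrightarrow> (\<exists>\<epsilon>>0. bifurcating_branch W \<kappa>0 {\<kappa>0<..\<kappa>0 + \<epsilon>} P)"

definition subcritical_branch ::
  "(real \<Rightarrow> real) \<Rightarrow> real \<Rightarrow> (real \<Rightarrow> real \<Rightarrow> real) \<Rightarrow> bool" where
  "subcritical_branch W \<kappa>0 P \<longleftrightarrow> (\<exists>\<epsilon>>0. bifurcating_branch W \<kappa>0 {\<kappa>0 - \<epsilon>..<\<kappa>0} P)"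

(* All non-trivial solutions (p, kappa) with p in the delta-ball and kappa in J lie on one of the
   two curves P, Q over I. *)
definition only_solutions ::
  "(real \<Rightarrow> real) \<Rightarrow> real \<Rightarrow> real set \<Rightarrow> real set \<Rightarrow> (real \<Rightarrow> real \<Rightarrow> real) \<Rightarrow> (real \<Rightarrow> real \<Rightarrow> real)
    \<Rightarrow> bool" where
  "only_solutions W \<delta> J I P Q \<longleftrightarrow>
     (\<forall>\<kappa>\<in>J. \<forall>p\<in>H1s_ball uniform_density \<delta>. nontrivial_solution W \<kappa> p \<longrightarrow>
        \<kappa> \<in> I \<and> ((AE \<theta> in lborel. p \<theta> = P \<kappa> \<theta>) \<or> (AE \<theta> in lborel. p \<theta> = Q \<kappa> \<theta>)))"

end

theory Submission
  imports Defs "HOL-Library.Nat_Bijection"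
begin

text \<open>
  Write an even density as p = 1 + \<Sum>_n U_n cos n\<theta>, the sum running over all integers, with U even and
  U_0 = 0. In Fourier space the stationary equation is the system of balance equations
  n (2 - \<kappa> a_n) U_n = \<kappa> \<Sum>_k k a_k U_k U_(n-k), where a_n stands for the coefficient with index |n|.
  Because l |a_l| is bounded, the right side is a bounded bilinear map on l1 (young_l1), and solving for
  n U_n gains one derivative; bifurcation theory in H^1 is thereby replaced by elementary fixed point
  arguments for sequences. Conversely a summable solution of the balance equations gives p' = V' p with
  V = \<kappa> (W * p), whence p = exp V / Z: this is the exponential form of the branch
  (solution_from_coefficients).

  On the multiples of m the linear part 2 - \<kappa> a_lm vanishes near \<kappa>_m = 2/a_m only for l = 1. The rescaling
  U_lm = t^|l| y_l, with y_1 = \<rho> a fixed small number, turns the convolution kernel into k a_km \<tau>^e with \<tau> = t^2 and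
  e = (|k| + |l-k| - |l|)/2 \<ge> 0. The equations for |l| \<ge> 2 are solved by contraction, with a solution that
  is Lipschitz in (\<kappa>, \<tau>) (mode_solution_exists, mode_difference). At \<tau> = 0 only the terms with 0 \<le> k \<le> l
  remain, and this is the convolution recursion for z; the difference between \<tau> and 0 is the remainder r.
  Since only t^2 enters, the two signs of t give the two branches with the same z and r.

  The equation of mode 1 becomes \<rho> a_m (\<kappa>_m - \<kappa>) = \<tau> \<kappa> H \<kappa> \<tau>, and H \<kappa> 0 is explicit (H_0): at \<kappa>_m its sign is
  opposite to that of R_m. This scalar equation has a unique positive root \<tau> on one side of \<kappa>_m and none on the
  other (scalar_branch), and its expansion gives the amplitude s = \<plusminus>\<rho>\<surd>\<tau>.

  For uniqueness, a solution close to the uniform density in H^1 has small coefficients in l1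
  (coefficients_of_solution, by completeness of the trigonometric system and the inequalities of Bessel and
  Cauchy-Schwarz). If a_l \<noteq> a_m for all l \<noteq> m, the modes that are not multiples of m satisfy a linear estimate with
  small constant and vanish (nonresonant_modes_vanish). The remaining coefficients are a rescaled solution of
  the higher modes, so they are determined by the scalar equation (balance_unique).
\<close>

section \<open>Summable sequences on the integers\<close>

definition l1 :: "(int \<Rightarrow> real) \<Rightarrow> bool" where
  "l1 x \<longleftrightarrow> (\<lambda>n. \<bar>x n\<bar>) summable_on UNIV"

definition l1norm :: "(int \<Rightarrow> real) \<Rightarrow> real" where
  "l1norm x = (\<Sum>\<^sub>\<infinity>n. \<bar>x n\<bar>)"

lemma l1_summable: "l1 x \<Longrightarrow> x summable_on UNIV"
  unfolding l1_def using summable_on_iff_abs_summable_on_real by (metis (no_types, lifting) real_norm_def summable_on_cong)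

lemma l1norm_nonneg: "0 \<le> l1norm x"
  unfolding l1norm_def by (intro infsum_nonneg) auto

lemma l1_le:
  assumes "f summable_on UNIV" "\<And>n. \<bar>x n\<bar> \<le> f n"
  shows "l1 x" "l1norm x \<le> (\<Sum>\<^sub>\<infinity>n. f n)"
proof -
  show "l1 x" unfolding l1_def
    by (rule summable_on_comparison_test[OF assms(1)]) (use assms(2) in auto)
  then show "l1norm x \<le> (\<Sum>\<^sub>\<infinity>n. f n)"
    unfolding l1norm_def l1_def by (intro infsum_mono assms) auto
qed

lemma l1_cmult_le:
  assumes "l1 y" "\<And>n. \<bar>x n\<bar> \<le> C * \<bar>y n\<bar>"
  shows "l1 x" "l1norm x \<le> C * l1norm y"
proof -
  have s: "(\<lambda>n. C * \<bar>y n\<bar>) summable_on UNIV"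
    using assms(1) unfolding l1_def by (rule summable_on_cmult_right)
  show "l1 x" using l1_le[OF s assms(2)] by simp
  show "l1norm x \<le> C * l1norm y"
    using l1_le(2)[OF s assms(2)] by (simp add: l1norm_def infsum_cmult_right')
qed

lemma l1_add_le:
  assumes "l1 y" "l1 z" "\<And>n. \<bar>x n\<bar> \<le> C * \<bar>y n\<bar> + D * \<bar>z n\<bar>"
  shows "l1 x" "l1norm x \<le> C * l1norm y + D * l1norm z"
proof -
  have s1: "(\<lambda>n. C * \<bar>y n\<bar>) summable_on UNIV" "(\<lambda>n. D * \<bar>z n\<bar>) summable_on UNIV"
    using assms(1,2) unfolding l1_def by (auto intro: summable_on_cmult_right)
  then have s: "(\<lambda>n. C * \<bar>y n\<bar> + D * \<bar>z n\<bar>) summable_on UNIV"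
    by (rule summable_on_add)
  show "l1 x" using l1_le[OF s assms(3)] by simp
  show "l1norm x \<le> C * l1norm y + D * l1norm z"
    using l1_le(2)[OF s assms(3)] s1 by (simp add: l1norm_def infsum_cmult_right' infsum_add)
qed

lemma l1_diff: "l1 x \<Longrightarrow> l1 y \<Longrightarrow> l1 (\<lambda>n. x n - y n)"
  by (rule l1_add_le(1)[of x y _ 1 1]) auto

lemma l1_abs_le: "l1 x \<Longrightarrow> \<bar>x n\<bar> \<le> l1norm x"
  using finite_sum_le_infsum[of "\<lambda>n. \<bar>x n\<bar>" UNIV "{n}"] by (simp add: l1_def l1norm_def)

lemma l1norm_eq_0: "l1 x \<Longrightarrow> l1norm x \<le> 0 \<Longrightarrow> x n = 0"
  using l1_abs_le[of x n] by simp

lemma l1_infsum_le: "l1 x \<Longrightarrow> \<bar>\<Sum>\<^sub>\<infinity>n. x n\<bar> \<le> l1norm x"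
  unfolding l1_def l1norm_def using norm_infsum_bound[of x UNIV] by simp

lemma l1_finite_bound:
  assumes "\<And>F. finite F \<Longrightarrow> (\<Sum>n\<in>F. \<bar>x n\<bar>) \<le> M"
  shows "l1 x" "l1norm x \<le> M"
proof -
  show "l1 x" unfolding l1_def
    by (rule nonneg_bdd_above_summable_on) (use assms in \<open>auto intro!: bdd_aboveI[of _ M]\<close>)
  then show "l1norm x \<le> M"
    unfolding l1_def l1norm_def by (intro infsum_le_finite_sums assms) auto
qed

lemma l1_finite_le:
  assumes "l1 x" "finite F"
  shows "(\<Sum>n\<in>F. \<bar>x n\<bar>) \<le> l1norm x"
  using finite_sum_le_infsum[of "\<lambda>n. \<bar>x n\<bar>" UNIV F] assms by (simp add: l1_def l1norm_def)

text \<open>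
  The nonlinearity of the stationary equation in Fourier space: K n k = 1 is the convolution of sequences,
  and K n k = k a_k gives the product of the drift with the density.
\<close>

definition qconv :: "(int \<Rightarrow> int \<Rightarrow> real) \<Rightarrow> (int \<Rightarrow> real) \<Rightarrow> (int \<Rightarrow> real) \<Rightarrow> int \<Rightarrow> real" where
  "qconv K x y n = (\<Sum>\<^sub>\<infinity>k. K n k * x k * y (n - k))"

text \<open>
  The shear (n, k) \<mapsto> (k, n - k) turns the double sum into a product of two single sums; every
  summability fact on weighted convolutions below is a comparison with this one.
\<close>

lemma product_has_sum_shift:
  assumes "l1 x" "l1 y"
  shows "((\<lambda>(n, k). \<bar>x k\<bar> * \<bar>y (n - k)\<bar>) has_sum (l1norm x * l1norm y)) (UNIV \<times> UNIV)"
proof -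
  have y: "((\<lambda>j. \<bar>x k\<bar> * \<bar>y j\<bar>) has_sum (\<bar>x k\<bar> * l1norm y)) UNIV" for k
    using assms(2) unfolding l1_def l1norm_def by (intro has_sum_cmult_right has_sum_infsum)
  have x: "((\<lambda>k. \<bar>x k\<bar> * l1norm y) has_sum (l1norm x * l1norm y)) UNIV"
    using assms(1) unfolding l1_def l1norm_def by (intro has_sum_cmult_left has_sum_infsum)
  have "(\<lambda>p. \<bar>x (fst p)\<bar> * \<bar>y (snd p)\<bar>) summable_on UNIV \<times> UNIV"
    by (rule summable_on_SigmaI[OF _ has_sum_imp_summable[OF x]]) (use y in auto)
  then have "((\<lambda>p. \<bar>x (fst p)\<bar> * \<bar>y (snd p)\<bar>) has_sum (l1norm x * l1norm y)) (UNIV \<times> UNIV)"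
    by (intro has_sum_SigmaI[OF _ x]) (use y in auto)
  then show ?thesis
    by (subst has_sum_reindex_bij_witness[where i = "\<lambda>(k, j). (k + j, k)" and j = "\<lambda>(n, k). (k, n - k)"
          and h = "\<lambda>p. \<bar>x (fst p)\<bar> * \<bar>y (snd p)\<bar>" and T = "UNIV \<times> UNIV" and s' = "l1norm x * l1norm y"]) auto
qed

lemma qconv_summable:
  assumes "l1 x" "l1 y" "\<And>n k. \<bar>K n k\<bar> \<le> A"
  shows "(\<lambda>k. \<bar>x k\<bar> * \<bar>y (n - k)\<bar>) summable_on UNIV"
    and "(\<lambda>(n, k). K n k * x k * y (n - k)) summable_on UNIV \<times> UNIV"
    and "(\<lambda>k. K n k * x k * y (n - k)) summable_on UNIV"
proof -
  have A: "(\<lambda>(n, k). A * (\<bar>x k\<bar> * \<bar>y (n - k)\<bar>)) summable_on UNIV \<times> UNIV"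
    using has_sum_imp_summable[OF has_sum_cmult_right[OF product_has_sum_shift[OF assms(1,2)], of A]]
    by (simp add: case_prod_unfold)
  show "(\<lambda>k. \<bar>x k\<bar> * \<bar>y (n - k)\<bar>) summable_on UNIV"
    using summable_on_SigmaD1[OF has_sum_imp_summable[OF product_has_sum_shift[OF assms(1,2)]], where x = n]
    by simp
  have "norm (K n k * x k * y (n - k)) \<le> A * (\<bar>x k\<bar> * \<bar>y (n - k)\<bar>)" for n k
    using mult_right_mono[OF assms(3)[of n k], of "\<bar>x k\<bar> * \<bar>y (n - k)\<bar>"] by (simp add: abs_mult mult.assoc)
  then have "(\<lambda>p. norm (case p of (n, k) \<Rightarrow> K n k * x k * y (n - k))) summable_on UNIV \<times> UNIV"
    by (intro summable_on_comparison_test[OF A]) auto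
  then show B: "(\<lambda>(n, k). K n k * x k * y (n - k)) summable_on UNIV \<times> UNIV"
    by (rule abs_summable_summable)
  show "(\<lambda>k. K n k * x k * y (n - k)) summable_on UNIV"
    using summable_on_SigmaD1[OF B, where x = n] by simp
qed

lemma qconv_abs_le:
  assumes "l1 x" "l1 y" "\<And>n k. \<bar>K n k\<bar> \<le> A"
  shows "\<bar>qconv K x y n\<bar> \<le> A * (\<Sum>\<^sub>\<infinity>k. \<bar>x k\<bar> * \<bar>y (n - k)\<bar>)"
proof -
  have le: "\<bar>K n k * x k * y (n - k)\<bar> \<le> A * (\<bar>x k\<bar> * \<bar>y (n - k)\<bar>)" for k
    using mult_right_mono[OF assms(3)[of n k], of "\<bar>x k\<bar> * \<bar>y (n - k)\<bar>"] by (simp add: abs_mult mult.assoc)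
  have s: "(\<lambda>k. A * (\<bar>x k\<bar> * \<bar>y (n - k)\<bar>)) summable_on UNIV"
    using qconv_summable(1)[OF assms] by (rule summable_on_cmult_right)
  have "\<bar>qconv K x y n\<bar> \<le> l1norm (\<lambda>k. K n k * x k * y (n - k))"
    unfolding qconv_def by (rule l1_infsum_le) (rule l1_le(1)[OF s le])
  also have "\<dots> \<le> A * (\<Sum>\<^sub>\<infinity>k. \<bar>x k\<bar> * \<bar>y (n - k)\<bar>)"
    using l1_le(2)[OF s le] by (simp add: infsum_cmult_right')
  finally show ?thesis .
qed

text \<open>
  Absolute values reduce a bounded kernel to the plain convolution, where Tonelli applies. This is where the decay
  of the Fourier coefficients of the potential enters, since k a_k is bounded.
\<close>

lemma young_l1:
  assumes "l1 x" "l1 y" "\<And>n k. \<bar>K n k\<bar> \<le> A"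
  shows "l1 (qconv K x y)" "l1norm (qconv K x y) \<le> A * (l1norm x * l1norm y)"
proof -
  note hs = product_has_sum_shift[OF assms(1,2)]
  have s: "(\<lambda>n. \<Sum>\<^sub>\<infinity>k. \<bar>x k\<bar> * \<bar>y (n - k)\<bar>) summable_on UNIV"
    using summable_on_Sigma_banach[OF has_sum_imp_summable[OF hs]] by simp
  have i: "(\<Sum>\<^sub>\<infinity>n. \<Sum>\<^sub>\<infinity>k. \<bar>x k\<bar> * \<bar>y (n - k)\<bar>) = l1norm x * l1norm y"
    using infsum_Sigma'_banach[OF has_sum_imp_summable[OF hs]] infsumI[OF hs] by simp
  have s': "(\<lambda>n. A * (\<Sum>\<^sub>\<infinity>k. \<bar>x k\<bar> * \<bar>y (n - k)\<bar>)) summable_on UNIV"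
    using s by (rule summable_on_cmult_right)
  note l = l1_le[OF s' qconv_abs_le[where K = K, OF assms]]
  show "l1 (qconv K x y)" by (rule l)
  show "l1norm (qconv K x y) \<le> A * (l1norm x * l1norm y)"
    using l(2) i by (simp add: infsum_cmult_right')
qed

text \<open>
  The other endpoint of Young's inequality, l1 against bounded sequences. It makes the quadratic map a
  contraction for the sup norm on a small l1 ball, which is the hypothesis of the fixed point lemma below.
\<close>

lemma qconv_sup_le:
  assumes "l1 x" "l1 y" "\<And>n k. \<bar>K n k\<bar> \<le> A" "0 \<le> A" "\<And>k. \<bar>y k\<bar> \<le> B"
  shows "\<bar>qconv K x y n\<bar> \<le> A * l1norm x * B"
proof -
  have sx: "(\<lambda>k. \<bar>x k\<bar> * B) summable_on UNIV"
    using assms(1) unfolding l1_def by (rule summable_on_cmult_left)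
  have "(\<Sum>\<^sub>\<infinity>k. \<bar>x k\<bar> * \<bar>y (n - k)\<bar>) \<le> (\<Sum>\<^sub>\<infinity>k. \<bar>x k\<bar> * B)"
    by (intro infsum_mono qconv_summable(1)[OF assms(1-3)] sx mult_left_mono assms(5)) auto
  also have "\<dots> = l1norm x * B"
    by (simp add: infsum_cmult_left' l1norm_def)
  finally have "A * (\<Sum>\<^sub>\<infinity>k. \<bar>x k\<bar> * \<bar>y (n - k)\<bar>) \<le> A * (l1norm x * B)"
    using assms(4) by (rule mult_left_mono)
  then show ?thesis
    using qconv_abs_le[where K = K and n = n, OF assms(1-3)] by simp
qed

lemma qconv_flip: "qconv K x y n = qconv (\<lambda>n k. K n (n - k)) y x n"
  unfolding qconv_def
  by (rule infsum_reindex_bij_witness[where i = "\<lambda>k. n - k" and j = "\<lambda>k. n - k"]) (auto simp: mult_ac)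

lemma infsum_diff_real:
  fixes f g :: "'a \<Rightarrow> real"
  assumes "f summable_on S" "g summable_on S"
  shows "(\<Sum>\<^sub>\<infinity>k\<in>S. f k - g k) = infsum f S - infsum g S"
  using infsum_add[OF assms(1), of "\<lambda>x. - g x"] assms(2) by (simp add: infsum_uminus summable_on_uminus)

lemma qconv_diff_kernel:
  assumes "l1 x" "l1 y" "\<And>n k. \<bar>K n k\<bar> \<le> A" "\<And>n k. \<bar>K' n k\<bar> \<le> A'"
  shows "qconv K x y n - qconv K' x y n = qconv (\<lambda>n k. K n k - K' n k) x y n"
  unfolding qconv_def
  using infsum_diff_real[OF qconv_summable(3)[where K = K and n = n, OF assms(1,2,3)] qconv_summable(3)[where K = K' and n = n, OF assms(1,2,4)]]
  by (simp add: left_diff_distrib)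

text \<open>
  Bilinearity in the form x x - x' x' = (x - x') x + x' (x - x'); all Lipschitz estimates of the
  quadratic terms start from it.
\<close>

lemma qconv_diff_square:
  assumes "l1 x" "l1 x'" "\<And>n k. \<bar>K n k\<bar> \<le> A"
  shows "qconv K x x n - qconv K x' x' n
     = qconv K (\<lambda>n. x n - x' n) x n + qconv K x' (\<lambda>n. x n - x' n) n"
proof -
  have d: "l1 (\<lambda>n. x n - x' n)" by (rule l1_diff[OF assms(1,2)])
  show ?thesis
    unfolding qconv_def
    using infsum_diff_real[OF qconv_summable(3)[where K = K and n = n, OF assms(1,1,3)] qconv_summable(3)[where K = K and n = n, OF assms(2,2,3)]]
      infsum_add[OF qconv_summable(3)[where K = K and n = n, OF d assms(1,3)] qconv_summable(3)[where K = K and n = n, OF assms(2) d assms(3)]]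
    by (simp add: algebra_simps)
qed

text \<open>
  The reflection n \<mapsto> -n swaps the balance equations at n and -n; hence only the modes n \<ge> 1 carry
  information, and the equation at n = 0 holds by oddness.
\<close>

lemma qconv_even_odd:
  assumes "\<And>n. x (- n) = x n" "\<And>n. y (- n) = y n" "\<And>n k. K (- n) (- k) = - K n k"
  shows "qconv K x y (- n) = - qconv K x y n"
proof -
  have "qconv K x y (- n) = (\<Sum>\<^sub>\<infinity>k. - (K n k * x k * y (n - k)))"
    unfolding qconv_def
  proof (rule infsum_reindex_bij_witness[where i = uminus and j = uminus])
    fix k :: int
    have "- n - k = - (n - (- k))" by simp
    then have "y (- n - k) = y (n - (- k))" using assms(2)[of "n - (- k)"] by simp
    then show "- (K n (- k) * x (- k) * y (n - - k)) = K (- n) k * x k * y (- n - k)"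
      using assms(1)[of k] assms(3)[of n "- k"] by simp
  qed auto
  then show ?thesis by (simp add: qconv_def infsum_uminus)
qed

text \<open>
  Picard iteration from 0. The iterates stay in an l1 ball and converge coordinatewise at a geometric
  rate; finite partial sums pass to the limit, so the limit stays in the ball, and contraction in the
  sup norm is enough to identify it as a fixed point. Evenness passes to the limit as well.
\<close>

lemma l1_fixed_point:
  fixes F :: "(int \<Rightarrow> real) \<Rightarrow> (int \<Rightarrow> real)"
  assumes M: "0 \<le> M" and q: "0 \<le> q" "q < 1"
    and maps: "\<And>x. l1 x \<Longrightarrow> l1norm x \<le> M \<Longrightarrow> (\<And>n. x (- n) = x n) \<Longrightarrow>
       l1 (F x) \<and> l1norm (F x) \<le> M \<and> (\<forall>n. F x (- n) = F x n)"
    and contr: "\<And>x y B n. \<lbrakk>l1 x; l1norm x \<le> M; l1 y; l1norm y \<le> M; \<And>n. x (- n) = x n; \<And>n. y (- n) = y n;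
        \<And>n. \<bar>x n - y n\<bar> \<le> B\<rbrakk> \<Longrightarrow> \<bar>F x n - F y n\<bar> \<le> q * B"
  obtains x where "l1 x" "l1norm x \<le> M" "\<And>n. x (- n) = x n" "F x = x"
proof -
  define X where "X k = (F ^^ k) (\<lambda>_. 0)" for k
  have X0: "X 0 n = 0" and XS: "X (Suc k) = F (X k)" for k n by (simp_all add: X_def)
  have XM: "l1 (X k) \<and> l1norm (X k) \<le> M \<and> (\<forall>n. X k (- n) = X k n)" for k
  proof (induction k)
    case 0
    then show ?case using M by (simp add: X_def l1_def l1norm_def)
  next
    case (Suc k)
    then show ?case using maps[of "X k"] by (simp add: XS)
  qed
  have step: "\<bar>X (Suc k) n - X k n\<bar> \<le> M * q ^ k" for k n
  proof (induction k arbitrary: n)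
    case 0
    have "\<bar>X 1 n\<bar> \<le> l1norm (X 1)" using XM[of 1] by (intro l1_abs_le) auto
    then show ?case using XM[of 1] by (simp add: X0)
  next
    case (Suc k)
    have "\<bar>F (X (Suc k)) n - F (X k) n\<bar> \<le> q * (M * q ^ k)"
      using XM[of k] XM[of "Suc k"] Suc.IH by (intro contr) auto
    then show ?case using XS[of k] XS[of "Suc k"] by (simp add: mult_ac)
  qed
  have geo: "summable (\<lambda>k. M * q ^ k)" using q by (intro summable_mult summable_geometric) auto
  define x where "x n = (\<Sum>k. X (Suc k) n - X k n)" for n
  have sm: "summable (\<lambda>k. \<bar>X (Suc k) n - X k n\<bar>)" for n
    by (rule summable_comparison_test'[OF geo]) (use step in auto)
  have part: "(\<Sum>j<k. X (Suc j) n - X j n) = X k n" for k n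
    using sum_lessThan_telescope[of "\<lambda>j. X j n" k] by (simp add: X0)
  have lim: "(\<lambda>k. X k n) \<longlonglongrightarrow> x n" for n
    using summable_LIMSEQ[OF summable_rabs_cancel[OF sm[of n]]] by (simp add: part x_def)
  have tail: "\<bar>x n - X k n\<bar> \<le> M / (1 - q) * q ^ k" for n k
  proof -
    have "x n - X k n = (\<Sum>j. X (Suc (j + k)) n - X (j + k) n)"
      using suminf_split_initial_segment[OF summable_rabs_cancel[OF sm[of n]], of k] by (simp add: part x_def)
    also have "\<bar>\<dots>\<bar> \<le> (\<Sum>j. \<bar>X (Suc (j + k)) n - X (j + k) n\<bar>)"
      using sm[of n] by (intro summable_rabs) (subst summable_iff_shift[of "\<lambda>j. \<bar>X (Suc j) n - X j n\<bar>" k], simp)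
    also have "\<dots> \<le> (\<Sum>j. M * q ^ k * q ^ j)"
    proof (rule suminf_le)
      show "\<bar>X (Suc (j + k)) n - X (j + k) n\<bar> \<le> M * q ^ k * q ^ j" for j
        using step[of "j + k" n] by (simp add: power_add mult_ac)
      show "summable (\<lambda>j. \<bar>X (Suc (j + k)) n - X (j + k) n\<bar>)"
        using sm[of n] by (subst summable_iff_shift[of "\<lambda>j. \<bar>X (Suc j) n - X j n\<bar>" k], simp)
      show "summable (\<lambda>j. M * q ^ k * q ^ j)"
        using q by (intro summable_mult summable_geometric) auto
    qed
    also have "\<dots> = M * q ^ k * (1 / (1 - q))"
      using q by (subst suminf_mult) (auto simp: suminf_geometric intro!: summable_geometric)
    also have "\<dots> = M / (1 - q) * q ^ k" by simp
    finally show ?thesis .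
  qed
  have x: "l1 x \<and> l1norm x \<le> M"
  proof -
    have "(\<Sum>n\<in>A. \<bar>x n\<bar>) \<le> M" if "finite A" for A
    proof (rule LIMSEQ_le_const2)
      show "(\<lambda>k. \<Sum>n\<in>A. \<bar>X k n\<bar>) \<longlonglongrightarrow> (\<Sum>n\<in>A. \<bar>x n\<bar>)"
        by (intro tendsto_sum tendsto_rabs lim)
      show "\<exists>N. \<forall>k\<ge>N. (\<Sum>n\<in>A. \<bar>X k n\<bar>) \<le> M"
        using XM l1_finite_le[OF _ that] by (meson order_trans)
    qed
    then show ?thesis using l1_finite_bound[of x M] by blast
  qed
  have sym: "x (- n) = x n" for n
    using LIMSEQ_unique[OF lim[of n]] lim[of "- n"] XM by simp
  have "F x n = x n" for n
  proof -
    have "(\<lambda>k. F x n - X (Suc k) n) \<longlonglongrightarrow> 0"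
    proof (rule Lim_null_comparison)
      have "\<bar>F x n - F (X k) n\<bar> \<le> q * (M / (1 - q) * q ^ k)" for k
        using x XM[of k] sym tail by (intro contr) auto
      then show "\<forall>\<^sub>F k in sequentially. norm (F x n - X (Suc k) n) \<le> q * (M / (1 - q) * q ^ k)"
        by (simp add: XS)
      show "(\<lambda>k. q * (M / (1 - q) * q ^ k)) \<longlonglongrightarrow> 0"
        using q by (intro tendsto_mult_right_zero LIMSEQ_realpow_zero) auto
    qed
    moreover have "(\<lambda>k. F x n - X (Suc k) n) \<longlonglongrightarrow> F x n - x n"
      by (intro tendsto_diff tendsto_const LIMSEQ_Suc lim)
    ultimately show ?thesis using LIMSEQ_unique by fastforce
  qed
  then show ?thesis using that[of x] x sym by auto
qed

section \<open>The higher modes\<close>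

text \<open>
  The exponent that remains after the rescaling u_n = t^|n| y_n: the product u_k u_(n-k) carries
  t^(|k| + |n-k|), which exceeds t^|n| by an even power, t^(2 excess n k). It vanishes exactly when k lies
  between 0 and n, that is, when no cancellation of frequencies takes place.
\<close>

definition excess :: "int \<Rightarrow> int \<Rightarrow> nat" where
  "excess n k = nat ((\<bar>k\<bar> + \<bar>n - k\<bar> - \<bar>n\<bar>) div 2)"

lemma excess_eq: "\<bar>k\<bar> + \<bar>n - k\<bar> = \<bar>n\<bar> + 2 * int (excess n k)"
proof -
  have "even (\<bar>k\<bar> + \<bar>n - k\<bar> - \<bar>n\<bar>)" by (auto simp: abs_if)
  moreover have "0 \<le> \<bar>k\<bar> + \<bar>n - k\<bar> - \<bar>n\<bar>" by auto
  ultimately show ?thesis unfolding excess_def by auto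
qed

lemma excess_minus: "excess (- n) (- k) = excess n k"
  using excess_eq[of "- k" "- n"] excess_eq[of k n] by linarith

lemma excess_eq_0_iff: "0 \<le> n \<Longrightarrow> excess n k = 0 \<longleftrightarrow> 0 \<le> k \<and> k \<le> n"
  using excess_eq[of k n] by linarith

text \<open>
  On [0, 1/2] the Lipschitz constant j 2^(1-j) of the j-th power is at most 1 for every j. The bound does
  not depend on j, so the rescaled kernels below are Lipschitz in \<tau> uniformly in n and k, although
  their exponents are unbounded.
\<close>

lemma power_lipschitz_half:
  fixes s t :: real
  assumes "0 \<le> s" "s \<le> 1/2" "0 \<le> t" "t \<le> 1/2"
  shows "\<bar>s ^ j - t ^ j\<bar> \<le> \<bar>s - t\<bar>"
proof -
  have "\<bar>s ^ j - t ^ j\<bar> \<le> \<bar>s - t\<bar> \<and> (j \<ge> 1 \<longrightarrow> s ^ j \<le> 1/2)"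
  proof (induction j)
    case (Suc j)
    show ?case
    proof (cases "j = 0")
      case False
      have "s ^ Suc j - t ^ Suc j = t * (s ^ j - t ^ j) + s ^ j * (s - t)" by (simp add: algebra_simps)
      also have "\<bar>\<dots>\<bar> \<le> t * \<bar>s ^ j - t ^ j\<bar> + s ^ j * \<bar>s - t\<bar>"
        using assms by (intro order_trans[OF abs_triangle_ineq]) (simp add: abs_mult)
      also have "\<dots> \<le> (1/2) * \<bar>s - t\<bar> + (1/2) * \<bar>s - t\<bar>"
        using assms Suc.IH False by (intro add_mono mult_mono) auto
      finally have "\<bar>s ^ Suc j - t ^ Suc j\<bar> \<le> \<bar>s - t\<bar>" by simp
      moreover have "s * s ^ j \<le> 1 * (1/2)" using assms Suc.IH False by (intro mult_mono) auto
      ultimately show ?thesis by simp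
    qed (use assms in auto)
  qed simp
  then show ?thesis by simp
qed

text \<open>
  The reduced problem: b l stands for a (l m), the Fourier coefficients of the potential along the
  multiples of m. A bounds the kernel, L bounds the inverse of the linear part on the modes l \<ge> 2
  together with its dependence on \<kappa>. The rescaled first mode is held at the fixed value \<rho>, which is so
  small that the quadratic map of the higher modes contracts: on the ball of radius 4\<rho> its Lipschitz
  constant is 8 A L \<rho> \<le> 1/2. With u_n = t^|n| y_n and y_1 = \<rho>, the amplitude of the solution is then
  governed by t alone.
\<close>

locale mode_system =
  fixes b :: "nat \<Rightarrow> real" and A L \<kappa>c \<eta>0 \<rho> :: real
  assumes b1: "b 1 > 0" and kc: "\<kappa>c = 2 / b 1"
    and bA: "\<And>l. l \<ge> 1 \<Longrightarrow> real l * \<bar>b l\<bar> \<le> A"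
    and eta0: "0 < \<eta>0" "\<eta>0 \<le> \<kappa>c / 2"
    and den: "\<And>\<kappa> l. \<bar>\<kappa> - \<kappa>c\<bar> \<le> \<eta>0 \<Longrightarrow> l \<ge> 2 \<Longrightarrow> 2 - \<kappa> * b l \<noteq> 0"
    and lam_le: "\<And>\<kappa> l. \<bar>\<kappa> - \<kappa>c\<bar> \<le> \<eta>0 \<Longrightarrow> l \<ge> 2 \<Longrightarrow> \<bar>\<kappa> / (2 - \<kappa> * b l)\<bar> \<le> L"
    and lam_lip: "\<And>\<kappa> \<kappa>' l. \<bar>\<kappa> - \<kappa>c\<bar> \<le> \<eta>0 \<Longrightarrow> \<bar>\<kappa>' - \<kappa>c\<bar> \<le> \<eta>0 \<Longrightarrow> l \<ge> 2 \<Longrightarrow>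
        \<bar>\<kappa> / (2 - \<kappa> * b l) - \<kappa>' / (2 - \<kappa>' * b l)\<bar> \<le> L * \<bar>\<kappa> - \<kappa>'\<bar>"
    and rho: "0 < \<rho>" "A * L * \<rho> \<le> 1/16"
begin

definition \<beta> :: "int \<Rightarrow> real" where "\<beta> k = of_int k * b (nat \<bar>k\<bar>)"

definition ker :: "real \<Rightarrow> int \<Rightarrow> int \<Rightarrow> real" where "ker \<tau> n k = \<beta> k * \<tau> ^ excess n k"

text \<open>
  The rescaled balance equations of all modes except 0 and \<plusminus>1, with \<tau> = t^2. Only \<tau> enters, not t:
  this is why both signs of the amplitude share the same coefficients.
\<close>

definition modes :: "real \<Rightarrow> real \<Rightarrow> (int \<Rightarrow> real) \<Rightarrow> bool" where
  "modes \<kappa> \<tau> y \<longleftrightarrow> (\<forall>n. \<bar>n\<bar> \<ge> 2 \<longrightarrow>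
     of_int n * (2 - \<kappa> * b (nat \<bar>n\<bar>)) * y n = \<kappa> * qconv (ker \<tau>) y y n)"

lemma A_pos: "0 < A" using bA[of 1] b1 by simp

lemma kc_pos: "0 < \<kappa>c" using b1 kc by simp

lemma L_nonneg: "0 \<le> L" using order_trans[OF abs_ge_zero lam_le[of \<kappa>c 2]] eta0 by simp

lemma beta_le: "\<bar>\<beta> k\<bar> \<le> A"
proof (cases "k = 0")
  case False
  then show ?thesis using bA[of "nat \<bar>k\<bar>"] by (simp add: \<beta>_def abs_mult)
qed (use A_pos in \<open>simp add: \<beta>_def\<close>)

lemma beta_minus: "\<beta> (- k) = - \<beta> k" by (simp add: \<beta>_def)

lemma ker_le: "0 \<le> \<tau> \<Longrightarrow> \<tau> \<le> 1 \<Longrightarrow> \<bar>ker \<tau> n k\<bar> \<le> A"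
  using mult_mono[OF beta_le[of k] power_le_one[of \<tau> "excess n k"]] A_pos
  by (simp add: ker_def abs_mult)

lemma modes_iff:
  assumes "\<bar>\<kappa> - \<kappa>c\<bar> \<le> \<eta>0"
  shows "modes \<kappa> \<tau> y \<longleftrightarrow> (\<forall>n. \<bar>n\<bar> \<ge> 2 \<longrightarrow>
     of_int n * y n = \<kappa> / (2 - \<kappa> * b (nat \<bar>n\<bar>)) * qconv (ker \<tau>) y y n)"
proof -
  have "2 - \<kappa> * b (nat \<bar>n\<bar>) \<noteq> 0" if "\<bar>n\<bar> \<ge> 2" for n
    using that by (intro den[OF assms]) linarith
  then show ?thesis unfolding modes_def by (auto simp: field_simps)
qed

lemma qconv_square_diff_le:
  assumes y: "l1 y" "l1norm y \<le> 4 * \<rho>" and y': "l1 y'" "l1norm y' \<le> 4 * \<rho>"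
    and K: "\<And>n k. \<bar>K n k\<bar> \<le> A" and K': "\<And>n k. \<bar>K' n k\<bar> \<le> A"
    and KK: "\<And>n k. \<bar>K n k - K' n k\<bar> \<le> A * T"
  defines "d \<equiv> \<lambda>n. y n - y' n"
  shows "l1 (\<lambda>n. qconv K y y n - qconv K' y' y' n)"
    and "l1norm (\<lambda>n. qconv K y y n - qconv K' y' y' n) \<le> A * (8 * \<rho> * l1norm d + 16 * \<rho>\<^sup>2 * T)"
proof -
  have d: "l1 d" unfolding d_def by (rule l1_diff[OF y(1) y'(1)])
  have T: "0 \<le> T" using order_trans[OF abs_ge_zero KK[of 0 0]] A_pos by (simp add: zero_le_mult_iff)
  define q where "q n = qconv K d y n + qconv K y' d n" for n
  define e where "e = qconv (\<lambda>n k. K n k - K' n k) y' y'"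
  have eq: "qconv K y y n - qconv K' y' y' n = q n + e n" for n
    using qconv_diff_square[where n = n and K = K, OF y(1) y'(1) K] qconv_diff_kernel[where n = n and K = K and K' = K', OF y'(1) y'(1) K K']
    by (simp add: q_def e_def d_def)
  note q1 = young_l1[where K = K, OF d y(1) K] and q2 = young_l1[where K = K, OF y'(1) d K]
    and e = young_l1[where K = "\<lambda>n k. K n k - K' n k", OF y'(1) y'(1) KK]
  note q = l1_add_le[where x = q and C = 1 and D = 1, OF q1(1) q2(1)]
  have q': "l1 q" "l1norm q \<le> l1norm (qconv K d y) + l1norm (qconv K y' d)"
    using q by (auto simp: q_def)
  note s = l1_add_le[where x = "\<lambda>n. q n + e n" and C = 1 and D = 1, OF q'(1) e(1)[folded e_def]]
  have s': "l1 (\<lambda>n. q n + e n)" "l1norm (\<lambda>n. q n + e n) \<le> l1norm q + l1norm e"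
    using s by auto
  show "l1 (\<lambda>n. qconv K y y n - qconv K' y' y' n)" unfolding eq by (rule s')
  have "A * (l1norm d * l1norm y) \<le> A * (l1norm d * (4 * \<rho>))"
    "A * (l1norm y' * l1norm d) \<le> A * (4 * \<rho> * l1norm d)"
    using A_pos y(2) y'(2) l1norm_nonneg[of d] by (intro mult_left_mono mult_right_mono; simp)+
  moreover have "A * T * (l1norm y' * l1norm y') \<le> A * T * ((4 * \<rho>) * (4 * \<rho>))"
    using A_pos T rho y'(2) l1norm_nonneg[of y'] by (intro mult_left_mono mult_mono) auto
  ultimately show "l1norm (\<lambda>n. qconv K y y n - qconv K' y' y' n) \<le> A * (8 * \<rho> * l1norm d + 16 * \<rho>\<^sup>2 * T)"
    unfolding eq using s'(2) q'(2) q1(2) q2(2) e(2)[folded e_def]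
    by (simp add: algebra_simps power2_eq_square)
qed

lemma qconv_square_le:
  assumes y: "l1 y" "l1norm y \<le> 4 * \<rho>" and K: "\<And>n k. \<bar>K n k\<bar> \<le> A"
  shows "l1 (qconv K y y)" and "l1norm (qconv K y y) \<le> A * (16 * \<rho>\<^sup>2)"
proof -
  show "l1 (qconv K y y)" by (rule young_l1[OF y(1) y(1) K])
  have "A * (l1norm y * l1norm y) \<le> A * ((4 * \<rho>) * (4 * \<rho>))"
    using A_pos y(2) rho l1norm_nonneg[of y] by (intro mult_left_mono mult_mono) auto
  then show "l1norm (qconv K y y) \<le> A * (16 * \<rho>\<^sup>2)"
    using young_l1(2)[where K = K, OF y(1) y(1) K] by (simp add: power2_eq_square)
qed

text \<open>
  Stability of the higher modes. Dividing the equation by n gains a factor 1/n, hence the difference is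
  controlled even with weight n, which on the function side is control of the derivative. The quantity T
  stands for the distance of the kernels: it is |\<tau> - \<tau>'| where the branch is constructed, and 0 at
  \<tau> = \<tau>' = 1, which is the uniqueness statement for unscaled coefficients.
\<close>

lemma mode_difference:
  assumes \<kappa>: "\<bar>\<kappa> - \<kappa>c\<bar> \<le> \<eta>0" "\<bar>\<kappa>' - \<kappa>c\<bar> \<le> \<eta>0"
    and \<tau>: "0 \<le> \<tau>" "\<tau> \<le> 1" "0 \<le> \<tau>'" "\<tau>' \<le> 1" and T: "\<And>j. \<bar>\<tau> ^ j - \<tau>' ^ j\<bar> \<le> T"
    and y: "l1 y" "l1norm y \<le> 4 * \<rho>" "modes \<kappa> \<tau> y"
    and y': "l1 y'" "l1norm y' \<le> 4 * \<rho>" "modes \<kappa>' \<tau>' y'"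
    and low: "y 0 = y' 0" "y 1 = y' 1" "y (-1) = y' (-1)"
  shows "l1 (\<lambda>n. of_int n * (y n - y' n))"
    and "l1norm (\<lambda>n. of_int n * (y n - y' n)) \<le> 2 * \<rho> * (T + \<bar>\<kappa> - \<kappa>'\<bar>)"
    and "l1norm (\<lambda>n. y n - y' n) \<le> 2 * \<rho> * (T + \<bar>\<kappa> - \<kappa>'\<bar>)"
proof -
  have T0: "0 \<le> T" using order_trans[OF abs_ge_zero T[of 0]] .
  define d where "d n = y n - y' n" for n
  define nd where "nd n = of_int n * d n" for n :: int
  define q where "q n = qconv (ker \<tau>) y y n - qconv (ker \<tau>') y' y' n" for n
  define q' where "q' = qconv (ker \<tau>') y' y'"
  have KK: "\<bar>ker \<tau> n k - ker \<tau>' n k\<bar> \<le> A * T" for n k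
    using mult_mono[OF beta_le[of k] T[of "excess n k"]] A_pos
    by (simp add: ker_def abs_mult right_diff_distrib[symmetric])
  note qq = qconv_square_diff_le[where K = "ker \<tau>" and K' = "ker \<tau>'", OF y(1,2) y'(1,2) ker_le[OF \<tau>(1,2)] ker_le[OF \<tau>(3,4)] KK,
      folded q_def d_def]
  note qq' = qconv_square_le[where K = "ker \<tau>'", OF y'(1,2) ker_le[OF \<tau>(3,4)], folded q'_def]
  have le: "\<bar>nd n\<bar> \<le> L * \<bar>q n\<bar> + (L * \<bar>\<kappa> - \<kappa>'\<bar>) * \<bar>q' n\<bar>" for n
  proof (cases "\<bar>n\<bar> \<ge> 2")
    case True
    then have n2: "nat \<bar>n\<bar> \<ge> 2" by linarith
    define l where "l = \<kappa> / (2 - \<kappa> * b (nat \<bar>n\<bar>))"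
    define l' where "l' = \<kappa>' / (2 - \<kappa>' * b (nat \<bar>n\<bar>))"
    have "of_int n * y n = l * qconv (ker \<tau>) y y n" "of_int n * y' n = l' * q' n"
      using y(3) y'(3) True modes_iff[OF \<kappa>(1)] modes_iff[OF \<kappa>(2)] unfolding l_def l'_def q'_def by blast+
    then have "nd n = l * q n + (l - l') * q' n"
      by (simp add: nd_def d_def q_def q'_def algebra_simps)
    also have "\<bar>\<dots>\<bar> \<le> \<bar>l\<bar> * \<bar>q n\<bar> + \<bar>l - l'\<bar> * \<bar>q' n\<bar>"
      by (intro order_trans[OF abs_triangle_ineq]) (simp add: abs_mult)
    also have "\<dots> \<le> L * \<bar>q n\<bar> + (L * \<bar>\<kappa> - \<kappa>'\<bar>) * \<bar>q' n\<bar>"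
      unfolding l_def l'_def using lam_le[OF \<kappa>(1) n2] lam_lip[OF \<kappa> n2]
      by (intro add_mono mult_right_mono) auto
    finally show ?thesis .
  next
    case False
    then have "n = 0 \<or> n = 1 \<or> n = -1" by linarith
    then have "nd n = 0" using low by (auto simp: nd_def d_def)
    then show ?thesis using L_nonneg by simp
  qed
  note nd = l1_add_le[where x = nd, OF qq(1) qq'(1) le]
  show "l1 (\<lambda>n. of_int n * (y n - y' n))" using nd(1) by (simp add: nd_def[abs_def] d_def)
  have dn: "\<bar>d n\<bar> \<le> 1 * \<bar>nd n\<bar>" for n
  proof (cases "n = 0")
    case False
    then have "1 \<le> \<bar>of_int n :: real\<bar>" by linarith
    then show ?thesis using mult_right_mono[of 1 "\<bar>of_int n :: real\<bar>" "\<bar>d n\<bar>"] by (simp add: nd_def abs_mult)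
  qed (use low in \<open>simp add: d_def\<close>)
  have dle: "l1norm d \<le> l1norm nd" using l1_cmult_le(2)[OF nd(1) dn] by simp
  have "l1norm nd \<le> L * (A * (8 * \<rho> * l1norm d + 16 * \<rho>\<^sup>2 * T)) + (L * \<bar>\<kappa> - \<kappa>'\<bar>) * (A * (16 * \<rho>\<^sup>2))"
    using L_nonneg by (intro order_trans[OF nd(2)] add_mono mult_left_mono qq(2) qq'(2)) auto
  also have "\<dots> = (A * L * \<rho>) * (8 * l1norm d + 16 * \<rho> * (T + \<bar>\<kappa> - \<kappa>'\<bar>))"
    by (simp add: algebra_simps power2_eq_square)
  \<comment> \<open>Half of the norm of d reappears on the right and is absorbed.\<close>
  also have "\<dots> \<le> 1/16 * (8 * l1norm d + 16 * \<rho> * (T + \<bar>\<kappa> - \<kappa>'\<bar>))"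
    using rho l1norm_nonneg[of d] T0 by (intro mult_right_mono add_nonneg_nonneg mult_nonneg_nonneg) auto
  finally have fin: "l1norm nd \<le> 2 * \<rho> * (T + \<bar>\<kappa> - \<kappa>'\<bar>)" using dle by simp
  then show "l1norm (\<lambda>n. of_int n * (y n - y' n)) \<le> 2 * \<rho> * (T + \<bar>\<kappa> - \<kappa>'\<bar>)"
    by (simp add: nd_def[abs_def] d_def)
  show "l1norm (\<lambda>n. y n - y' n) \<le> 2 * \<rho> * (T + \<bar>\<kappa> - \<kappa>'\<bar>)"
    using fin dle by (simp add: d_def[abs_def])
qed

lemma mode_solution_exists:
  assumes \<kappa>: "\<bar>\<kappa> - \<kappa>c\<bar> \<le> \<eta>0" and \<tau>: "0 \<le> \<tau>" "\<tau> \<le> 1"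
  obtains y where "l1 y" "l1norm y \<le> 4 * \<rho>" "modes \<kappa> \<tau> y" "\<And>n. y (- n) = y n"
    "y 0 = 0" "y 1 = \<rho>" "l1 (\<lambda>n. of_int n * y n)"
proof -
  define lam where "lam n = \<kappa> / (2 - \<kappa> * b (nat \<bar>n\<bar>)) / of_int n" for n
  define ind where "ind n = (if \<bar>n\<bar> = 1 then \<rho> else 0)" for n :: int
  define F where "F y n = (if \<bar>n\<bar> \<le> 1 then ind n else lam n * qconv (ker \<tau>) y y n)" for y n
  note K = ker_le[OF \<tau>]
  have lam: "\<bar>lam n\<bar> \<le> L" if "\<not> \<bar>n\<bar> \<le> 1" for n
  proof -
    have "1 \<le> \<bar>of_int n :: real\<bar>" using that by linarith
    then have "\<bar>\<kappa> / (2 - \<kappa> * b (nat \<bar>n\<bar>))\<bar> / \<bar>of_int n\<bar> \<le> L / 1"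
      using that by (intro frac_le lam_le[OF \<kappa>] L_nonneg) auto
    then show ?thesis by (simp add: lam_def abs_mult)
  qed
  have "\<bar>n\<bar> = 1 \<longleftrightarrow> n \<in> {-1, 1}" for n :: int by auto
  then have "ind = (\<lambda>n. if n \<in> {-1, 1} then \<rho> else 0)" by (simp add: ind_def[abs_def])
  then have ind_sum: "((\<lambda>n. \<bar>ind n\<bar>) has_sum (2 * \<rho>)) UNIV"
    using rho by (intro has_sum_finite_neutralI[of "{-1, 1}"]) auto
  then have ind: "l1 ind" "l1norm ind = 2 * \<rho>"
    unfolding l1_def l1norm_def by (auto intro: has_sum_imp_summable infsumI)
  have Fle: "\<bar>F y n\<bar> \<le> 1 * \<bar>ind n\<bar> + L * \<bar>qconv (ker \<tau>) y y n\<bar>" for y n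
    using lam[of n] L_nonneg mult_right_mono[of "\<bar>lam n\<bar>" L "\<bar>qconv (ker \<tau>) y y n\<bar>"]
    by (auto simp: F_def abs_mult)
  have maps: "l1 (F y) \<and> l1norm (F y) \<le> 4 * \<rho> \<and> (\<forall>n. F y (- n) = F y n)"
    if y: "l1 y" "l1norm y \<le> 4 * \<rho>" "\<And>n. y (- n) = y n" for y
  proof -
    note q = qconv_square_le[where K = "ker \<tau>", OF y(1,2) K]
    note f = l1_add_le[where x = "F y", OF ind(1) q(1) Fle]
    have "L * l1norm (qconv (ker \<tau>) y y) \<le> L * (A * (16 * \<rho>\<^sup>2))"
      by (rule mult_left_mono[OF q(2) L_nonneg])
    also have "\<dots> = (A * L * \<rho>) * (16 * \<rho>)" by (simp add: power2_eq_square)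
    also have "\<dots> \<le> 1/16 * (16 * \<rho>)" using rho by (intro mult_right_mono) auto
    finally have "l1norm (F y) \<le> 4 * \<rho>" using f(2) ind(2) rho by simp
    moreover have "F y (- n) = F y n" for n
    proof -
      have "qconv (ker \<tau>) y y (- n) = - qconv (ker \<tau>) y y n"
        by (rule qconv_even_odd[where x = y and y = y, OF y(3) y(3)]) (simp add: ker_def beta_minus excess_minus)
      then show ?thesis by (simp add: F_def ind_def lam_def)
    qed
    ultimately show ?thesis using f(1) by blast
  qed
  have contr: "\<bar>F x n - F y n\<bar> \<le> 1/2 * B"
    if x: "l1 x" "l1norm x \<le> 4 * \<rho>" and y: "l1 y" "l1norm y \<le> 4 * \<rho>"
      and ev: "\<And>n. x (- n) = x n" "\<And>n. y (- n) = y n" and B: "\<And>n. \<bar>x n - y n\<bar> \<le> B" for x y B n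
  proof (cases "\<bar>n\<bar> \<le> 1")
    case True
    then show ?thesis using order_trans[OF abs_ge_zero B[of 0]] by (simp add: F_def)
  next
    case False
    have B0: "0 \<le> B" using order_trans[OF abs_ge_zero B[of 0]] .
    have d: "l1 (\<lambda>n. x n - y n)" by (rule l1_diff[OF x(1) y(1)])
    have A0: "0 \<le> A" using A_pos by simp
    have e1: "\<bar>qconv (ker \<tau>) y (\<lambda>n. x n - y n) n\<bar> \<le> A * l1norm y * B"
      by (rule qconv_sup_le[where K = "ker \<tau>", OF y(1) d K A0 B])
    have e2: "\<bar>qconv (ker \<tau>) (\<lambda>n. x n - y n) x n\<bar> \<le> A * l1norm x * B"
      by (subst qconv_flip) (rule qconv_sup_le[where K = "\<lambda>n k. ker \<tau> n (n - k)", OF x(1) d K A0 B])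
    have "\<bar>qconv (ker \<tau>) x x n - qconv (ker \<tau>) y y n\<bar> \<le> A * l1norm x * B + A * l1norm y * B"
      using qconv_diff_square[where n = n and K = "ker \<tau>", OF x(1) y(1) K] e1 e2 by linarith
    also have "\<dots> \<le> A * (4 * \<rho>) * B + A * (4 * \<rho>) * B"
      using A0 B0 x(2) y(2) by (intro add_mono mult_right_mono mult_left_mono) auto
    finally have q: "\<bar>qconv (ker \<tau>) x x n - qconv (ker \<tau>) y y n\<bar> \<le> 8 * A * \<rho> * B" by (simp add: mult_ac)
    have "\<bar>F x n - F y n\<bar> = \<bar>lam n\<bar> * \<bar>qconv (ker \<tau>) x x n - qconv (ker \<tau>) y y n\<bar>"
      using False by (simp add: F_def right_diff_distrib[symmetric] abs_mult)
    also have "\<dots> \<le> L * (8 * A * \<rho> * B)"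
      using lam[OF False] q L_nonneg by (intro mult_mono) auto
    also have "\<dots> = (A * L * \<rho>) * (8 * B)" by simp
    also have "\<dots> \<le> 1/16 * (8 * B)" using rho B0 by (intro mult_right_mono) auto
    finally show ?thesis by simp
  qed
  obtain y where y: "l1 y" "l1norm y \<le> 4 * \<rho>" "\<And>n. y (- n) = y n" "F y = y"
    using l1_fixed_point[where F = F and M = "4 * \<rho>" and q = "1/2"] maps contr rho by force
  have low: "y 0 = 0" "y 1 = \<rho>" using fun_cong[OF y(4), of 0] fun_cong[OF y(4), of 1]
    by (auto simp: F_def ind_def)
  have eq: "of_int n * y n = \<kappa> / (2 - \<kappa> * b (nat \<bar>n\<bar>)) * qconv (ker \<tau>) y y n" if "\<bar>n\<bar> \<ge> 2" for n
  proof -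
    have "y n = lam n * qconv (ker \<tau>) y y n" using fun_cong[OF y(4), of n] that by (simp add: F_def)
    moreover have "(of_int n :: real) \<noteq> 0" using that by auto
    ultimately show ?thesis by (simp add: lam_def)
  qed
  have "\<bar>of_int n * y n\<bar> \<le> 1 * \<bar>ind n\<bar> + L * \<bar>qconv (ker \<tau>) y y n\<bar>" for n
  proof (cases "\<bar>n\<bar> \<ge> 2")
    case True
    then have "nat \<bar>n\<bar> \<ge> 2" by linarith
    then have "\<bar>of_int n * y n\<bar> \<le> L * \<bar>qconv (ker \<tau>) y y n\<bar>"
      unfolding eq[OF True] abs_mult by (intro mult_right_mono lam_le[OF \<kappa>]) auto
    then show ?thesis by simp
  next
    case False
    then have "n = 0 \<or> n = 1 \<or> n = -1" by linarith
    then show ?thesis using low y(3)[of 1] L_nonneg by (auto simp: ind_def)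
  qed
  then have "l1 (\<lambda>n. of_int n * y n)"
    by (rule l1_add_le(1)[OF ind(1) qconv_square_le(1)[where K = "ker \<tau>", OF y(1,2) K]])
  then show ?thesis
    using that[OF y(1,2) _ y(3) low] eq modes_iff[OF \<kappa>] by blast
qed

end

section \<open>A scalar bifurcation equation\<close>

text \<open>
  A bifurcation equation c (\<kappa>c - \<kappa>) = \<tau> g \<kappa> \<tau> in one real unknown \<tau> \<ge> 0, with g merely Lipschitz. Near
  (\<kappa>c, 0) the factor g keeps the sign of g \<kappa>c 0, so a positive root forces \<kappa>c - \<kappa> to have this sign:
  this decides between super- and subcritical. On that side the intermediate value theorem gives a root,
  and the difference quotients of \<tau> g \<kappa> \<tau> in \<tau> are bounded away from 0, which gives uniqueness and Lipschitz dependence. Freezing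
  g at \<tau> = 0 yields the leading term, with an error that is quadratic because \<tau> is of order |\<kappa> - \<kappa>c|.
\<close>

lemma scalar_branch:
  fixes g :: "real \<Rightarrow> real \<Rightarrow> real" and \<kappa>c \<eta>0 c C :: real
  assumes c: "0 < c" and \<eta>0: "0 < \<eta>0" and C: "0 \<le> C" and g0: "g \<kappa>c 0 \<noteq> 0"
    and lip: "\<And>\<kappa> \<kappa>' \<tau> \<tau>'. \<lbrakk>\<bar>\<kappa> - \<kappa>c\<bar> \<le> \<eta>0; \<bar>\<kappa>' - \<kappa>c\<bar> \<le> \<eta>0; 0 \<le> \<tau>; \<tau> \<le> 1/2; 0 \<le> \<tau>'; \<tau>' \<le> 1/2\<rbrakk>
      \<Longrightarrow> \<bar>g \<kappa> \<tau> - g \<kappa>' \<tau>'\<bar> \<le> C * (\<bar>\<kappa> - \<kappa>'\<bar> + \<bar>\<tau> - \<tau>'\<bar>)"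
  obtains \<eta> \<tau>1 D :: real and T :: "real \<Rightarrow> real"
  where "0 < \<eta>" "\<eta> \<le> \<eta>0" "0 < \<tau>1" "\<tau>1 \<le> 1/2" "0 < D"
    and "\<And>\<kappa>. \<lbrakk>\<bar>\<kappa> - \<kappa>c\<bar> \<le> \<eta>; 0 < (\<kappa>c - \<kappa>) * g \<kappa>c 0\<rbrakk> \<Longrightarrow>
          0 < T \<kappa> \<and> T \<kappa> \<le> \<tau>1 \<and> c * (\<kappa>c - \<kappa>) = T \<kappa> * g \<kappa> (T \<kappa>) \<and> T \<kappa> \<le> D * \<bar>\<kappa> - \<kappa>c\<bar>"
    and "\<And>\<kappa> \<tau>. \<lbrakk>\<bar>\<kappa> - \<kappa>c\<bar> \<le> \<eta>; 0 < \<tau>; \<tau> \<le> \<tau>1; c * (\<kappa>c - \<kappa>) = \<tau> * g \<kappa> \<tau>\<rbrakk> \<Longrightarrow>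
          0 < (\<kappa>c - \<kappa>) * g \<kappa>c 0 \<and> \<tau> = T \<kappa>"
    and "\<And>\<kappa> \<kappa>'. \<lbrakk>\<bar>\<kappa> - \<kappa>c\<bar> \<le> \<eta>; 0 < (\<kappa>c - \<kappa>) * g \<kappa>c 0; \<bar>\<kappa>' - \<kappa>c\<bar> \<le> \<eta>; 0 < (\<kappa>c - \<kappa>') * g \<kappa>c 0\<rbrakk> \<Longrightarrow>
          \<bar>T \<kappa> - T \<kappa>'\<bar> \<le> D * \<bar>\<kappa> - \<kappa>'\<bar>"
    and "\<And>\<kappa>. \<lbrakk>\<bar>\<kappa> - \<kappa>c\<bar> \<le> \<eta>; 0 < (\<kappa>c - \<kappa>) * g \<kappa>c 0\<rbrakk> \<Longrightarrow>
          \<bar>\<kappa> - \<kappa>c\<bar> \<le> D * (c * (\<kappa>c - \<kappa>) / g \<kappa> 0) \<and>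
          \<bar>T \<kappa> - c * (\<kappa>c - \<kappa>) / g \<kappa> 0\<bar> \<le> D * \<bar>\<kappa> - \<kappa>c\<bar>\<^sup>2"
proof -
  define \<sigma> where "\<sigma> = sgn (g \<kappa>c 0)"
  define \<gamma> where "\<gamma> = \<bar>g \<kappa>c 0\<bar>"
  \<comment> \<open>After multiplication by the sign of g at the critical point only the positive case remains.\<close>
  define f where "f \<kappa> \<tau> = \<sigma> * g \<kappa> \<tau>" for \<kappa> \<tau>
  have \<sigma>: "\<sigma> * \<sigma> = 1" "\<bar>\<sigma>\<bar> = 1" "g \<kappa>c 0 = \<sigma> * \<gamma>" and \<gamma>: "0 < \<gamma>"
    using g0 by (auto simp: \<sigma>_def \<gamma>_def sgn_real_def)
  have gf: "g \<kappa> \<tau> = \<sigma> * f \<kappa> \<tau>" for \<kappa> \<tau>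
    using \<sigma>(1) by (simp add: f_def mult.assoc[symmetric])
  have f_c: "f \<kappa>c 0 = \<gamma>" using \<sigma> by (simp add: f_def mult.assoc[symmetric])
  have flip: "\<bar>f \<kappa> \<tau> - f \<kappa>' \<tau>'\<bar> \<le> C * (\<bar>\<kappa> - \<kappa>'\<bar> + \<bar>\<tau> - \<tau>'\<bar>)"
    if "\<bar>\<kappa> - \<kappa>c\<bar> \<le> \<eta>0" "\<bar>\<kappa>' - \<kappa>c\<bar> \<le> \<eta>0" "0 \<le> \<tau>" "\<tau> \<le> 1/2" "0 \<le> \<tau>'" "\<tau>' \<le> 1/2" for \<kappa> \<kappa>' \<tau> \<tau>'
    using lip[OF that] \<sigma>(2) by (simp add: f_def right_diff_distrib[symmetric] abs_mult)
  \<comment> \<open>\<tau>1 and \<eta> keep f within a quarter of its critical value \<gamma>; the last bound on \<eta> makes \<tau>1 f \<kappa> \<tau>1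
    exceed the left side, so that the intermediate value theorem applies on [0, \<tau>1].\<close>
  define \<tau>1 where "\<tau>1 = min (1/2) (\<gamma> / (8 * (C + 1)))"
  define \<eta> where "\<eta> = min \<eta>0 (min (\<gamma> / (8 * (C + 1))) (\<gamma> * \<tau>1 / (2 * c)))"
  have t1: "0 < \<tau>1" "\<tau>1 \<le> 1/2" unfolding \<tau>1_def using \<gamma> C by (simp_all only: min_less_iff_conj min.cobounded1) simp
  have eta: "0 < \<eta>" "\<eta> \<le> \<eta>0" using \<gamma> C c t1 \<eta>0 by (auto simp: \<eta>_def)
  have "\<tau>1 \<le> \<gamma> / (8 * (C + 1))" "\<eta> \<le> \<gamma> / (8 * (C + 1))" "\<eta> \<le> \<gamma> * \<tau>1 / (2 * c)"
    by (auto simp: \<tau>1_def \<eta>_def)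
  then have ce: "(C + 1) * \<tau>1 \<le> \<gamma> / 8" "(C + 1) * \<eta> \<le> \<gamma> / 8" "c * \<eta> \<le> \<gamma> * \<tau>1 / 2"
    using C c by (simp_all add: field_simps)
  have Ct: "C * \<tau>1 \<le> \<gamma> / 8" "C * \<eta> \<le> \<gamma> / 8" using ce t1 eta by (simp_all add: distrib_right)
  have fb: "3/4 * \<gamma> \<le> f \<kappa> \<tau> \<and> f \<kappa> \<tau> \<le> 5/4 * \<gamma>" if "\<bar>\<kappa> - \<kappa>c\<bar> \<le> \<eta>" "0 \<le> \<tau>" "\<tau> \<le> \<tau>1" for \<kappa> \<tau>
  proof -
    have "\<bar>f \<kappa> \<tau> - f \<kappa>c 0\<bar> \<le> C * (\<bar>\<kappa> - \<kappa>c\<bar> + \<bar>\<tau> - 0\<bar>)"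
      using that eta t1 \<eta>0 by (intro flip) auto
    also have "\<dots> \<le> C * (\<eta> + \<tau>1)" using that C by (intro mult_left_mono) auto
    also have "\<dots> \<le> \<gamma> / 4" using Ct by (simp add: distrib_left)
    finally show ?thesis unfolding f_c by linarith
  qed
  have pos: "0 < (\<kappa>c - \<kappa>) * g \<kappa>c 0 \<longleftrightarrow> 0 < \<sigma> * (\<kappa>c - \<kappa>)" for \<kappa>
  proof -
    have "(\<kappa>c - \<kappa>) * g \<kappa>c 0 = \<sigma> * (\<kappa>c - \<kappa>) * \<gamma>" by (simp add: \<sigma>(3))
    then show ?thesis using \<gamma> zero_less_mult_pos2[of "\<sigma> * (\<kappa>c - \<kappa>)" \<gamma>] by (metis mult_pos_pos)
  qed
  have xabs: "\<sigma> * (\<kappa>c - \<kappa>) = \<bar>\<kappa> - \<kappa>c\<bar>" if "0 < \<sigma> * (\<kappa>c - \<kappa>)" for \<kappa>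
    using that \<sigma>(2) abs_mult[of \<sigma> "\<kappa>c - \<kappa>"] by (simp add: abs_minus_commute)
  have eqf: "c * (\<kappa>c - \<kappa>) = \<tau> * g \<kappa> \<tau> \<longleftrightarrow> c * (\<sigma> * (\<kappa>c - \<kappa>)) = \<tau> * f \<kappa> \<tau>" for \<kappa> \<tau>
  proof -
    have "\<sigma> \<noteq> 0" using \<sigma>(2) by auto
    have "c * (\<sigma> * (\<kappa>c - \<kappa>)) = \<tau> * f \<kappa> \<tau> \<longleftrightarrow> \<sigma> * (c * (\<kappa>c - \<kappa>)) = \<sigma> * (\<tau> * g \<kappa> \<tau>)"
      by (simp add: f_def mult_ac)
    then show ?thesis using \<open>\<sigma> \<noteq> 0\<close> by simp
  qed
  define act where "act \<kappa> \<longleftrightarrow> \<bar>\<kappa> - \<kappa>c\<bar> \<le> \<eta> \<and> 0 < \<sigma> * (\<kappa>c - \<kappa>)" for \<kappa>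
  have ex: "\<exists>\<tau>. 0 < \<tau> \<and> \<tau> \<le> \<tau>1 \<and> c * (\<sigma> * (\<kappa>c - \<kappa>)) = \<tau> * f \<kappa> \<tau>" if "act \<kappa>" for \<kappa>
  proof -
    define x where "x = \<sigma> * (\<kappa>c - \<kappa>)"
    have x: "0 < x" "x \<le> \<eta>" using that xabs[of \<kappa>] by (auto simp: act_def x_def)
    have k: "\<bar>\<kappa> - \<kappa>c\<bar> \<le> \<eta>" using that by (simp add: act_def)
    have "C-lipschitz_on {0..\<tau>1} (f \<kappa>)"
      using flip[of \<kappa> \<kappa>] k eta t1 C by (intro lipschitz_onI) (auto simp: dist_real_def)
    then have cont: "continuous_on {0..\<tau>1} (\<lambda>\<tau>. \<tau> * f \<kappa> \<tau>)"
      by (intro continuous_intros lipschitz_on_continuous_on)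
    have "c * x \<le> c * \<eta>" using x c by simp
    also have "\<dots> \<le> \<tau>1 * (3/4 * \<gamma>)" using ce(3) mult_pos_pos[OF \<gamma> t1(1)] by (simp add: mult_ac)
    also have "\<dots> \<le> \<tau>1 * f \<kappa> \<tau>1" using fb[OF k, of \<tau>1] t1 by simp
    finally have "\<exists>\<tau>\<ge>0. \<tau> \<le> \<tau>1 \<and> \<tau> * f \<kappa> \<tau> = c * x"
      using x c t1 by (intro IVT'[OF _ _ _ cont]) auto
    then obtain \<tau> where \<tau>: "0 \<le> \<tau>" "\<tau> \<le> \<tau>1" "\<tau> * f \<kappa> \<tau> = c * x" by auto
    then have "\<tau> \<noteq> 0" using mult_pos_pos[OF c x(1)] by auto
    then have "0 < \<tau> \<and> \<tau> \<le> \<tau>1 \<and> c * (\<sigma> * (\<kappa>c - \<kappa>)) = \<tau> * f \<kappa> \<tau>" using \<tau> by (simp add: x_def)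
    then show ?thesis by blast
  qed
  define T where "T \<kappa> = (SOME \<tau>. 0 < \<tau> \<and> \<tau> \<le> \<tau>1 \<and> c * (\<sigma> * (\<kappa>c - \<kappa>)) = \<tau> * f \<kappa> \<tau>)" for \<kappa>
  have T: "0 < T \<kappa>" "T \<kappa> \<le> \<tau>1" "c * (\<sigma> * (\<kappa>c - \<kappa>)) = T \<kappa> * f \<kappa> (T \<kappa>)" if "act \<kappa>" for \<kappa>
    using someI_ex[OF ex[OF that]] unfolding T_def by auto
  define D1 where "D1 = (c + \<gamma> / 4) * (2 / \<gamma>)"
  have D1: "0 < D1" using c \<gamma> by (simp add: D1_def)
  have stab: "\<bar>\<tau> - \<tau>'\<bar> \<le> D1 * \<bar>\<kappa> - \<kappa>'\<bar>"
    if k: "\<bar>\<kappa> - \<kappa>c\<bar> \<le> \<eta>" "\<bar>\<kappa>' - \<kappa>c\<bar> \<le> \<eta>" and t: "0 \<le> \<tau>" "\<tau> \<le> \<tau>1" "0 \<le> \<tau>'" "\<tau>' \<le> \<tau>1"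
      and e: "c * (\<sigma> * (\<kappa>c - \<kappa>)) = \<tau> * f \<kappa> \<tau>" "c * (\<sigma> * (\<kappa>c - \<kappa>')) = \<tau>' * f \<kappa>' \<tau>'" for \<kappa> \<kappa>' \<tau> \<tau>'
  proof -
    have d: "\<bar>f \<kappa> \<tau> - f \<kappa>' \<tau>'\<bar> \<le> C * (\<bar>\<kappa> - \<kappa>'\<bar> + \<bar>\<tau> - \<tau>'\<bar>)"
      using k t eta t1 by (intro flip) auto
    have "\<tau>' * \<bar>f \<kappa> \<tau> - f \<kappa>' \<tau>'\<bar> \<le> \<tau>1 * (C * (\<bar>\<kappa> - \<kappa>'\<bar> + \<bar>\<tau> - \<tau>'\<bar>))"
      using d t by (intro mult_mono) auto
    also have "\<dots> = (C * \<tau>1) * (\<bar>\<kappa> - \<kappa>'\<bar> + \<bar>\<tau> - \<tau>'\<bar>)" by simp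
    also have "\<dots> \<le> \<gamma> / 8 * (\<bar>\<kappa> - \<kappa>'\<bar> + \<bar>\<tau> - \<tau>'\<bar>)" using Ct by (intro mult_right_mono) auto
    finally have A: "\<tau>' * \<bar>f \<kappa> \<tau> - f \<kappa>' \<tau>'\<bar> \<le> \<gamma> / 8 * \<bar>\<kappa> - \<kappa>'\<bar> + \<gamma> / 8 * \<bar>\<tau> - \<tau>'\<bar>"
      by (simp add: distrib_left)
    have B: "3/4 * \<gamma> * \<bar>\<tau> - \<tau>'\<bar> \<le> f \<kappa> \<tau> * \<bar>\<tau> - \<tau>'\<bar>"
      using fb[OF k(1) t(1,2)] by (intro mult_right_mono) auto
    have "f \<kappa> \<tau> * (\<tau> - \<tau>') = c * \<sigma> * (\<kappa>' - \<kappa>) - \<tau>' * (f \<kappa> \<tau> - f \<kappa>' \<tau>')"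
      using e by (simp add: algebra_simps)
    then have "f \<kappa> \<tau> * \<bar>\<tau> - \<tau>'\<bar> = \<bar>c * \<sigma> * (\<kappa>' - \<kappa>) - \<tau>' * (f \<kappa> \<tau> - f \<kappa>' \<tau>')\<bar>"
      using fb[OF k(1) t(1,2)] \<gamma> abs_mult[of "f \<kappa> \<tau>" "\<tau> - \<tau>'"] by simp
    also have "\<dots> \<le> \<bar>c * \<sigma> * (\<kappa>' - \<kappa>)\<bar> + \<bar>\<tau>' * (f \<kappa> \<tau> - f \<kappa>' \<tau>')\<bar>" by (rule abs_triangle_ineq4)
    also have "\<dots> = c * \<bar>\<kappa> - \<kappa>'\<bar> + \<tau>' * \<bar>f \<kappa> \<tau> - f \<kappa>' \<tau>'\<bar>"
      using c \<sigma>(2) t by (simp add: abs_mult abs_minus_commute)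
    finally have C': "f \<kappa> \<tau> * \<bar>\<tau> - \<tau>'\<bar> \<le> c * \<bar>\<kappa> - \<kappa>'\<bar> + \<tau>' * \<bar>f \<kappa> \<tau> - f \<kappa>' \<tau>'\<bar>" .
    have nn: "0 \<le> \<gamma> * \<bar>\<kappa> - \<kappa>'\<bar>" "0 \<le> \<gamma> * \<bar>\<tau> - \<tau>'\<bar>" using \<gamma> by auto
    have "\<gamma> / 2 * \<bar>\<tau> - \<tau>'\<bar> \<le> (c + \<gamma> / 4) * \<bar>\<kappa> - \<kappa>'\<bar>"
      using A B C' nn by (simp add: distrib_right)
    then show ?thesis using \<gamma> by (simp add: D1_def field_simps)
  qed
  \<comment> \<open>D1 is the Lipschitz constant of T, D2 bounds T by |\<kappa> - \<kappa>c|, D3 bounds |\<kappa> - \<kappa>c| by the leading term,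
    and D4 is the quadratic error; one constant serves for all four.\<close>
  define D2 where "D2 = c / (3/4 * \<gamma>)"
  define D3 where "D3 = 5/4 * \<gamma> / c"
  define D4 where "D4 = D2\<^sup>2 * C / (3/4 * \<gamma>)"
  define D where "D = D1 + D2 + D3 + D4"
  have Dn: "0 \<le> D2" "0 \<le> D3" "0 \<le> D4" using c \<gamma> C by (auto simp: D2_def D3_def D4_def)
  have D: "0 < D" "D1 \<le> D" "D2 \<le> D" "D3 \<le> D" "D4 \<le> D" using D1 Dn by (auto simp: D_def)
  have Tle: "T \<kappa> \<le> D2 * \<bar>\<kappa> - \<kappa>c\<bar>" if "act \<kappa>" for \<kappa>
  proof -
    have "T \<kappa> * (3/4 * \<gamma>) \<le> T \<kappa> * f \<kappa> (T \<kappa>)"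
      using T[OF that] fb[of \<kappa> "T \<kappa>"] that by (intro mult_left_mono) (auto simp: act_def)
    also have "\<dots> = c * \<bar>\<kappa> - \<kappa>c\<bar>" using T(3)[OF that] xabs[of \<kappa>] that by (simp add: act_def)
    finally show ?thesis using \<gamma> by (simp add: D2_def field_simps)
  qed
  have amp: "c * (\<kappa>c - \<kappa>) / g \<kappa> 0 = c * \<bar>\<kappa> - \<kappa>c\<bar> / f \<kappa> 0" if "act \<kappa>" for \<kappa>
  proof -
    have "\<sigma> \<noteq> 0" using \<sigma>(2) by auto
    then have "c * (\<kappa>c - \<kappa>) / g \<kappa> 0 = (\<sigma> * (c * (\<kappa>c - \<kappa>))) / (\<sigma> * g \<kappa> 0)" by simp
    also have "\<dots> = c * (\<sigma> * (\<kappa>c - \<kappa>)) / f \<kappa> 0" by (simp add: f_def mult_ac)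
    finally show ?thesis using xabs[of \<kappa>] that by (simp add: act_def)
  qed
  show ?thesis
  proof (rule that[of \<eta> \<tau>1 D T, OF eta t1 D(1)])
    fix \<kappa> assume "\<bar>\<kappa> - \<kappa>c\<bar> \<le> \<eta>" "0 < (\<kappa>c - \<kappa>) * g \<kappa>c 0"
    then have a: "act \<kappa>" by (simp add: pos act_def)
    have "D2 * \<bar>\<kappa> - \<kappa>c\<bar> \<le> D * \<bar>\<kappa> - \<kappa>c\<bar>" using D by (intro mult_right_mono) auto
    then show "0 < T \<kappa> \<and> T \<kappa> \<le> \<tau>1 \<and> c * (\<kappa>c - \<kappa>) = T \<kappa> * g \<kappa> (T \<kappa>) \<and> T \<kappa> \<le> D * \<bar>\<kappa> - \<kappa>c\<bar>"
      using T[OF a] Tle[OF a] eqf[of \<kappa> "T \<kappa>"] by linarith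
  next
    fix \<kappa> \<tau> assume k: "\<bar>\<kappa> - \<kappa>c\<bar> \<le> \<eta>" and t: "0 < \<tau>" "\<tau> \<le> \<tau>1" and "c * (\<kappa>c - \<kappa>) = \<tau> * g \<kappa> \<tau>"
    then have e: "c * (\<sigma> * (\<kappa>c - \<kappa>)) = \<tau> * f \<kappa> \<tau>" by (simp add: eqf)
    have "0 < \<tau> * f \<kappa> \<tau>" using fb[OF k, of \<tau>] t \<gamma> by (intro mult_pos_pos) auto
    then have "0 < \<sigma> * (\<kappa>c - \<kappa>)" using c unfolding e[symmetric] by (simp add: zero_less_mult_iff)
    then have a: "act \<kappa>" using k by (simp add: act_def)
    then have "\<bar>\<tau> - T \<kappa>\<bar> \<le> D1 * \<bar>\<kappa> - \<kappa>\<bar>" using T[OF a] t e k by (intro stab) auto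
    then show "0 < (\<kappa>c - \<kappa>) * g \<kappa>c 0 \<and> \<tau> = T \<kappa>" using a by (simp add: pos act_def)
  next
    fix \<kappa> \<kappa>' assume "\<bar>\<kappa> - \<kappa>c\<bar> \<le> \<eta>" "0 < (\<kappa>c - \<kappa>) * g \<kappa>c 0" "\<bar>\<kappa>' - \<kappa>c\<bar> \<le> \<eta>" "0 < (\<kappa>c - \<kappa>') * g \<kappa>c 0"
    then have a: "act \<kappa>" "act \<kappa>'" by (simp_all add: pos act_def)
    have "\<bar>T \<kappa> - T \<kappa>'\<bar> \<le> D1 * \<bar>\<kappa> - \<kappa>'\<bar>"
      using a T[OF a(1)] T[OF a(2)] by (intro stab) (auto simp: act_def)
    also have "\<dots> \<le> D * \<bar>\<kappa> - \<kappa>'\<bar>" using D by (intro mult_right_mono) auto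
    finally show "\<bar>T \<kappa> - T \<kappa>'\<bar> \<le> D * \<bar>\<kappa> - \<kappa>'\<bar>" .
  next
    fix \<kappa> assume "\<bar>\<kappa> - \<kappa>c\<bar> \<le> \<eta>" "0 < (\<kappa>c - \<kappa>) * g \<kappa>c 0"
    then have a: "act \<kappa>" by (simp add: pos act_def)
    then have k: "\<bar>\<kappa> - \<kappa>c\<bar> \<le> \<eta>" by (simp add: act_def)
    define x where "x = \<bar>\<kappa> - \<kappa>c\<bar>"
    have x0: "0 \<le> x" by (simp add: x_def)
    have f0: "3/4 * \<gamma> \<le> f \<kappa> 0" "f \<kappa> 0 \<le> 5/4 * \<gamma>" using fb[OF k, of 0] t1 by auto
    then have f0p: "0 < f \<kappa> 0" using \<gamma> by linarith
    have "x \<le> D3 * (c * x / f \<kappa> 0)"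
    proof -
      have "x * f \<kappa> 0 \<le> x * (5/4 * \<gamma>)" using f0 x0 by (intro mult_left_mono) auto
      then show ?thesis using f0p c by (simp add: D3_def field_simps)
    qed
    also have "\<dots> \<le> D * (c * x / f \<kappa> 0)" using D f0p c x0 by (intro mult_right_mono) auto
    finally have 1: "x \<le> D * (c * x / f \<kappa> 0)" .
    have cx: "c * x = T \<kappa> * f \<kappa> (T \<kappa>)" using T(3)[OF a] xabs[of \<kappa>] a by (simp add: act_def x_def)
    have "T \<kappa> - c * x / f \<kappa> 0 = T \<kappa> * (f \<kappa> 0 - f \<kappa> (T \<kappa>)) / f \<kappa> 0"
      using f0p by (simp add: cx field_simps)
    also have "\<bar>\<dots>\<bar> = T \<kappa> * \<bar>f \<kappa> 0 - f \<kappa> (T \<kappa>)\<bar> / f \<kappa> 0"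
      using f0p T(1)[OF a] by (simp add: abs_mult)
    also have "\<dots> \<le> T \<kappa> * (C * T \<kappa>) / (3/4 * \<gamma>)"
    proof (intro frac_le mult_left_mono)
      show "\<bar>f \<kappa> 0 - f \<kappa> (T \<kappa>)\<bar> \<le> C * T \<kappa>"
        using flip[of \<kappa> \<kappa> 0 "T \<kappa>"] k eta t1 T(1,2)[OF a] by simp
    qed (use T(1)[OF a] C \<gamma> f0 in auto)
    also have "\<dots> = (T \<kappa>)\<^sup>2 * (C / (3/4 * \<gamma>))" by (simp add: power2_eq_square)
    also have "\<dots> \<le> (D2 * x)\<^sup>2 * (C / (3/4 * \<gamma>))"
      using T(1)[OF a] Tle[OF a] C \<gamma> by (intro mult_right_mono power_mono) (auto simp: x_def)
    also have "\<dots> = D4 * x\<^sup>2" by (simp add: D4_def power_mult_distrib)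
    also have "\<dots> \<le> D * x\<^sup>2" using D by (intro mult_right_mono) auto
    finally have "\<bar>T \<kappa> - c * x / f \<kappa> 0\<bar> \<le> D * x\<^sup>2" .
    with 1 show "\<bar>\<kappa> - \<kappa>c\<bar> \<le> D * (c * (\<kappa>c - \<kappa>) / g \<kappa> 0) \<and>
          \<bar>T \<kappa> - c * (\<kappa>c - \<kappa>) / g \<kappa> 0\<bar> \<le> D * \<bar>\<kappa> - \<kappa>c\<bar>\<^sup>2"
      unfolding amp[OF a] by (simp add: x_def)
  qed
qed

section \<open>Reduction to the critical mode\<close>

context mode_system
begin

text \<open>
  The rescaled coefficients on the branch, as a function of the two parameters \<kappa> and \<tau> = t^2; at \<tau> = 0
  they satisfy the convolution recursion.
\<close>

definition Y :: "real \<Rightarrow> real \<Rightarrow> int \<Rightarrow> real" where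
  "Y \<kappa> \<tau> = (SOME y. l1 y \<and> l1norm y \<le> 4 * \<rho> \<and> modes \<kappa> \<tau> y \<and> (\<forall>n. y (- n) = y n) \<and>
     y 0 = 0 \<and> y 1 = \<rho> \<and> l1 (\<lambda>n. of_int n * y n))"

text \<open>
  The convolution in the equation of mode 1, divided by \<tau>. The truncated subtraction is harmless: excess 1 k
  vanishes only for k = 0 and k = 1, and these two terms contain the factor y_0 = 0.
\<close>

definition "H \<kappa> \<tau> = qconv (\<lambda>n k. \<beta> k * \<tau> ^ (excess n k - 1)) (Y \<kappa> \<tau>) (Y \<kappa> \<tau>) 1"

lemma Y:
  assumes "\<bar>\<kappa> - \<kappa>c\<bar> \<le> \<eta>0" "0 \<le> \<tau>" "\<tau> \<le> 1"
  shows "l1 (Y \<kappa> \<tau>)" "l1norm (Y \<kappa> \<tau>) \<le> 4 * \<rho>" "modes \<kappa> \<tau> (Y \<kappa> \<tau>)" "\<And>n. Y \<kappa> \<tau> (- n) = Y \<kappa> \<tau> n"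
    "Y \<kappa> \<tau> 0 = 0" "Y \<kappa> \<tau> 1 = \<rho>" "l1 (\<lambda>n. of_int n * Y \<kappa> \<tau> n)"
proof -
  have "\<exists>y. l1 y \<and> l1norm y \<le> 4 * \<rho> \<and> modes \<kappa> \<tau> y \<and> (\<forall>n. y (- n) = y n) \<and>
     y 0 = 0 \<and> y 1 = \<rho> \<and> l1 (\<lambda>n. of_int n * y n)"
  proof (rule mode_solution_exists[OF assms])
    fix y assume y: "l1 y" "l1norm y \<le> 4 * \<rho>" "modes \<kappa> \<tau> y" "\<And>n. y (- n) = y n"
      "y 0 = 0" "y 1 = \<rho>" "l1 (\<lambda>n. of_int n * y n)"
    show ?thesis by (rule exI[of _ y]) (simp add: y)
  qed
  from someI_ex[OF this, folded Y_def]
  show "l1 (Y \<kappa> \<tau>)" "l1norm (Y \<kappa> \<tau>) \<le> 4 * \<rho>" "modes \<kappa> \<tau> (Y \<kappa> \<tau>)" "\<And>n. Y \<kappa> \<tau> (- n) = Y \<kappa> \<tau> n"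
    "Y \<kappa> \<tau> 0 = 0" "Y \<kappa> \<tau> 1 = \<rho>" "l1 (\<lambda>n. of_int n * Y \<kappa> \<tau> n)"
    by simp_all
qed

lemma Y_minus_one:
  assumes "\<bar>\<kappa> - \<kappa>c\<bar> \<le> \<eta>0" "0 \<le> \<tau>" "\<tau> \<le> 1"
  shows "Y \<kappa> \<tau> (-1) = \<rho>"
  using Y(4)[OF assms, of 1] Y(6)[OF assms] by simp

lemma Y_lipschitz:
  assumes "\<bar>\<kappa> - \<kappa>c\<bar> \<le> \<eta>0" "0 \<le> \<tau>" "\<tau> \<le> 1/2" "\<bar>\<kappa>' - \<kappa>c\<bar> \<le> \<eta>0" "0 \<le> \<tau>'" "\<tau>' \<le> 1/2"
  shows "l1 (\<lambda>n. of_int n * (Y \<kappa> \<tau> n - Y \<kappa>' \<tau>' n))"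
    and "l1norm (\<lambda>n. of_int n * (Y \<kappa> \<tau> n - Y \<kappa>' \<tau>' n)) \<le> 2 * \<rho> * (\<bar>\<tau> - \<tau>'\<bar> + \<bar>\<kappa> - \<kappa>'\<bar>)"
    and "l1norm (\<lambda>n. Y \<kappa> \<tau> n - Y \<kappa>' \<tau>' n) \<le> 2 * \<rho> * (\<bar>\<tau> - \<tau>'\<bar> + \<bar>\<kappa> - \<kappa>'\<bar>)"
proof -
  have t: "\<tau> \<le> 1" "\<tau>' \<le> 1" using assms by auto
  note a = assms(1,2) t(1) and a' = assms(4,5) t(2)
  note m = mode_difference[OF assms(1,4,2) t(1) assms(5) t(2) power_lipschitz_half[OF assms(2,3,5,6)]
      Y(1,2,3)[OF a] Y(1,2,3)[OF a']]
  show "l1 (\<lambda>n. of_int n * (Y \<kappa> \<tau> n - Y \<kappa>' \<tau>' n))"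
    "l1norm (\<lambda>n. of_int n * (Y \<kappa> \<tau> n - Y \<kappa>' \<tau>' n)) \<le> 2 * \<rho> * (\<bar>\<tau> - \<tau>'\<bar> + \<bar>\<kappa> - \<kappa>'\<bar>)"
    "l1norm (\<lambda>n. Y \<kappa> \<tau> n - Y \<kappa>' \<tau>' n) \<le> 2 * \<rho> * (\<bar>\<tau> - \<tau>'\<bar> + \<bar>\<kappa> - \<kappa>'\<bar>)"
    using m Y(5,6)[OF a] Y(5,6)[OF a'] Y_minus_one[OF a] Y_minus_one[OF a'] by simp_all
qed

lemma hker_le: "0 \<le> \<tau> \<Longrightarrow> \<tau> \<le> 1 \<Longrightarrow> \<bar>\<beta> k * \<tau> ^ (excess n k - 1)\<bar> \<le> A"
  using mult_mono[OF beta_le[of k] power_le_one[of \<tau> "excess n k - 1"]] A_pos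
  by (simp add: abs_mult)

lemma H_factor:
  assumes "\<bar>\<kappa> - \<kappa>c\<bar> \<le> \<eta>0" "0 \<le> \<tau>" "\<tau> \<le> 1"
  shows "qconv (ker \<tau>) (Y \<kappa> \<tau>) (Y \<kappa> \<tau>) 1 = \<tau> * H \<kappa> \<tau>"
proof -
  have "ker \<tau> 1 k * Y \<kappa> \<tau> k * Y \<kappa> \<tau> (1 - k)
     = \<tau> * (\<beta> k * \<tau> ^ (excess 1 k - 1) * Y \<kappa> \<tau> k * Y \<kappa> \<tau> (1 - k))" for k
  proof (cases "k = 0 \<or> k = 1")
    case True
    then show ?thesis using Y(5)[OF assms] by auto
  next
    case False
    then have "excess 1 k \<noteq> 0" using excess_eq_0_iff[of 1 k] by auto
    then obtain j where "excess 1 k = Suc j" using not0_implies_Suc by blast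
    then show ?thesis by (simp add: ker_def)
  qed
  then show ?thesis unfolding H_def qconv_def by (simp only: infsum_cmult_right')
qed

lemma H_lipschitz:
  assumes "\<bar>\<kappa> - \<kappa>c\<bar> \<le> \<eta>0" "0 \<le> \<tau>" "\<tau> \<le> 1/2" "\<bar>\<kappa>' - \<kappa>c\<bar> \<le> \<eta>0" "0 \<le> \<tau>'" "\<tau>' \<le> 1/2"
  shows "\<bar>H \<kappa> \<tau> - H \<kappa>' \<tau>'\<bar> \<le> 32 * A * \<rho>\<^sup>2 * (\<bar>\<kappa> - \<kappa>'\<bar> + \<bar>\<tau> - \<tau>'\<bar>)"
    and "\<bar>H \<kappa> \<tau>\<bar> \<le> 16 * A * \<rho>\<^sup>2"
proof -
  have t: "\<tau> \<le> 1" "\<tau>' \<le> 1" using assms by auto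
  note a = assms(1,2) t(1) and a' = assms(4,5) t(2)
  define K where "K \<tau> n k = \<beta> k * \<tau> ^ (excess n k - 1)" for \<tau> n k
  have K: "\<bar>K \<tau> n k\<bar> \<le> A" "\<bar>K \<tau>' n k\<bar> \<le> A" for n k
    using hker_le assms t by (auto simp: K_def)
  have KK: "\<bar>K \<tau> n k - K \<tau>' n k\<bar> \<le> A * \<bar>\<tau> - \<tau>'\<bar>" for n k
    using mult_mono[OF beta_le[of k] power_lipschitz_half[OF assms(2,3,5,6), of "excess n k - 1"]] A_pos
    by (simp add: K_def abs_mult right_diff_distrib[symmetric])
  note q = qconv_square_diff_le[where K = "K \<tau>" and K' = "K \<tau>'", OF Y(1,2)[OF a] Y(1,2)[OF a'] K KK]
  have "\<bar>H \<kappa> \<tau> - H \<kappa>' \<tau>'\<bar> \<le> A * (8 * \<rho> * l1norm (\<lambda>n. Y \<kappa> \<tau> n - Y \<kappa>' \<tau>' n) + 16 * \<rho>\<^sup>2 * \<bar>\<tau> - \<tau>'\<bar>)"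
    using order_trans[OF l1_abs_le[OF q(1), of 1] q(2)] by (simp add: H_def K_def[abs_def])
  also have "\<dots> \<le> A * (8 * \<rho> * (2 * \<rho> * (\<bar>\<tau> - \<tau>'\<bar> + \<bar>\<kappa> - \<kappa>'\<bar>)) + 16 * \<rho>\<^sup>2 * (\<bar>\<tau> - \<tau>'\<bar> + \<bar>\<kappa> - \<kappa>'\<bar>))"
    using A_pos rho Y_lipschitz(3)[OF assms] by (intro mult_left_mono add_mono) auto
  also have "\<dots> = 32 * A * \<rho>\<^sup>2 * (\<bar>\<kappa> - \<kappa>'\<bar> + \<bar>\<tau> - \<tau>'\<bar>)"
    by (simp add: algebra_simps power2_eq_square)
  finally show "\<bar>H \<kappa> \<tau> - H \<kappa>' \<tau>'\<bar> \<le> 32 * A * \<rho>\<^sup>2 * (\<bar>\<kappa> - \<kappa>'\<bar> + \<bar>\<tau> - \<tau>'\<bar>)" .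
  note q' = qconv_square_le[where K = "K \<tau>", OF Y(1,2)[OF a] K(1)]
  show "\<bar>H \<kappa> \<tau>\<bar> \<le> 16 * A * \<rho>\<^sup>2"
    using order_trans[OF l1_abs_le[OF q'(1), of 1] q'(2)] by (simp add: H_def K_def[abs_def])
qed

text \<open>
  At \<tau> = 0 only the terms with excess n k = 0 survive, and these are the terms 0 \<le> k \<le> n. The infinite
  convolution thereby collapses to a finite sum over modes below n, a recursion.
\<close>

lemma Y_recursion:
  assumes k: "\<bar>\<kappa> - \<kappa>c\<bar> \<le> \<eta>0" and l: "l \<ge> 2"
  shows "real l * (2 - \<kappa> * b l) * Y \<kappa> 0 (int l)
     = \<kappa> * (\<Sum>j=1..l-1. real j * b j * Y \<kappa> 0 (int j) * Y \<kappa> 0 (int (l - j)))"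
proof -
  note y = Y[OF k order_refl zero_le_one]
  have "((\<lambda>k. ker 0 (int l) k * Y \<kappa> 0 k * Y \<kappa> 0 (int l - k)) has_sum
      (\<Sum>k\<in>int ` {1..l-1}. ker 0 (int l) k * Y \<kappa> 0 k * Y \<kappa> 0 (int l - k))) UNIV"
  proof (rule has_sum_finite_neutralI)
    fix k assume "k \<in> UNIV - int ` {1..l-1}"
    then have "k \<notin> int ` {1..l-1}" by simp
    show "ker 0 (int l) k * Y \<kappa> 0 k * Y \<kappa> 0 (int l - k) = 0"
    proof (cases "0 \<le> k \<and> k \<le> int l")
      case True
      have "k = 0 \<or> k = int l"
      proof (rule ccontr)
        assume "\<not> ?thesis"
        then have "nat k \<in> {1..l-1}" using True by auto
        then have "k \<in> int ` {1..l-1}" using True by (intro image_eqI[of _ _ "nat k"]) auto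
        then show False using \<open>k \<notin> int ` {1..l-1}\<close> by simp
      qed
      then show ?thesis by (elim disjE) (simp_all add: y(5))
    next
      case False
      then have "excess (int l) k \<noteq> 0" using excess_eq_0_iff[of "int l" k] by simp
      then show ?thesis by (simp add: ker_def)
    qed
  qed simp_all
  then have "qconv (ker 0) (Y \<kappa> 0) (Y \<kappa> 0) (int l)
     = (\<Sum>k\<in>int ` {1..l-1}. ker 0 (int l) k * Y \<kappa> 0 k * Y \<kappa> 0 (int l - k))"
    unfolding qconv_def by (rule infsumI)
  also have "\<dots> = (\<Sum>j=1..l-1. ker 0 (int l) (int j) * Y \<kappa> 0 (int j) * Y \<kappa> 0 (int l - int j))"
    by (simp add: sum.reindex)
  also have "\<dots> = (\<Sum>j=1..l-1. real j * b j * Y \<kappa> 0 (int j) * Y \<kappa> 0 (int (l - j)))"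
  proof (rule sum.cong)
    fix j assume "j \<in> {1..l-1}"
    then have "j \<le> l" by (simp, linarith)
    then have e: "excess (int l) (int j) = 0" and d: "int l - int j = int (l - j)"
      using excess_eq_0_iff[of "int l" "int j"] by simp_all
    show "ker 0 (int l) (int j) * Y \<kappa> 0 (int j) * Y \<kappa> 0 (int l - int j)
        = real j * b j * Y \<kappa> 0 (int j) * Y \<kappa> 0 (int (l - j))"
      unfolding d ker_def \<beta>_def e by simp
  qed simp
  finally have q: "qconv (ker 0) (Y \<kappa> 0) (Y \<kappa> 0) (int l) = \<dots>" .
  have "\<bar>int l\<bar> \<ge> 2" using l by auto
  then have "of_int (int l) * (2 - \<kappa> * b (nat \<bar>int l\<bar>)) * Y \<kappa> 0 (int l)
      = \<kappa> * qconv (ker 0) (Y \<kappa> 0) (Y \<kappa> 0) (int l)"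
    by (rule y(3)[unfolded modes_def, rule_format])
  then show ?thesis by (simp add: q)
qed

text \<open>
  For mode 1 and \<tau> = 0 the terms of excess exactly 1 survive, k = -1 and k = 2, and both contain mode 2,
  which the recursion expresses through mode 1. The factor 2 b_2 - b_1 is the numerator of the quantity whose
  sign decides the direction of the bifurcation.
\<close>

lemma H_0:
  assumes k: "\<bar>\<kappa> - \<kappa>c\<bar> \<le> \<eta>0"
  shows "H \<kappa> 0 = (2 * b 2 - b 1) * \<rho> ^ 3 * \<kappa> * b 1 / (2 * (2 - \<kappa> * b 2))"
proof -
  note y = Y[OF k order_refl zero_le_one]
  note y1 = Y_minus_one[OF k order_refl zero_le_one]
  have e: "excess 1 (-1) = 1" "excess 1 2 = 1" by (simp_all add: excess_def)
  have "((\<lambda>k. \<beta> k * 0 ^ (excess 1 k - 1) * Y \<kappa> 0 k * Y \<kappa> 0 (1 - k)) has_sum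
      (\<Sum>k\<in>{-1, 2}. \<beta> k * 0 ^ (excess 1 k - 1) * Y \<kappa> 0 k * Y \<kappa> 0 (1 - k))) UNIV"
  proof (rule has_sum_finite_neutralI)
    fix k :: int assume k: "k \<in> UNIV - {-1, 2}"
    show "\<beta> k * 0 ^ (excess 1 k - 1) * Y \<kappa> 0 k * Y \<kappa> 0 (1 - k) = 0"
    proof (cases "k = 0 \<or> k = 1")
      case True
      then show ?thesis using y(5) by auto
    next
      case False
      then have "k \<ge> 3 \<or> k \<le> -2" using k by auto
      then have "excess 1 k \<ge> 2" using excess_eq[of k 1] by linarith
      then show ?thesis by simp
    qed
  qed auto
  then have "H \<kappa> 0 = (\<Sum>k\<in>{-1, 2}. \<beta> k * 0 ^ (excess 1 k - 1) * Y \<kappa> 0 k * Y \<kappa> 0 (1 - k))"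
    unfolding H_def qconv_def by (rule infsumI)
  also have "\<dots> = (2 * b 2 - b 1) * \<rho> * Y \<kappa> 0 2"
    using y1 by (simp add: e \<beta>_def algebra_simps)
  finally have H: "H \<kappa> 0 = (2 * b 2 - b 1) * \<rho> * Y \<kappa> 0 2" .
  have "2 * (2 - \<kappa> * b 2) * Y \<kappa> 0 2 = \<kappa> * b 1 * \<rho>\<^sup>2"
    using Y_recursion[OF k, of 2] y(6) by (simp add: power2_eq_square)
  moreover have "2 - \<kappa> * b 2 \<noteq> 0" using den[OF k, of 2] by simp
  ultimately have "Y \<kappa> 0 2 = \<kappa> * b 1 * \<rho>\<^sup>2 / (2 * (2 - \<kappa> * b 2))"
    by (simp add: nonzero_eq_divide_eq mult.commute)
  then have "H \<kappa> 0 = (2 * b 2 - b 1) * \<rho> * (\<kappa> * b 1 * \<rho>\<^sup>2) / (2 * (2 - \<kappa> * b 2))" unfolding H by simp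
  also have "(2 * b 2 - b 1) * \<rho> * (\<kappa> * b 1 * \<rho>\<^sup>2) = (2 * b 2 - b 1) * \<rho> ^ 3 * \<kappa> * b 1"
    by (simp only: power2_eq_square power3_eq_cube mult_ac)
  finally show ?thesis .
qed

text \<open>
  The unscaled equations of all modes; modes 1 is the same system without n = 0 and n = \<plusminus>1.
\<close>

definition balance :: "real \<Rightarrow> (int \<Rightarrow> real) \<Rightarrow> bool" where
  "balance \<kappa> u \<longleftrightarrow> (\<forall>n. of_int n * (2 - \<kappa> * b (nat \<bar>n\<bar>)) * u n = \<kappa> * qconv (\<lambda>n. \<beta>) u u n)"

lemma qconv_scaled:
  "qconv (\<lambda>n. \<beta>) (\<lambda>n. t ^ nat \<bar>n\<bar> * y n) (\<lambda>n. t ^ nat \<bar>n\<bar> * y n) n = t ^ nat \<bar>n\<bar> * qconv (ker (t\<^sup>2)) y y n"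
proof -
  have "t ^ nat \<bar>k\<bar> * t ^ nat \<bar>n - k\<bar> = t ^ nat \<bar>n\<bar> * (t\<^sup>2) ^ excess n k" for k
  proof -
    have "nat \<bar>k\<bar> + nat \<bar>n - k\<bar> = nat \<bar>n\<bar> + 2 * excess n k" using excess_eq[of k n] by linarith
    then show ?thesis by (simp add: power_add[symmetric] power_mult[symmetric])
  qed
  note pw = this
  have "\<beta> k * (t ^ nat \<bar>k\<bar> * y k) * (t ^ nat \<bar>n - k\<bar> * y (n - k))
     = t ^ nat \<bar>n\<bar> * (ker (t\<^sup>2) n k * y k * y (n - k))" for k
  proof -
    have "\<beta> k * (t ^ nat \<bar>k\<bar> * y k) * (t ^ nat \<bar>n - k\<bar> * y (n - k))
       = (t ^ nat \<bar>k\<bar> * t ^ nat \<bar>n - k\<bar>) * (\<beta> k * y k * y (n - k))" by (simp only: mult_ac)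
    then show ?thesis unfolding pw ker_def by (simp only: mult_ac)
  qed
  then show ?thesis unfolding qconv_def by (simp only: infsum_cmult_right')
qed

text \<open>
  The coefficient sequence of a point on the branch with amplitude parameter t, of either sign.
\<close>

definition scaled :: "real \<Rightarrow> real \<Rightarrow> int \<Rightarrow> real" where
  "scaled \<kappa> t n = t ^ nat \<bar>n\<bar> * Y \<kappa> (t\<^sup>2) n"

lemma scaled:
  assumes k: "\<bar>\<kappa> - \<kappa>c\<bar> \<le> \<eta>0" and t: "\<bar>t\<bar> \<le> 1"
  shows "l1 (scaled \<kappa> t)" "l1norm (scaled \<kappa> t) \<le> 4 * \<rho>" "\<And>n. scaled \<kappa> t (- n) = scaled \<kappa> t n"
    "scaled \<kappa> t 0 = 0" "scaled \<kappa> t 1 = \<rho> * t" "l1 (\<lambda>n. of_int n * scaled \<kappa> t n)"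
    "\<And>n. \<bar>n\<bar> \<ge> 2 \<Longrightarrow> of_int n * (2 - \<kappa> * b (nat \<bar>n\<bar>)) * scaled \<kappa> t n
        = \<kappa> * qconv (\<lambda>n. \<beta>) (scaled \<kappa> t) (scaled \<kappa> t) n"
    "qconv (\<lambda>n. \<beta>) (scaled \<kappa> t) (scaled \<kappa> t) 1 = t ^ 3 * H \<kappa> (t\<^sup>2)"
proof -
  have t2: "0 \<le> t\<^sup>2" "t\<^sup>2 \<le> 1" using t by (auto simp: abs_square_le_1)
  note y = Y[OF k t2]
  have tn: "\<bar>t ^ j\<bar> \<le> 1" for j using t by (simp add: power_abs power_le_one)
  have le: "\<bar>scaled \<kappa> t n\<bar> \<le> 1 * \<bar>Y \<kappa> (t\<^sup>2) n\<bar>" for n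
    unfolding scaled_def abs_mult by (intro mult_right_mono tn) auto
  then have le': "\<bar>of_int n * scaled \<kappa> t n\<bar> \<le> 1 * \<bar>of_int n * Y \<kappa> (t\<^sup>2) n\<bar>" for n
    using mult_left_mono[OF le, of "\<bar>of_int n :: real\<bar>" n] by (simp add: abs_mult)
  show "l1 (scaled \<kappa> t)" "l1norm (scaled \<kappa> t) \<le> 4 * \<rho>" "l1 (\<lambda>n. of_int n * scaled \<kappa> t n)"
    using l1_cmult_le[OF y(1) le] l1_cmult_le(1)[OF y(7) le'] y(2) by auto
  show "scaled \<kappa> t (- n) = scaled \<kappa> t n" for n using y(4) by (simp add: scaled_def)
  show "scaled \<kappa> t 0 = 0" "scaled \<kappa> t 1 = \<rho> * t" using y(5,6) by (auto simp: scaled_def)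
  have q: "qconv (\<lambda>n. \<beta>) (scaled \<kappa> t) (scaled \<kappa> t) n
      = t ^ nat \<bar>n\<bar> * qconv (ker (t\<^sup>2)) (Y \<kappa> (t\<^sup>2)) (Y \<kappa> (t\<^sup>2)) n" for n
    unfolding scaled_def[abs_def] by (rule qconv_scaled)
  show "of_int n * (2 - \<kappa> * b (nat \<bar>n\<bar>)) * scaled \<kappa> t n
        = \<kappa> * qconv (\<lambda>n. \<beta>) (scaled \<kappa> t) (scaled \<kappa> t) n" if "\<bar>n\<bar> \<ge> 2" for n
  proof -
    have "of_int n * (2 - \<kappa> * b (nat \<bar>n\<bar>)) * Y \<kappa> (t\<^sup>2) n = \<kappa> * qconv (ker (t\<^sup>2)) (Y \<kappa> (t\<^sup>2)) (Y \<kappa> (t\<^sup>2)) n"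
      by (rule y(3)[unfolded modes_def, rule_format, OF that])
    then have "t ^ nat \<bar>n\<bar> * (of_int n * (2 - \<kappa> * b (nat \<bar>n\<bar>)) * Y \<kappa> (t\<^sup>2) n)
        = t ^ nat \<bar>n\<bar> * (\<kappa> * qconv (ker (t\<^sup>2)) (Y \<kappa> (t\<^sup>2)) (Y \<kappa> (t\<^sup>2)) n)" by (simp only:)
    then show ?thesis unfolding q scaled_def by (simp only: mult_ac)
  qed
  show "qconv (\<lambda>n. \<beta>) (scaled \<kappa> t) (scaled \<kappa> t) 1 = t ^ 3 * H \<kappa> (t\<^sup>2)"
    unfolding q H_factor[OF k t2] by (simp add: power2_eq_square power3_eq_cube)
qed

lemma scaled_balance:
  assumes k: "\<bar>\<kappa> - \<kappa>c\<bar> \<le> \<eta>0" and t: "\<bar>t\<bar> \<le> 1"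
    and eq: "\<rho> * b 1 * (\<kappa>c - \<kappa>) = t\<^sup>2 * (\<kappa> * H \<kappa> (t\<^sup>2))"
  shows "balance \<kappa> (scaled \<kappa> t)"
  unfolding balance_def
proof
  fix n :: int
  note s = scaled[OF k t]
  have kb: "2 - \<kappa> * b 1 = b 1 * (\<kappa>c - \<kappa>)" using b1 by (simp add: kc field_simps)
  have odd: "qconv (\<lambda>n. \<beta>) (scaled \<kappa> t) (scaled \<kappa> t) (- n) = - qconv (\<lambda>n. \<beta>) (scaled \<kappa> t) (scaled \<kappa> t) n" for n
    by (rule qconv_even_odd[where x = "scaled \<kappa> t" and y = "scaled \<kappa> t", OF s(3) s(3)]) (simp add: beta_minus)
  have one: "(2 - \<kappa> * b 1) * scaled \<kappa> t 1 = \<kappa> * qconv (\<lambda>n. \<beta>) (scaled \<kappa> t) (scaled \<kappa> t) 1"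
    unfolding s(5,8) kb using eq by (simp add: power2_eq_square power3_eq_cube mult_ac)
  consider "\<bar>n\<bar> \<ge> 2" | "n = 0" | "n = 1" | "n = -1" by linarith
  then show "of_int n * (2 - \<kappa> * b (nat \<bar>n\<bar>)) * scaled \<kappa> t n = \<kappa> * qconv (\<lambda>n. \<beta>) (scaled \<kappa> t) (scaled \<kappa> t) n"
  proof cases
    case 1
    then show ?thesis by (rule s(7))
  next
    case 2
    then show ?thesis using odd[of 0] by simp
  next
    case 3
    then show ?thesis using one by simp
  next
    case 4
    then show ?thesis using one odd[of 1] s(3)[of 1] by (simp add: algebra_simps)
  qed
qed

text \<open>
  A small solution u of the balance equations has a determined parameter t, read off from its first
  mode. The sequences u and scaled \<kappa> t agree in the modes 0 and \<plusminus>1 and both solve the other equations, so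
  they coincide by the stability of the higher modes; the equation of mode 1 is then the scalar equation,
  once the common factor t is cancelled.
\<close>

lemma balance_unique:
  assumes k: "\<bar>\<kappa> - \<kappa>c\<bar> \<le> \<eta>0" and u: "l1 u" "l1norm u \<le> \<rho>" "\<And>n. u (- n) = u n" "u 0 = 0"
    and bal: "balance \<kappa> u"
  defines "t \<equiv> u 1 / \<rho>"
  shows "u = scaled \<kappa> t" "\<bar>t\<bar> \<le> l1norm u / \<rho>"
    and "t \<noteq> 0 \<Longrightarrow> \<rho> * b 1 * (\<kappa>c - \<kappa>) = t\<^sup>2 * (\<kappa> * H \<kappa> (t\<^sup>2))"
proof -
  show tl: "\<bar>t\<bar> \<le> l1norm u / \<rho>"
    using l1_abs_le[OF u(1), of 1] rho by (simp add: t_def divide_right_mono)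
  also have "\<dots> \<le> 1" using u(2) rho by simp
  finally have t: "\<bar>t\<bar> \<le> 1" .
  note s = scaled[OF k t]
  have ker1: "ker 1 = (\<lambda>n. \<beta>)" by (simp add: ker_def[abs_def])
  have mu: "modes \<kappa> 1 u" using bal unfolding modes_def balance_def ker1 by blast
  have ms: "modes \<kappa> 1 (scaled \<kappa> t)" using s(7) unfolding modes_def ker1 by blast
  have u1: "u 1 = scaled \<kappa> t 1" unfolding s(5) unfolding t_def using rho by simp
  have u2: "l1norm u \<le> 4 * \<rho>" using u(2) rho by simp
  have um: "u (-1) = scaled \<kappa> t (-1)" using u(3)[of 1] s(3)[of 1] u1 by simp
  have u0: "u 0 = scaled \<kappa> t 0" using u(4) s(4) by simp
  have T: "\<bar>1 ^ j - 1 ^ j\<bar> \<le> (0::real)" for j by simp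
  have "l1norm (\<lambda>n. u n - scaled \<kappa> t n) \<le> 2 * \<rho> * (0 + \<bar>\<kappa> - \<kappa>\<bar>)"
    using mode_difference(3)[OF k k zero_le_one order_refl zero_le_one order_refl T u(1) u2 mu s(1,2) ms u0 u1 um] .
  then show us: "u = scaled \<kappa> t"
    using l1norm_eq_0[OF l1_diff[OF u(1) s(1)]] by (intro ext) auto
  assume t0: "t \<noteq> 0"
  have kb: "2 - \<kappa> * b 1 = b 1 * (\<kappa>c - \<kappa>)" using b1 by (simp add: kc field_simps)
  have "(2 - \<kappa> * b 1) * (\<rho> * t) = \<kappa> * (t ^ 3 * H \<kappa> (t\<^sup>2))"
    using bal[unfolded balance_def, rule_format, of 1] s(5,8) us by simp
  then have "t * (\<rho> * b 1 * (\<kappa>c - \<kappa>)) = t * (t\<^sup>2 * (\<kappa> * H \<kappa> (t\<^sup>2)))"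
    unfolding kb by (simp add: power2_eq_square power3_eq_cube mult_ac)
  then show "\<rho> * b 1 * (\<kappa>c - \<kappa>) = t\<^sup>2 * (\<kappa> * H \<kappa> (t\<^sup>2))" using t0 by simp
qed

text \<open>
  Continuity of the branch in the weighted norm. The parameters t and t' have the same sign, so that their
  powers can be compared on [0, 1/2].
\<close>

lemma scaled_diff:
  assumes "\<bar>\<kappa> - \<kappa>c\<bar> \<le> \<eta>0" "\<bar>\<kappa>' - \<kappa>c\<bar> \<le> \<eta>0" "\<bar>t\<bar> \<le> 1/2" "\<bar>t'\<bar> \<le> 1/2" "0 \<le> t * t'"
  shows "l1 (\<lambda>n. of_int n * (scaled \<kappa> t n - scaled \<kappa>' t' n))"
    and "l1norm (\<lambda>n. of_int n * (scaled \<kappa> t n - scaled \<kappa>' t' n))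
      \<le> 2 * \<rho> * (\<bar>t\<^sup>2 - t'\<^sup>2\<bar> + \<bar>\<kappa> - \<kappa>'\<bar>) + \<bar>t - t'\<bar> * l1norm (\<lambda>n. of_int n * Y \<kappa> (t\<^sup>2) n)"
proof -
  have t1: "\<bar>t\<bar> \<le> 1" "\<bar>t'\<bar> \<le> 1" using assms by auto
  have sq: "0 \<le> s\<^sup>2 \<and> s\<^sup>2 \<le> 1/2 \<and> s\<^sup>2 \<le> 1" if "\<bar>s\<bar> \<le> 1/2" for s :: real
  proof -
    have "\<bar>s\<bar> * \<bar>s\<bar> \<le> 1/2 * 1" using that by (intro mult_mono) auto
    then show ?thesis by (simp add: power2_eq_square)
  qed
  have t2: "0 \<le> t\<^sup>2" "t\<^sup>2 \<le> 1/2" "t\<^sup>2 \<le> 1" "0 \<le> t'\<^sup>2" "t'\<^sup>2 \<le> 1/2" "t'\<^sup>2 \<le> 1"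
    using sq assms(3,4) by auto
  have pd: "\<bar>t ^ j - t' ^ j\<bar> \<le> \<bar>t - t'\<bar>" for j
  proof (cases "0 \<le> t \<and> 0 \<le> t'")
    case True
    then show ?thesis using assms by (intro power_lipschitz_half) auto
  next
    case False
    then have neg: "t \<le> 0" "t' \<le> 0" using assms(5) by (auto simp: zero_le_mult_iff)
    have "\<bar>(- t) ^ j - (- t') ^ j\<bar> \<le> \<bar>(- t) - (- t')\<bar>" using neg assms by (intro power_lipschitz_half) auto
    moreover have "\<bar>(- t) ^ j - (- t') ^ j\<bar> = \<bar>t ^ j - t' ^ j\<bar>"
      using power_minus[of t j] power_minus[of t' j]
      by (simp add: right_diff_distrib[symmetric] abs_mult power_abs)
    ultimately show ?thesis by (simp add: abs_minus_commute)
  qed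
  note yl = Y_lipschitz[OF assms(1) t2(1,2) assms(2) t2(4,5)]
  note y = Y(7)[OF assms(1) t2(1,3)]
  have tn: "\<bar>t' ^ j\<bar> \<le> 1" for j using t1 by (simp add: power_abs power_le_one)
  have le: "\<bar>of_int n * (scaled \<kappa> t n - scaled \<kappa>' t' n)\<bar>
     \<le> 1 * \<bar>of_int n * (Y \<kappa> (t\<^sup>2) n - Y \<kappa>' (t'\<^sup>2) n)\<bar> + \<bar>t - t'\<bar> * \<bar>of_int n * Y \<kappa> (t\<^sup>2) n\<bar>" for n
  proof -
    have "of_int n * (scaled \<kappa> t n - scaled \<kappa>' t' n)
      = t' ^ nat \<bar>n\<bar> * (of_int n * (Y \<kappa> (t\<^sup>2) n - Y \<kappa>' (t'\<^sup>2) n))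
        + (t ^ nat \<bar>n\<bar> - t' ^ nat \<bar>n\<bar>) * (of_int n * Y \<kappa> (t\<^sup>2) n)"
      by (simp add: scaled_def algebra_simps)
    also have "\<bar>\<dots>\<bar> \<le> \<bar>t' ^ nat \<bar>n\<bar>\<bar> * \<bar>of_int n * (Y \<kappa> (t\<^sup>2) n - Y \<kappa>' (t'\<^sup>2) n)\<bar>
        + \<bar>t ^ nat \<bar>n\<bar> - t' ^ nat \<bar>n\<bar>\<bar> * \<bar>of_int n * Y \<kappa> (t\<^sup>2) n\<bar>"
      unfolding abs_mult[symmetric] by (rule abs_triangle_ineq)
    also have "\<dots> \<le> 1 * \<bar>of_int n * (Y \<kappa> (t\<^sup>2) n - Y \<kappa>' (t'\<^sup>2) n)\<bar> + \<bar>t - t'\<bar> * \<bar>of_int n * Y \<kappa> (t\<^sup>2) n\<bar>"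
      by (intro add_mono mult_right_mono tn pd) auto
    finally show ?thesis .
  qed
  note l = l1_add_le[OF yl(1) y le]
  show "l1 (\<lambda>n. of_int n * (scaled \<kappa> t n - scaled \<kappa>' t' n))" by (rule l(1))
  show "l1norm (\<lambda>n. of_int n * (scaled \<kappa> t n - scaled \<kappa>' t' n))
      \<le> 2 * \<rho> * (\<bar>t\<^sup>2 - t'\<^sup>2\<bar> + \<bar>\<kappa> - \<kappa>'\<bar>) + \<bar>t - t'\<bar> * l1norm (\<lambda>n. of_int n * Y \<kappa> (t\<^sup>2) n)"
    using l(2) yl(2) by simp
qed

end

section \<open>Integration over the circle\<close>

text \<open>
  A finite measure in place of set integrals, so that the library on Bochner integration applies directly.
\<close>

definition circ :: "real measure" where "circ = restrict_space lborel {0..<2*pi}"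

lemma circle_integral_circ: "circle_integral f = integral\<^sup>L circ f"
  unfolding circ_def set_lebesgue_integral_def by (subst integral_restrict_space) auto

lemma set_integrable_circ: "set_integrable lborel {0..<2*pi} f \<longleftrightarrow> integrable circ f"
  for f :: "real \<Rightarrow> real"
  unfolding circ_def set_integrable_def by (subst integrable_restrict_space) auto

lemma space_circ: "space circ = {0..<2*pi}" by (simp add: circ_def space_restrict_space)

lemma finite_measure_circ: "finite_measure circ"
  by (rule finite_measureI) (simp add: circ_def emeasure_restrict_space space_restrict_space)

lemma borel_circ: "f \<in> borel_measurable borel \<Longrightarrow> f \<in> borel_measurable circ"
  unfolding circ_def by (rule measurable_restrict_space1) simp

lemma integrable_circ_bounded:
  fixes h :: "real \<Rightarrow> real"
  assumes "h \<in> borel_measurable borel" "\<And>x. \<bar>h x\<bar> \<le> B"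
  shows "integrable circ h"
proof -
  interpret finite_measure circ by (rule finite_measure_circ)
  show ?thesis
  proof (rule integrable_const_bound[of _ B])
    show "AE x in circ. norm (h x) \<le> B" using assms(2) by simp
    show "h \<in> borel_measurable circ" by (rule borel_circ[OF assms(1)])
  qed
qed

lemma integrable_circ_mult:
  fixes f h :: "real \<Rightarrow> real"
  assumes "integrable circ f" "h \<in> borel_measurable borel" "\<And>x. \<bar>h x\<bar> \<le> B"
  shows "integrable circ (\<lambda>x. f x * h x)"
proof (rule Bochner_Integration.integrable_bound[of circ "\<lambda>x. B * f x"])
  have "0 \<le> B" using order_trans[OF abs_ge_zero assms(3)] .
  then have "norm (f x * h x) \<le> norm (B * f x)" for x
    using assms(3)[of x] mult_left_mono[of "\<bar>h x\<bar>" B "\<bar>f x\<bar>"] by (simp add: abs_mult mult.commute)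
  then show "AE x in circ. norm (f x * h x) \<le> norm (B * f x)" by simp
  show "integrable circ (\<lambda>x. B * f x)" using assms(1) by simp
  show "(\<lambda>x. f x * h x) \<in> borel_measurable circ"
    by (intro borel_measurable_times borel_measurable_integrable[OF assms(1)] borel_circ[OF assms(2)])
qed

lemma integrable_circ_L2_mult:
  fixes f g :: "real \<Rightarrow> real"
  assumes "f \<in> borel_measurable borel" "g \<in> borel_measurable borel"
    and "integrable circ (\<lambda>x. (f x)\<^sup>2)" "integrable circ (\<lambda>x. (g x)\<^sup>2)"
  shows "integrable circ (\<lambda>x. f x * g x)"
proof (rule Bochner_Integration.integrable_bound[OF Bochner_Integration.integrable_add[OF assms(3,4)]])
  have "\<bar>f x * g x\<bar> \<le> (f x)\<^sup>2 + (g x)\<^sup>2" for x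
    using sum_squares_bound[of "\<bar>f x\<bar>" "\<bar>g x\<bar>"] zero_le_power2[of "f x"] zero_le_power2[of "g x"]
    unfolding abs_mult power2_abs by linarith
  then show "AE x in circ. norm (f x * g x) \<le> norm ((f x)\<^sup>2 + (g x)\<^sup>2)" by simp
  show "(\<lambda>x. f x * g x) \<in> borel_measurable circ"
    by (intro borel_measurable_times borel_circ assms(1,2))
qed

lemma integrable_circ_L2:
  fixes f :: "real \<Rightarrow> real"
  assumes "f \<in> borel_measurable borel" "integrable circ (\<lambda>x. (f x)\<^sup>2)"
  shows "integrable circ f"
proof -
  have "integrable circ (\<lambda>x. (1::real)\<^sup>2)" by (rule integrable_circ_bounded[of _ 1]) simp_all
  from integrable_circ_L2_mult[OF assms(1) _ assms(2) this] show ?thesis by simp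
qed

lemma circle_periodic_int:
  assumes "circle_periodic f"
  shows "f (x + of_int k * (2*pi)) = f x" "f (x - of_int k * (2*pi)) = f x"
proof -
  interpret periodic_fun_simple f "2*pi" using assms by unfold_locales (simp add: circle_periodic_def)
  show "f (x + of_int k * (2*pi)) = f x" by (simp add: plus_of_int)
  show "f (x - of_int k * (2*pi)) = f x" by (simp add: minus_of_int)
qed

lemma continuous_periodic_bounded:
  assumes "continuous_on UNIV f" "circle_periodic f"
  obtains B where "\<And>x. \<bar>f x\<bar> \<le> (B::real)"
proof -
  have "bounded (f ` {0..2*pi})"
    by (intro compact_imp_bounded compact_continuous_image continuous_on_subset[OF assms(1)]) auto
  then obtain B where B: "\<forall>x\<in>{0..2*pi}. \<bar>f x\<bar> \<le> B" unfolding bounded_iff by auto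
  have "\<bar>f x\<bar> \<le> B" for x
  proof -
    define k where "k = \<lfloor>x / (2*pi)\<rfloor>"
    have "x - of_int k * (2*pi) \<in> {0..2*pi}"
      using floor_divide_lower[of "2*pi" x] floor_divide_upper[of "2*pi" x]
      by (auto simp: k_def algebra_simps)
    then have "\<bar>f (x - of_int k * (2*pi))\<bar> \<le> B" using B by blast
    then show ?thesis unfolding circle_periodic_int(2)[OF assms(2)] .
  qed
  then show ?thesis by (rule that)
qed

lemma integral_circ_FTC:
  fixes f F :: "real \<Rightarrow> real"
  assumes "\<And>x. (F has_real_derivative f x) (at x)" "continuous_on UNIV f"
  shows "integral\<^sup>L circ f = F (2*pi) - F 0"
proof -
  have "integral\<^sup>L circ f = (LINT x|lborel. indicator {0..<2*pi} x *\<^sub>R f x)"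
    by (simp add: circle_integral_circ[symmetric] set_lebesgue_integral_def)
  also have "\<dots> = (LINT x|lborel. indicator {0..2*pi} x *\<^sub>R f x)"
  proof (rule integral_cong_AE)
    have "AE x in lborel. x \<noteq> 2*pi" by (rule AE_lborel_singleton)
    then show "AE x in lborel. indicator {0..<2*pi} x *\<^sub>R f x = indicator {0..2*pi} x *\<^sub>R f x"
      by eventually_elim (auto simp: indicator_def)
  qed (use borel_measurable_continuous_onI[OF assms(2)] in auto)
  also have "\<dots> = F (2*pi) - F 0"
    using assms by (intro integral_FTC_atLeastAtMost)
      (auto intro: continuous_on_subset has_field_derivative_at_within simp: has_real_derivative_iff_has_vector_derivative[symmetric])
  finally show ?thesis .
qed

lemma sin_int_2pi: "sin (of_int n * (2 * pi)) = 0" and cos_int_2pi: "cos (of_int n * (2 * pi)) = 1"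
  using sin_int_2pin[of n] cos_int_2pin[of n] by (simp_all add: mult.commute)

lemma integral_circ_cos: "integral\<^sup>L circ (\<lambda>x. cos (of_int n * x)) = (if n = 0 then 2*pi else 0)"
proof (cases "n = 0")
  case True
  have "integral\<^sup>L circ (\<lambda>x. 1::real) = 2*pi - 0"
    by (rule integral_circ_FTC[of "\<lambda>x. x"]) (auto intro!: derivative_eq_intros)
  then show ?thesis using True by simp
next
  case False
  have "integral\<^sup>L circ (\<lambda>x. cos (of_int n * x)) = sin (of_int n * (2*pi)) / of_int n - sin (of_int n * 0) / of_int n"
    using False by (intro integral_circ_FTC) (auto intro!: derivative_eq_intros continuous_intros)
  then show ?thesis using False sin_int_2pi[of n] by simp
qed

lemma integral_circ_sin: "integral\<^sup>L circ (\<lambda>x. sin (of_int n * x)) = 0"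
proof (cases "n = 0")
  case False
  have "integral\<^sup>L circ (\<lambda>x. sin (of_int n * x)) = - cos (of_int n * (2*pi)) / of_int n - (- cos (of_int n * 0) / of_int n)"
    using False by (intro integral_circ_FTC) (auto intro!: derivative_eq_intros continuous_intros)
  then show ?thesis using False cos_int_2pi[of n] by simp
qed simp

lemma integrable_circ_cos: "integrable circ (\<lambda>x. cos (c * x))" "integrable circ (\<lambda>x. sin (c * x))"
  by (rule integrable_circ_bounded[of _ 1]; simp)+

lemma integral_circ_cos_cos:
  "integral\<^sup>L circ (\<lambda>x. cos (of_int n * x) * cos (of_int k * x)) = pi * (of_bool (n = k) + of_bool (n = - k))"
proof -
  have eq: "cos (of_int n * x) * cos (of_int k * x) = (cos (of_int (n - k) * x) + cos (of_int (n + k) * x)) / 2" for x :: real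
    by (simp only: cos_times_cos of_int_diff of_int_add left_diff_distrib distrib_right)
  have "integral\<^sup>L circ (\<lambda>x. cos (of_int n * x) * cos (of_int k * x))
      = (integral\<^sup>L circ (\<lambda>x. cos (of_int (n - k) * x)) + integral\<^sup>L circ (\<lambda>x. cos (of_int (n + k) * x))) / 2"
    unfolding eq by (simp add: integrable_circ_cos del: of_int_diff of_int_add)
  then show ?thesis unfolding integral_circ_cos by auto
qed

lemma integral_circ_sin_sin:
  "integral\<^sup>L circ (\<lambda>x. sin (of_int n * x) * sin (of_int k * x)) = pi * (of_bool (n = k) - of_bool (n = - k))"
proof -
  have eq: "sin (of_int n * x) * sin (of_int k * x) = (cos (of_int (n - k) * x) - cos (of_int (n + k) * x)) / 2" for x :: real
    by (simp only: sin_times_sin of_int_diff of_int_add left_diff_distrib distrib_right)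
  have "integral\<^sup>L circ (\<lambda>x. sin (of_int n * x) * sin (of_int k * x))
      = (integral\<^sup>L circ (\<lambda>x. cos (of_int (n - k) * x)) - integral\<^sup>L circ (\<lambda>x. cos (of_int (n + k) * x))) / 2"
    unfolding eq by (simp add: integrable_circ_cos del: of_int_diff of_int_add)
  then show ?thesis unfolding integral_circ_cos by auto
qed

lemma integral_circ_sin_cos:
  "integral\<^sup>L circ (\<lambda>x. sin (of_int n * x) * cos (of_int k * x)) = 0"
proof -
  have eq: "sin (of_int n * x) * cos (of_int k * x) = (sin (of_int (n + k) * x) + sin (of_int (n - k) * x)) / 2" for x :: real
    by (simp only: sin_times_cos of_int_diff of_int_add left_diff_distrib distrib_right)
  have "integral\<^sup>L circ (\<lambda>x. sin (of_int n * x) * cos (of_int k * x))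
      = (integral\<^sup>L circ (\<lambda>x. sin (of_int (n + k) * x)) + integral\<^sup>L circ (\<lambda>x. sin (of_int (n - k) * x))) / 2"
    unfolding eq by (simp add: integrable_circ_cos del: of_int_diff of_int_add)
  then show ?thesis unfolding integral_circ_sin by auto
qed

text \<open>
  Invariance of the integral under rotations and reflections of the circle at once: \<theta> is reduced to
  r \<in> [0, 2\<pi>), and the circle is cut at r into two arcs, each of which is mapped by an affine map.
\<close>

lemma circ_reflect:
  fixes f :: "real \<Rightarrow> real"
  assumes per: "circle_periodic f" and int: "integrable circ f"
  shows "integrable circ (\<lambda>x. f (\<theta> - x))" "integral\<^sup>L circ (\<lambda>x. f (\<theta> - x)) = integral\<^sup>L circ f"
proof -
  define k where "k = \<lfloor>\<theta> / (2*pi)\<rfloor>"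
  define r where "r = \<theta> - of_int k * (2*pi)"
  have r: "0 \<le> r" "r < 2*pi"
    using floor_divide_lower[of "2*pi" \<theta>] floor_divide_upper[of "2*pi" \<theta>]
    by (auto simp: r_def k_def algebra_simps)
  have fr: "f (\<theta> - x) = f (r - x)" for x
    using circle_periodic_int(2)[OF per, of "\<theta> - x" k] by (simp add: r_def algebra_simps)
  have i: "integrable lborel (\<lambda>x. indicator {0..<2*pi} x *\<^sub>R f x)"
    using int by (simp add: set_integrable_circ[symmetric] set_integrable_def)
  define g1 where "g1 x = indicator {0..r} x *\<^sub>R f x" for x
  define g2 where "g2 x = indicator {r<..<2*pi} x *\<^sub>R f x" for x
  have "g1 = (\<lambda>x. indicator {0..r} x *\<^sub>R (indicator {0..<2*pi} x *\<^sub>R f x))"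
    "g2 = (\<lambda>x. indicator {r<..<2*pi} x *\<^sub>R (indicator {0..<2*pi} x *\<^sub>R f x))"
    using r by (auto simp: g1_def g2_def indicator_def)
  then have ig: "integrable lborel g1" "integrable lborel g2"
    using integrable_mult_indicator[OF _ i] by auto
  have ig': "integrable lborel (\<lambda>x. g2 (2*pi + 1 * x))"
    by (rule lborel_integrable_real_affine[OF ig(2)]) simp
  define h where "h x = g1 x + g2 (2*pi + 1 * x)" for x
  have ih: "integrable lborel h" unfolding h_def by (intro Bochner_Integration.integrable_add ig ig')
  have "integral\<^sup>L lborel h = integral\<^sup>L lborel g1 + integral\<^sup>L lborel g2"
    unfolding h_def using lborel_integral_real_affine[of 1 g2 "2*pi"] ig ig' by simp
  also have "\<dots> = integral\<^sup>L lborel (\<lambda>x. g1 x + g2 x)" using ig by simp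
  also have "(\<lambda>x. g1 x + g2 x) = (\<lambda>x. indicator {0..<2*pi} x *\<^sub>R f x)"
    using r by (auto simp: g1_def g2_def indicator_def)
  finally have hf: "integral\<^sup>L lborel h = integral\<^sup>L circ f"
    by (simp add: circle_integral_circ[symmetric] set_lebesgue_integral_def)
  have f2: "f (2*pi + x) = f x" for x using per by (simp add: circle_periodic_def add.commute)
  have hr: "h (r + (- 1) * x) = indicator {0..<2*pi} x *\<^sub>R f (\<theta> - x)" for x
    using r f2[of "r - x"] unfolding fr by (auto simp: h_def g1_def g2_def indicator_def)
  have "integrable lborel (\<lambda>x. h (r + (- 1) * x))"
    by (rule lborel_integrable_real_affine[OF ih]) simp
  then show "integrable circ (\<lambda>x. f (\<theta> - x))"
    unfolding hr by (simp add: set_integrable_circ[symmetric] set_integrable_def)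
  have "integral\<^sup>L lborel h = integral\<^sup>L lborel (\<lambda>x. h (r + (- 1) * x))"
    using lborel_integral_real_affine[of "-1" h r] by simp
  then show "integral\<^sup>L circ (\<lambda>x. f (\<theta> - x)) = integral\<^sup>L circ f"
    unfolding hf hr by (simp add: circle_integral_circ[symmetric] set_lebesgue_integral_def)
qed

lemma AE_circ_iff: "(AE x in circ. P x) \<longleftrightarrow> (AE x in lborel. x \<in> {0..<2*pi} \<longrightarrow> P x)"
  unfolding circ_def by (subst AE_restrict_space_iff) auto

text \<open>
  Equality almost everywhere on one period spreads to the line by countably many translations of the
  exceptional null set.
\<close>

lemma AE_periodic:
  fixes f g :: "real \<Rightarrow> real"
  assumes "circle_periodic f" "circle_periodic g" "f \<in> borel_measurable borel" "g \<in> borel_measurable borel"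
    and "AE x in circ. f x = g x"
  shows "AE x in lborel. f x = g x"
proof -
  define N where "N = {x \<in> {0..<2*pi}. f x \<noteq> g x}"
  have "AE x in lborel. x \<notin> N" using assms(5) unfolding AE_circ_iff by eventually_elim (auto simp: N_def)
  moreover have "N \<in> sets lborel"
  proof -
    have "{x. f x \<noteq> g x} \<in> sets borel" using assms(3,4) by measurable
    moreover have "N = {0..<2*pi} \<inter> {x. f x \<noteq> g x}" by (auto simp: N_def)
    ultimately show ?thesis by simp
  qed
  ultimately have N: "N \<in> null_sets lborel" by (simp add: AE_iff_null_sets)
  have "(\<Union>k::int. {x. x - of_int k * (2*pi) \<in> N}) \<in> null_sets lborel"
    by (intro null_sets_UN' null_sets_translation N) auto
  moreover have "{x. f x \<noteq> g x} \<subseteq> (\<Union>k::int. {x. x - of_int k * (2*pi) \<in> N})"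
  proof
    fix x assume x: "x \<in> {x. f x \<noteq> g x}"
    define k where "k = \<lfloor>x / (2*pi)\<rfloor>"
    have "x - of_int k * (2*pi) \<in> {0..<2*pi}"
      using floor_divide_lower[of "2*pi" x] floor_divide_upper[of "2*pi" x]
      by (auto simp: k_def algebra_simps)
    then have "x - of_int k * (2*pi) \<in> N"
      using x circle_periodic_int(2)[OF assms(1), of x k] circle_periodic_int(2)[OF assms(2), of x k]
      by (simp add: N_def)
    then show "x \<in> (\<Union>k::int. {x. x - of_int k * (2*pi) \<in> N})" by auto
  qed
  ultimately show ?thesis by (intro AE_I') simp_all
qed

section \<open>Completeness of the trigonometric system\<close>

text \<open>
  A function f that is orthogonal to all cos n x and sin n x is orthogonal to cos (x - x_0)^k for all k and
  x_0, by the addition theorem and the product formula for cosines. By the Weierstrass theorem on [-1, 1] it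
  is orthogonal to all continuous functions of cos (x - x_0), and by dominated convergence to the indicator
  of the arc cos (x - x_0) > t. These arcs are the intervals, which generate the Borel sets, so the integral
  of f over every Borel set vanishes.
\<close>

lemma trig_complete:
  fixes f :: "real \<Rightarrow> real"
  assumes int: "integrable circ f"
    and c: "\<And>n::nat. integral\<^sup>L circ (\<lambda>x. f x * cos (of_nat n * x)) = 0"
    and s: "\<And>n::nat. integral\<^sup>L circ (\<lambda>x. f x * sin (of_nat n * x)) = 0"
  shows "AE x in circ. f x = 0"
proof -
  have meas: "(\<lambda>x. f x * h x) \<in> borel_measurable circ" if "h \<in> borel_measurable borel" for h :: "real \<Rightarrow> real"
    by (intro borel_measurable_times borel_measurable_integrable[OF int] borel_circ[OF that])
  have im: "integrable circ (\<lambda>x. f x * h x)" if "h \<in> borel_measurable borel" "\<And>x. \<bar>h x\<bar> \<le> B" for h :: "real \<Rightarrow> real" and B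
    using integrable_circ_mult[OF int that] .
  have zero_j: "integral\<^sup>L circ (\<lambda>x. f x * cos (of_nat j * (x - x0))) = 0" for j x0
  proof -
    have eq: "f x * cos (of_nat j * (x - x0)) = cos (of_nat j * x0) * (f x * cos (of_nat j * x))
        + sin (of_nat j * x0) * (f x * sin (of_nat j * x))" for x
      by (simp add: right_diff_distrib cos_diff algebra_simps)
    have "integrable circ (\<lambda>x. f x * cos (of_nat j * x))" "integrable circ (\<lambda>x. f x * sin (of_nat j * x))"
      by (rule im[of _ 1]; simp)+
    then show ?thesis unfolding eq using c s by simp
  qed
  have ib: "integrable circ (\<lambda>x. f x * (cos (x - x0) ^ k * cos (of_nat j * (x - x0))))" for k j x0
    by (rule im[of _ 1]) (auto simp: abs_mult power_abs intro!: mult_le_one power_le_one)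
  have zero_kj: "integral\<^sup>L circ (\<lambda>x. f x * (cos (x - x0) ^ k * cos (of_nat j * (x - x0)))) = 0" for k j x0
  proof (induction k arbitrary: j)
    case 0
    then show ?case using zero_j by simp
  next
    case (Suc k)
    show ?case
    proof (cases j)
      case 0
      have eq: "f x * (cos (x - x0) ^ Suc k * cos (of_nat j * (x - x0))) = f x * (cos (x - x0) ^ k * cos (of_nat 1 * (x - x0)))" for x
        using 0 by (simp add: mult.commute)
      show ?thesis unfolding eq by (rule Suc.IH)
    next
      case (Suc i)
      have "cos (x - x0) * cos (of_nat j * (x - x0))
          = (cos (of_nat i * (x - x0)) + cos (of_nat (Suc j) * (x - x0))) / 2" for x
      proof -
        have "cos (x - x0) * cos (of_nat j * (x - x0)) = cos (of_nat j * (x - x0)) * cos (x - x0)"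
          by (rule mult.commute)
        also have "\<dots> = (cos (of_nat j * (x - x0) - (x - x0)) + cos (of_nat j * (x - x0) + (x - x0))) / 2"
          by (rule cos_times_cos)
        also have "of_nat j * (x - x0) - (x - x0) = of_nat i * (x - x0)" by (simp add: Suc algebra_simps)
        also have "of_nat j * (x - x0) + (x - x0) = of_nat (Suc j) * (x - x0)" by (simp add: algebra_simps)
        finally show ?thesis .
      qed
      note pr = this
      have eq: "f x * (cos (x - x0) ^ Suc k * cos (of_nat j * (x - x0)))
          = (f x * (cos (x - x0) ^ k * cos (of_nat i * (x - x0))) + f x * (cos (x - x0) ^ k * cos (of_nat (Suc j) * (x - x0)))) / 2" for x
      proof -
        have "f x * (cos (x - x0) ^ Suc k * cos (of_nat j * (x - x0)))
          = f x * (cos (x - x0) ^ k * (cos (x - x0) * cos (of_nat j * (x - x0))))" by (simp only: power_Suc mult_ac)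
        then show ?thesis unfolding pr by (simp add: distrib_left)
      qed
      have "integral\<^sup>L circ (\<lambda>x. f x * (cos (x - x0) ^ Suc k * cos (of_nat j * (x - x0))))
          = (integral\<^sup>L circ (\<lambda>x. f x * (cos (x - x0) ^ k * cos (of_nat i * (x - x0))))
            + integral\<^sup>L circ (\<lambda>x. f x * (cos (x - x0) ^ k * cos (of_nat (Suc j) * (x - x0))))) / 2"
        unfolding eq using ib[of x0 k i] ib[of x0 k "Suc j"] by (simp del: of_nat_Suc)
      then show ?thesis by (simp only: Suc.IH) simp
    qed
  qed
  have ipow: "integrable circ (\<lambda>x. f x * cos (x - x0) ^ k)" for k x0 using ib[of x0 k 0] by simp
  have zero_pow: "integral\<^sup>L circ (\<lambda>x. f x * cos (x - x0) ^ k) = 0" for k x0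
    using zero_kj[of x0 k 0] by simp
  have zero_poly: "integral\<^sup>L circ (\<lambda>x. f x * p (cos (x - x0))) = 0"
    if p: "real_polynomial_function p" for p x0
  proof -
    obtain a n where pa: "p = (\<lambda>x. \<Sum>i\<le>n. a i * x ^ i)"
      using p real_polynomial_function_iff_sum by blast
    have eq: "f x * p (cos (x - x0)) = (\<Sum>i\<le>n. a i * (f x * cos (x - x0) ^ i))" for x
      by (simp add: pa sum_distrib_left mult_ac)
    show ?thesis unfolding eq using ipow zero_pow by simp
  qed
  have zero_cont: "integral\<^sup>L circ (\<lambda>x. f x * F (cos (x - x0))) = 0"
    if F: "continuous_on UNIV F" for F :: "real \<Rightarrow> real" and x0
  proof -
    have Fb: "F \<in> borel_measurable borel" using F by (rule borel_measurable_continuous_onI)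
    obtain B where B: "\<forall>y\<in>{-1..1}. \<bar>F y\<bar> \<le> B"
      using compact_imp_bounded[OF compact_continuous_image[OF continuous_on_subset[OF F] compact_Icc[of "-1" 1]]]
      unfolding bounded_iff by auto
    have iF: "integrable circ (\<lambda>x. f x * F (cos (x - x0)))"
      using Fb B by (intro im[of _ B]) (auto intro: measurable_compose[rotated])
    have "\<bar>integral\<^sup>L circ (\<lambda>x. f x * F (cos (x - x0)))\<bar> \<le> e" if e: "e > 0" for e
    proof -
      define I where "I = integral\<^sup>L circ (\<lambda>x. \<bar>f x\<bar>) + 1"
      have I: "0 < I" unfolding I_def by (simp add: add_nonneg_pos)
      obtain p where p: "real_polynomial_function p" "\<And>y. y \<in> {-1..1} \<Longrightarrow> \<bar>F y - p y\<bar> < e / I"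
      proof -
        have "0 < e / I" using e I by simp
        with Stone_Weierstrass_real_polynomial_function[OF compact_Icc continuous_on_subset[OF F subset_UNIV], where e = "e / I"]
        show ?thesis using that by blast
      qed
      have pc: "continuous_on UNIV p" using p(1) by (auto simp: continuous_on_eq_continuous_at continuous_real_polymonial_function)
      then have pb: "p \<in> borel_measurable borel" by (rule borel_measurable_continuous_onI)
      obtain B' where B': "\<forall>y\<in>{-1..1}. \<bar>p y\<bar> \<le> B'"
        using compact_imp_bounded[OF compact_continuous_image[OF continuous_on_subset[OF pc] compact_Icc[of "-1" 1]]]
        unfolding bounded_iff by auto
      have ip: "integrable circ (\<lambda>x. f x * p (cos (x - x0)))"
        using pb B' by (intro im[of _ B']) (auto intro: measurable_compose[rotated])
      have "integral\<^sup>L circ (\<lambda>x. f x * F (cos (x - x0)))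
         = integral\<^sup>L circ (\<lambda>x. f x * F (cos (x - x0)) - f x * p (cos (x - x0)))"
        using iF ip zero_poly[OF p(1)] by simp
      also have "\<bar>\<dots>\<bar> \<le> integral\<^sup>L circ (\<lambda>x. \<bar>f x * F (cos (x - x0)) - f x * p (cos (x - x0))\<bar>)"
        using integral_norm_bound[of circ "\<lambda>x. f x * F (cos (x - x0)) - f x * p (cos (x - x0))"] by simp
      also have "\<dots> \<le> integral\<^sup>L circ (\<lambda>x. (e / I) * \<bar>f x\<bar>)"
      proof (rule integral_mono)
        show "\<bar>f x * F (cos (x - x0)) - f x * p (cos (x - x0))\<bar> \<le> (e / I) * \<bar>f x\<bar>" for x
          using mult_right_mono[OF less_imp_le[OF p(2)[of "cos (x - x0)"]], of "\<bar>f x\<bar>"]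
          by (simp add: right_diff_distrib[symmetric] abs_mult mult.commute)
      qed (use iF ip int in \<open>auto intro!: integrable_abs\<close>)
      also have "\<dots> = e * (integral\<^sup>L circ (\<lambda>x. \<bar>f x\<bar>) / I)" by simp
      also have "\<dots> \<le> e * 1" using e I by (intro mult_left_mono) (auto simp: I_def)
      finally show ?thesis by simp
    qed
    then show ?thesis using field_le_epsilon[of "\<bar>integral\<^sup>L circ (\<lambda>x. f x * F (cos (x - x0)))\<bar>" 0] by auto
  qed
  have zero_arc: "integral\<^sup>L circ (\<lambda>x. f x * indicator {y. y > t} (cos (x - x0))) = 0" for t x0
  proof -
    define F where "F i y = max 0 (min 1 (real i * (y - t)))" for i :: nat and y
    have "(\<lambda>i. integral\<^sup>L circ (\<lambda>x. f x * F i (cos (x - x0))))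
        \<longlonglongrightarrow> integral\<^sup>L circ (\<lambda>x. f x * indicator {y. y > t} (cos (x - x0)))"
    proof (rule integral_dominated_convergence[where w = "\<lambda>x. \<bar>f x\<bar>"])
      have lim: "(\<lambda>i. F i y) \<longlonglongrightarrow> indicator {y. y > t} y" for y
      proof (cases "y > t")
        case True
        obtain N :: nat where N: "1 / (y - t) < real N" using reals_Archimedean2 by blast
        have "F i y = 1" if "i \<ge> N" for i
        proof -
          have "1 < real N * (y - t)" using N True by (simp add: field_simps)
          also have "\<dots> \<le> real i * (y - t)" using that True by (intro mult_right_mono) auto
          finally show ?thesis by (simp add: F_def)
        qed
        then have "\<forall>\<^sub>F i in sequentially. F i y = 1" using eventually_sequentially by blast
        then show ?thesis using True by (simp add: tendsto_eventually)
      next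
        case False
        then have np: "real i * (y - t) \<le> 0" for i by (intro mult_nonneg_nonpos) auto
        have "F i y = 0" for i unfolding F_def using np[of i] by linarith
        then show ?thesis using False by simp
      qed
      show "AE x in circ. (\<lambda>i. f x * F i (cos (x - x0))) \<longlonglongrightarrow> f x * indicator {y. y > t} (cos (x - x0))"
        by (intro always_eventually allI tendsto_mult tendsto_const lim)
      show "AE x in circ. norm (f x * F i (cos (x - x0))) \<le> \<bar>f x\<bar>" for i
        by (intro always_eventually allI) (auto simp: abs_mult F_def intro!: mult_left_le)
      show "(\<lambda>x. f x * indicator {y. y > t} (cos (x - x0))) \<in> borel_measurable circ"
        by (rule meas) measurable
      show "(\<lambda>x. f x * F i (cos (x - x0))) \<in> borel_measurable circ" for i
        unfolding F_def by (rule meas) measurable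
      show "integrable circ (\<lambda>x. \<bar>f x\<bar>)" by (rule integrable_abs[OF int])
    qed
    moreover have "integral\<^sup>L circ (\<lambda>x. f x * F i (cos (x - x0))) = 0" for i
      by (rule zero_cont) (auto simp: F_def intro!: continuous_intros)
    ultimately show ?thesis by (simp add: LIMSEQ_const_iff)
  qed
  have zero_int: "integral\<^sup>L circ (\<lambda>x. f x * indicator {a<..<b} x) = 0" for a b
  proof -
    \<comment> \<open>An interval inside the period is the arc |x - x_0| < r, that is cos (x - x_0) > cos r, with its midpoint x_0.\<close>
    define a' where "a' = max 0 a"
    define b' where "b' = min (2*pi) b"
    have eq: "f x * indicator {a<..<b} x = f x * indicator {a'<..<b'} x" if "x \<in> {0<..<2*pi}" for x
      using that by (auto simp: a'_def b'_def indicator_def)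
    have ne: "AE x in circ. x \<noteq> 0"
      unfolding AE_circ_iff using AE_lborel_singleton[of "0::real"] by eventually_elim simp
    have "integral\<^sup>L circ (\<lambda>x. f x * indicator {a<..<b} x) = integral\<^sup>L circ (\<lambda>x. f x * indicator {a'<..<b'} x)"
    proof (rule integral_cong_AE)
      have "AE x in circ. x \<in> {0<..<2*pi}" using ne AE_space[of circ] by eventually_elim (auto simp: space_circ)
      then show "AE x in circ. f x * indicator {a<..<b} x = f x * indicator {a'<..<b'} x"
        by eventually_elim (rule eq)
      show "(\<lambda>x. f x * indicator {a<..<b} x) \<in> borel_measurable circ"
        "(\<lambda>x. f x * indicator {a'<..<b'} x) \<in> borel_measurable circ"
        by (rule meas, simp)+
    qed
    also have "\<dots> = 0"
    proof (cases "a' < b'")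
      case True
      define x0 where "x0 = (a' + b') / 2"
      define r where "r = (b' - a') / 2"
      have ab: "0 \<le> a'" "b' \<le> 2*pi" by (auto simp: a'_def b'_def)
      then have r: "0 < r" "r \<le> pi" "r \<le> x0" "x0 \<le> 2*pi - r" using True by (auto simp: r_def x0_def field_simps)
      have "indicator {a'<..<b'} x = (indicator {y. y > cos r} (cos (x - x0)) :: real)" if x: "x \<in> {0..<2*pi}" for x
      proof -
        define d where "d = \<bar>x - x0\<bar>"
        have d: "0 \<le> d" "d \<le> 2*pi - r" using x r by (auto simp: d_def)
        have cd: "cos (x - x0) = cos d" using cos_minus[of "x - x0"] by (auto simp: d_def abs_if)
        have "x \<in> {a'<..<b'} \<longleftrightarrow> d < r" by (auto simp: d_def x0_def r_def abs_if field_simps)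
        also have "\<dots> \<longleftrightarrow> cos r < cos d"
        proof (cases "d \<le> pi")
          case True
          then show ?thesis using d r cos_mono_less_eq[of r d] by auto
        next
          case False
          have "cos d = cos (2*pi - d)" by (simp add: cos_diff)
          moreover have "\<not> cos r < cos (2*pi - d)" using cos_mono_less_eq[of r "2*pi - d"] False d r by auto
          ultimately show ?thesis using False r by auto
        qed
        finally show ?thesis by (simp add: indicator_def cd)
      qed
      then have "integral\<^sup>L circ (\<lambda>x. f x * indicator {a'<..<b'} x)
          = integral\<^sup>L circ (\<lambda>x. f x * indicator {y. y > cos r} (cos (x - x0)))"
        by (intro Bochner_Integration.integral_cong) (auto simp: space_circ)
      then show ?thesis using zero_arc by simp
    qed (simp add: indicator_def)
    finally show ?thesis .
  qed
  have ii: "integrable circ (\<lambda>x. f x * indicator A x)" if "A \<in> sets borel" for A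
    using that by (intro im[of _ 1]) (auto simp: indicator_def)
  have zero_set: "integral\<^sup>L circ (\<lambda>x. f x * indicator A x) = 0" if "A \<in> sets borel" for A
  proof -
    let ?G = "range (\<lambda>(a, b). {a<..<b::real})"
    have bx: "(\<lambda>(a, b). box a b) = (\<lambda>(a, b). {a<..<b::real})" by (auto simp: fun_eq_iff box_real)
    have g: "sets borel = sigma_sets UNIV ?G"
      unfolding bx[symmetric] by (subst borel_eq_box) (simp add: sets_measure_of)
    have A: "A \<in> sigma_sets UNIV ?G" using that g by simp
    show ?thesis
    proof (rule sigma_sets_induct_disjoint[where G = ?G and \<Omega> = UNIV and A = A
          and P = "\<lambda>A. integral\<^sup>L circ (\<lambda>x. f x * indicator A x) = 0"])
      show "A \<in> sigma_sets UNIV ?G" by (rule A)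
      show "Int_stable ?G"
      proof (rule Int_stableI)
        fix a b assume "a \<in> ?G" "b \<in> ?G"
        then obtain p q p' q' where "a = {p<..<q}" "b = {p'<..<q'}" by auto
        then have "a \<inter> b = (\<lambda>(a, b). {a<..<b}) (max p p', min q q')" by auto
        then show "a \<inter> b \<in> ?G" by blast
      qed
      show "?G \<subseteq> Pow UNIV" by simp
      show "integral\<^sup>L circ (\<lambda>x. f x * indicator A x) = 0" if "A \<in> ?G" for A using that zero_int by auto
      show "integral\<^sup>L circ (\<lambda>x. f x * indicator {} x) = 0" by simp
      show "integral\<^sup>L circ (\<lambda>x. f x * indicator (UNIV - A) x) = 0"
        if "A \<in> sigma_sets UNIV ?G" "integral\<^sup>L circ (\<lambda>x. f x * indicator A x) = 0" for A
      proof -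
        have eq: "f x * indicator (UNIV - A) x = f x * cos (of_nat 0 * x) - f x * indicator A x" for x
          by (simp add: indicator_def)
        have "integrable circ (\<lambda>x. f x * cos (of_nat 0 * x))" using int by simp
        then show ?thesis unfolding eq using c[of 0] that ii[of A] g by (simp del: of_nat_0)
      qed
      show "integral\<^sup>L circ (\<lambda>x. f x * indicator (\<Union>i. A i) x) = 0"
        if "disjoint_family A" "range A \<subseteq> sigma_sets UNIV ?G" "\<And>i. integral\<^sup>L circ (\<lambda>x. f x * indicator (A i) x) = 0"
        for A :: "nat \<Rightarrow> real set"
      proof -
        have Am: "A i \<in> sets borel" for i using that(2) g by auto
        have "(\<lambda>n. integral\<^sup>L circ (\<lambda>x. f x * indicator (\<Union>i<n. A i) x)) \<longlonglongrightarrow> integral\<^sup>L circ (\<lambda>x. f x * indicator (\<Union>i. A i) x)"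
        proof (rule integral_dominated_convergence[where w = "\<lambda>x. \<bar>f x\<bar>"])
          have "(\<lambda>n. indicator (\<Union>i<n. A i) x :: real) \<longlonglongrightarrow> indicator (\<Union>i. A i) x" for x
            by (rule LIMSEQ_indicator_UN)
          then show "AE x in circ. (\<lambda>n. f x * indicator (\<Union>i<n. A i) x) \<longlonglongrightarrow> f x * indicator (\<Union>i. A i) x"
            by (intro always_eventually allI tendsto_mult tendsto_const)
          show "AE x in circ. norm (f x * indicator (\<Union>i<n. A i) x) \<le> \<bar>f x\<bar>" for n
            by (intro always_eventually allI) (auto simp: indicator_def)
          show "(\<lambda>x. f x * indicator (\<Union>i. A i) x) \<in> borel_measurable circ"
            "(\<lambda>x. f x * indicator (\<Union>i<n. A i) x) \<in> borel_measurable circ" for n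
            using Am by (auto intro!: meas borel_measurable_indicator)
          show "integrable circ (\<lambda>x. \<bar>f x\<bar>)" by (rule integrable_abs[OF int])
        qed
        moreover have "integral\<^sup>L circ (\<lambda>x. f x * indicator (\<Union>i<n. A i) x) = 0" for n
        proof (induction n)
          case (Suc n)
          have eq: "f x * indicator (\<Union>i<Suc n. A i) x = f x * indicator (\<Union>i<n. A i) x + f x * indicator (A n) x" for x
          proof -
            have "A n \<inter> A i = {}" if "i < n" for i
              by (rule disjoint_family_onD[OF \<open>disjoint_family A\<close>]) (use that in auto)
            then have "A n \<inter> (\<Union>i<n. A i) = {}" by auto
            moreover have "(\<Union>i<Suc n. A i) = A n \<union> (\<Union>i<n. A i)" by (simp add: lessThan_Suc)
            ultimately have "indicator (\<Union>i<Suc n. A i) x = (indicator (A n) x + indicator (\<Union>i<n. A i) x :: real)"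
              by (simp only: indicator_disj_union)
            then show ?thesis by (simp only: distrib_left add.commute)
          qed
          have "integrable circ (\<lambda>x. f x * indicator (\<Union>i<n. A i) x)" using Am by (intro ii) auto
          then show ?case unfolding eq using Suc that(3)[of n] ii[OF Am[of n]]
            by (subst Bochner_Integration.integral_add) simp_all
        qed simp
        ultimately show ?thesis by (simp add: LIMSEQ_const_iff)
      qed
    qed
  qed
  show ?thesis
  proof (rule density_unique_real)
    fix A assume "A \<in> sets circ"
    then obtain B where B: "B \<in> sets borel" "A = {0..<2*pi} \<inter> B"
      unfolding circ_def sets_restrict_space by auto
    have "(\<integral>x \<in> A. f x \<partial>circ) = integral\<^sup>L circ (\<lambda>x. f x * indicator B x)"
      unfolding set_lebesgue_integral_def
      by (intro Bochner_Integration.integral_cong) (auto simp: B space_circ indicator_def)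
    then show "(\<integral>x \<in> A. f x \<partial>circ) = (\<integral>x \<in> A. 0 \<partial>circ)"
      using zero_set[OF B(1)] by (simp add: set_lebesgue_integral_def)
  qed (use int in auto)
qed

section \<open>Trigonometric series with summable coefficients\<close>

text \<open>
  Cosine and sine series over all integers, with h = cos or h = sin. Two-sided sums keep the product
  formula free of case distinctions on the signs of frequencies.
\<close>

definition tsum :: "(real \<Rightarrow> real) \<Rightarrow> (int \<Rightarrow> real) \<Rightarrow> real \<Rightarrow> real" where
  "tsum h x \<theta> = (\<Sum>\<^sub>\<infinity>n. x n * h (of_int n * \<theta>))"

abbreviation "csum \<equiv> tsum cos"
abbreviation "ssum \<equiv> tsum sin"

lemma l1_mult_bounded:
  assumes "l1 x" "\<And>n. \<bar>c n\<bar> \<le> C"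
  shows "l1 (\<lambda>n. x n * c n)" "l1norm (\<lambda>n. x n * c n) \<le> C * l1norm x"
proof -
  have le: "\<bar>x n * c n\<bar> \<le> C * \<bar>x n\<bar>" for n
    using mult_left_mono[OF assms(2)[of n], of "\<bar>x n\<bar>"] by (simp add: abs_mult mult.commute)
  show "l1 (\<lambda>n. x n * c n)" "l1norm (\<lambda>n. x n * c n) \<le> C * l1norm x"
    using l1_cmult_le[OF assms(1) le] by auto
qed

lemma l1_has_sum: "l1 x \<Longrightarrow> (x has_sum infsum x UNIV) UNIV"
  by (intro has_sum_infsum l1_summable)

lemma has_sum_int_sums:
  fixes f :: "int \<Rightarrow> real"
  assumes "(f has_sum s) UNIV"
  shows "(\<lambda>i. f (int_decode i)) sums s"
proof -
  have "((\<lambda>i. f (int_decode i)) has_sum s) UNIV"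
    using assms has_sum_reindex_bij_betw[OF bij_int_decode, of f s] by simp
  then show ?thesis by (rule has_sum_imp_sums)
qed

lemma l1_summable_decode: "l1 x \<Longrightarrow> summable (\<lambda>i. \<bar>x (int_decode i)\<bar>)"
  using has_sum_int_sums[OF has_sum_infsum] unfolding l1_def by (rule sums_summable)

context
  fixes h :: "real \<Rightarrow> real"
  assumes h: "continuous_on UNIV h" "\<And>y. \<bar>h y\<bar> \<le> 1"
begin

lemma tsum_has_sum: "l1 x \<Longrightarrow> ((\<lambda>n. x n * h (of_int n * \<theta>)) has_sum tsum h x \<theta>) UNIV"
  unfolding tsum_def by (rule l1_has_sum) (rule l1_mult_bounded(1)[where C = 1], use h in auto)

lemma tsum_sums: "l1 x \<Longrightarrow> (\<lambda>i. x (int_decode i) * h (of_int (int_decode i) * \<theta>)) sums tsum h x \<theta>"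
  by (rule has_sum_int_sums[OF tsum_has_sum])

lemma tsum_bound: "l1 x \<Longrightarrow> \<bar>tsum h x \<theta>\<bar> \<le> l1norm x"
proof -
  assume x: "l1 x"
  note l = l1_mult_bounded[where c = "\<lambda>n. h (of_int n * \<theta>)" and C = 1, OF x h(2)]
  show ?thesis unfolding tsum_def using order_trans[OF l1_infsum_le[OF l(1)] l(2)] by simp
qed

lemma tsum_continuous: "l1 x \<Longrightarrow> continuous_on UNIV (tsum h x)"
proof -
  assume x: "l1 x"
  have "uniform_limit UNIV (\<lambda>n \<theta>. \<Sum>i<n. x (int_decode i) * h (of_int (int_decode i) * \<theta>))
     (\<lambda>\<theta>. \<Sum>i. x (int_decode i) * h (of_int (int_decode i) * \<theta>)) sequentially"
    by (rule Weierstrass_m_test[OF _ l1_summable_decode[OF x]])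
      (use mult_left_le[OF h(2) abs_ge_zero] in \<open>auto simp: abs_mult\<close>)
  moreover have "(\<lambda>\<theta>. \<Sum>i. x (int_decode i) * h (of_int (int_decode i) * \<theta>)) = tsum h x"
    using sums_unique[OF tsum_sums[OF x]] by auto
  ultimately have u: "uniform_limit UNIV (\<lambda>n \<theta>. \<Sum>i<n. x (int_decode i) * h (of_int (int_decode i) * \<theta>)) (tsum h x) sequentially"
    by simp
  show ?thesis
  proof (rule uniform_limit_theorem[OF _ u])
    show "\<forall>\<^sub>F n in sequentially. continuous_on UNIV (\<lambda>\<theta>. \<Sum>i<n. x (int_decode i) * h (of_int (int_decode i) * \<theta>))"
      by (intro always_eventually allI continuous_intros continuous_on_compose2[OF h(1)]) auto
  qed simp
qed

lemma tsum_borel: "l1 x \<Longrightarrow> tsum h x \<in> borel_measurable borel"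
  by (intro borel_measurable_continuous_onI tsum_continuous)

text \<open>
  Integration term by term. The theorem on series of integrals is about sums over the naturals, so the
  integers are enumerated by int-decode; absolute convergence makes the order irrelevant.
\<close>

lemma tsum_integral:
  assumes f: "integrable circ f" and x: "l1 x"
  shows "((\<lambda>n. x n * integral\<^sup>L circ (\<lambda>\<theta>. f \<theta> * h (of_int n * \<theta>))) has_sum integral\<^sup>L circ (\<lambda>\<theta>. f \<theta> * tsum h x \<theta>)) UNIV"
proof -
  define G where "G n \<theta> = f \<theta> * h (of_int n * \<theta>)" for n :: int and \<theta>
  have hb: "(\<lambda>\<theta>. h (of_int n * \<theta>)) \<in> borel_measurable borel" for n :: int
    by (intro borel_measurable_continuous_onI continuous_on_compose2[OF h(1)] continuous_intros) auto
  have G: "integrable circ (G n)" for n unfolding G_def by (rule integrable_circ_mult[OF f hb h(2)])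
  define I where "I = integral\<^sup>L circ (\<lambda>\<theta>. \<bar>f \<theta>\<bar>)"
  have GI: "integral\<^sup>L circ (\<lambda>\<theta>. \<bar>G n \<theta>\<bar>) \<le> I" for n
    unfolding I_def
  proof (rule integral_mono)
    show "integrable circ (\<lambda>\<theta>. \<bar>G n \<theta>\<bar>)" "integrable circ (\<lambda>\<theta>. \<bar>f \<theta>\<bar>)" by (intro integrable_abs G f)+
    show "\<bar>G n \<theta>\<bar> \<le> \<bar>f \<theta>\<bar>" for \<theta> by (simp add: G_def abs_mult mult_left_le h(2))
  qed
  then have GI': "\<bar>integral\<^sup>L circ (G n)\<bar> \<le> I" for n
    using order_trans[OF integral_norm_bound[of circ "G n"]] by simp
  have l: "l1 (\<lambda>n. x n * integral\<^sup>L circ (G n))" by (rule l1_mult_bounded(1)[OF x GI'])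
  have s1: "(\<lambda>i. x (int_decode i) * integral\<^sup>L circ (G (int_decode i))) sums (\<Sum>\<^sub>\<infinity>n. x n * integral\<^sup>L circ (G n))"
    by (rule has_sum_int_sums[OF l1_has_sum[OF l]])
  have "(\<lambda>i. integral\<^sup>L circ (\<lambda>\<theta>. x (int_decode i) * G (int_decode i) \<theta>)) sums
      (integral\<^sup>L circ (\<lambda>\<theta>. \<Sum>i. x (int_decode i) * G (int_decode i) \<theta>))"
  proof (rule sums_integral)
    show "integrable circ (\<lambda>\<theta>. x (int_decode i) * G (int_decode i) \<theta>)" for i using G by simp
    have "summable (\<lambda>i. norm (x (int_decode i) * G (int_decode i) \<theta>))" for \<theta>
    proof (rule summable_comparison_test'[OF summable_mult2[OF l1_summable_decode[OF x], of "\<bar>f \<theta>\<bar>"]])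
      show "norm (norm (x (int_decode n) * G (int_decode n) \<theta>)) \<le> \<bar>x (int_decode n)\<bar> * \<bar>f \<theta>\<bar>" for n
        unfolding G_def by (simp add: abs_mult mult_left_mono mult_left_le h(2))
    qed
    then show "AE \<theta> in circ. summable (\<lambda>i. norm (x (int_decode i) * G (int_decode i) \<theta>))" by simp
    show "summable (\<lambda>i. integral\<^sup>L circ (\<lambda>\<theta>. norm (x (int_decode i) * G (int_decode i) \<theta>)))"
    proof (rule summable_comparison_test'[OF summable_mult2[OF l1_summable_decode[OF x], of I]])
      show "norm (integral\<^sup>L circ (\<lambda>\<theta>. norm (x (int_decode n) * G (int_decode n) \<theta>))) \<le> \<bar>x (int_decode n)\<bar> * I" for n
        using GI[of "int_decode n"] by (simp add: abs_mult mult_left_mono)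
    qed
  qed
  moreover have "(\<Sum>i. x (int_decode i) * G (int_decode i) \<theta>) = f \<theta> * tsum h x \<theta>" for \<theta>
    using sums_unique[OF sums_mult[OF tsum_sums[OF x], of "f \<theta>" \<theta>]] by (simp add: G_def mult_ac)
  ultimately have "(\<lambda>i. x (int_decode i) * integral\<^sup>L circ (G (int_decode i))) sums integral\<^sup>L circ (\<lambda>\<theta>. f \<theta> * tsum h x \<theta>)"
    by simp
  then have "(\<Sum>\<^sub>\<infinity>n. x n * integral\<^sup>L circ (G n)) = integral\<^sup>L circ (\<lambda>\<theta>. f \<theta> * tsum h x \<theta>)"
    using s1 sums_unique2 by blast
  then show ?thesis using l1_has_sum[OF l] by (simp add: G_def[abs_def])
qed

end

lemma cos_bd: "continuous_on UNIV (cos :: real \<Rightarrow> real)" "\<And>y::real. \<bar>cos y\<bar> \<le> 1"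
  and sin_bd: "continuous_on UNIV (sin :: real \<Rightarrow> real)" "\<And>y::real. \<bar>sin y\<bar> \<le> 1"
  by (auto intro!: continuous_intros)

lemma cos_sin_periodic: "cos (of_int n * (\<theta> + 2*pi)) = cos (of_int n * \<theta>)" "sin (of_int n * (\<theta> + 2*pi)) = sin (of_int n * \<theta>)"
  using sin_int_2pi[of n] cos_int_2pi[of n] by (simp_all add: distrib_left cos_add sin_add)

lemma tsum_periodic: "circle_periodic (csum x)" "circle_periodic (ssum x)"
  by (simp_all only: circle_periodic_def tsum_def cos_sin_periodic simp_thms)

lemma csum_deriv:
  assumes x: "l1 x" and nx: "l1 (\<lambda>n. of_int n * x n)"
  shows "(csum x has_real_derivative - ssum (\<lambda>n. of_int n * x n) \<theta>) (at \<theta>)"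
proof -
  define f where "f i \<theta> = x (int_decode i) * cos (of_int (int_decode i) * \<theta>)" for i and \<theta> :: real
  define f' where "f' i \<theta> = - (of_int (int_decode i) * x (int_decode i) * sin (of_int (int_decode i) * \<theta>))" for i and \<theta> :: real
  have uc: "uniformly_convergent_on UNIV (\<lambda>n \<theta>. \<Sum>i<n. f' i \<theta>)"
    unfolding uniformly_convergent_on_def
    by (rule exI, rule Weierstrass_m_test[OF _ l1_summable_decode[OF nx]])
      (auto simp: f'_def abs_mult mult_left_le)
  have df: "(f i has_field_derivative f' i \<theta>) (at \<theta> within UNIV)" for i \<theta>
    unfolding f_def f'_def by (auto intro!: derivative_eq_intros)
  have sf: "summable (\<lambda>i. f i 0)"
    unfolding f_def using sums_summable[OF tsum_sums[OF cos_bd x]] .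
  have "((\<lambda>\<theta>. \<Sum>i. f i \<theta>) has_field_derivative (\<Sum>i. f' i \<theta>)) (at \<theta>)"
    by (rule has_field_derivative_series'(2)[OF convex_UNIV df uc UNIV_I sf]) simp
  moreover have "(\<lambda>\<theta>. \<Sum>i. f i \<theta>) = csum x"
    using sums_unique[OF tsum_sums[OF cos_bd x]] by (auto simp: f_def)
  moreover have "(\<Sum>i. f' i \<theta>) = - ssum (\<lambda>n. of_int n * x n) \<theta>"
    using sums_unique[OF sums_minus[OF tsum_sums[OF sin_bd nx]]] by (simp add: f'_def)
  ultimately show ?thesis by simp
qed

lemma delta_has_sum: "((\<lambda>n. x n * of_bool (n = k)) has_sum (x k :: real)) UNIV" for k :: int
  by (rule has_sum_finite_neutralI[of "{k}"]) auto

lemma integral_cos_csum: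
  assumes x: "l1 x"
  shows "integral\<^sup>L circ (\<lambda>\<theta>. cos (of_int k * \<theta>) * csum x \<theta>) = pi * (x k + x (- k))"
proof -
  have "((\<lambda>n. pi * (x n * of_bool (n = k)) + pi * (x n * of_bool (n = - k))) has_sum (pi * x k + pi * x (- k))) UNIV"
    by (intro has_sum_add has_sum_cmult_right delta_has_sum)
  moreover have "pi * (x n * of_bool (n = k)) + pi * (x n * of_bool (n = - k))
     = x n * integral\<^sup>L circ (\<lambda>\<theta>. cos (of_int k * \<theta>) * cos (of_int n * \<theta>))" for n
    unfolding integral_circ_cos_cos by (auto simp: of_bool_def)
  ultimately have "((\<lambda>n. x n * integral\<^sup>L circ (\<lambda>\<theta>. cos (of_int k * \<theta>) * cos (of_int n * \<theta>))) has_sum (pi * x k + pi * x (- k))) UNIV"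
    by simp
  from has_sum_unique[OF tsum_integral[OF cos_bd integrable_circ_cos(1) x] this] show ?thesis
    by (simp add: distrib_left)
qed

lemma integral_sin_csum:
  assumes x: "l1 x"
  shows "integral\<^sup>L circ (\<lambda>\<theta>. sin (of_int k * \<theta>) * csum x \<theta>) = 0"
  using has_sum_unique[OF tsum_integral[OF cos_bd integrable_circ_cos(2) x, of "of_int k"]] has_sum_0
  by (simp add: integral_circ_sin_cos)

lemma integral_sin_ssum:
  assumes x: "l1 x"
  shows "integral\<^sup>L circ (\<lambda>\<theta>. sin (of_int k * \<theta>) * ssum x \<theta>) = pi * (x k - x (- k))"
proof -
  have "((\<lambda>n. pi * (x n * of_bool (n = k)) + (- pi) * (x n * of_bool (n = - k))) has_sum (pi * x k + (- pi) * x (- k))) UNIV"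
    by (intro has_sum_add has_sum_cmult_right delta_has_sum)
  moreover have "pi * (x n * of_bool (n = k)) + (- pi) * (x n * of_bool (n = - k))
     = x n * integral\<^sup>L circ (\<lambda>\<theta>. sin (of_int k * \<theta>) * sin (of_int n * \<theta>))" for n
    unfolding integral_circ_sin_sin by (auto simp: of_bool_def)
  ultimately have "((\<lambda>n. x n * integral\<^sup>L circ (\<lambda>\<theta>. sin (of_int k * \<theta>) * sin (of_int n * \<theta>))) has_sum (pi * x k + (- pi) * x (- k))) UNIV"
    by simp
  from has_sum_unique[OF tsum_integral[OF sin_bd integrable_circ_cos(2) x] this] show ?thesis
    by (simp add: right_diff_distrib)
qed

lemma even_ssum_0:
  assumes "\<And>n. x (- n) = x n"
  shows "ssum x \<theta> = 0"
proof -
  have "ssum x \<theta> = (\<Sum>\<^sub>\<infinity>n. - (x n * sin (of_int n * \<theta>)))"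
    unfolding tsum_def
    by (rule infsum_reindex_bij_witness[where i = uminus and j = uminus]) (auto simp: assms)
  also have "\<dots> = - ssum x \<theta>" by (simp add: infsum_uminus tsum_def)
  finally show ?thesis by simp
qed

text \<open>
  By the addition theorem, the coefficient of sin n\<theta> in the product is the convolution; the second half of
  the addition theorem contributes a multiple of ssum U, which vanishes for even U.
\<close>

lemma ssum_csum_product:
  assumes D: "l1 D" and U: "l1 U" "\<And>n. U (- n) = U n"
  shows "ssum D \<theta> * csum U \<theta> = ssum (qconv (\<lambda>_ _. 1) D U) \<theta>"
proof -
  have K: "\<bar>sin (of_int n * \<theta>)\<bar> \<le> 1" for n :: int by simp
  have sm: "(\<lambda>(n, k). sin (of_int n * \<theta>) * D k * U (n - k)) summable_on UNIV \<times> UNIV"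
    by (rule qconv_summable(2)[where K = "\<lambda>n k. sin (of_int n * \<theta>)", OF D U(1) K])
  have "ssum (qconv (\<lambda>_ _. 1) D U) \<theta> = (\<Sum>\<^sub>\<infinity>n. \<Sum>\<^sub>\<infinity>k. sin (of_int n * \<theta>) * D k * U (n - k))"
    unfolding tsum_def qconv_def by (simp add: infsum_cmult_right'[symmetric] infsum_cmult_left'[symmetric] mult_ac)
  also have "\<dots> = (\<Sum>\<^sub>\<infinity>k. \<Sum>\<^sub>\<infinity>n. sin (of_int n * \<theta>) * D k * U (n - k))"
    by (rule infsum_swap_banach[OF sm])
  also have "\<dots> = (\<Sum>\<^sub>\<infinity>k. D k * sin (of_int k * \<theta>) * csum U \<theta>)"
  proof (rule infsum_cong)
    fix k :: int
    have "(\<Sum>\<^sub>\<infinity>n. sin (of_int n * \<theta>) * D k * U (n - k)) = (\<Sum>\<^sub>\<infinity>j. sin (of_int (j + k) * \<theta>) * D k * U j)"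
      by (rule infsum_reindex_bij_witness[where i = "\<lambda>j. j + k" and j = "\<lambda>n. n - k"]) auto
    also have "\<dots> = (\<Sum>\<^sub>\<infinity>j. D k * sin (of_int k * \<theta>) * (U j * cos (of_int j * \<theta>))
         + D k * cos (of_int k * \<theta>) * (U j * sin (of_int j * \<theta>)))"
      by (rule infsum_cong) (simp add: distrib_right sin_add algebra_simps)
    also have "\<dots> = D k * sin (of_int k * \<theta>) * csum U \<theta> + D k * cos (of_int k * \<theta>) * ssum U \<theta>"
      by (intro infsumI has_sum_add has_sum_cmult_right tsum_has_sum cos_bd sin_bd U(1))
    finally show "(\<Sum>\<^sub>\<infinity>n. sin (of_int n * \<theta>) * D k * U (n - k)) = D k * sin (of_int k * \<theta>) * csum U \<theta>"
      by (simp add: even_ssum_0[where x = U, OF U(2)])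
  qed
  also have "\<dots> = ssum D \<theta> * csum U \<theta>" by (simp add: infsum_cmult_left' tsum_def)
  finally show ?thesis by simp
qed

lemma csum_nat_series:
  assumes x: "l1 x" "\<And>n. x (- n) = x n" "x 0 = 0"
  shows "(\<lambda>i. x (int (Suc i)) * cos (real (Suc i) * \<theta>)) sums (csum x \<theta> / 2)"
proof -
  define f where "f n = x n * cos (of_int n * \<theta>)" for n
  define g where "g i = f (int (Suc i))" for i
  have f: "(f has_sum csum x \<theta>) UNIV" unfolding f_def by (rule tsum_has_sum[OF cos_bd x(1)])
  define P where "P = range (\<lambda>i. int (Suc i))"
  define N where "N = range (\<lambda>i. - int (Suc i))"
  have "f summable_on P" using has_sum_imp_summable[OF f] by (rule summable_on_subset_banach) auto
  then obtain s where sP: "(f has_sum s) P" by (auto simp: summable_on_def)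
  then have g: "(g has_sum s) UNIV"
    unfolding P_def g_def by (subst (asm) has_sum_reindex) (auto simp: inj_on_def o_def)
  have fm: "f (- n) = f n" for n by (simp add: f_def x(2))
  have "((\<lambda>i. f (- int (Suc i))) has_sum s) UNIV" unfolding fm using g unfolding g_def .
  then have sN: "(f has_sum s) N"
    unfolding N_def by (subst has_sum_reindex) (auto simp: inj_on_def o_def)
  have s0: "(f has_sum 0) {0}" using has_sum_finiteI[of "{0}" 0 f] by (simp add: f_def x(3))
  have "(f has_sum (s + s + 0)) ((P \<union> N) \<union> {0})"
    by (intro has_sum_Un_disjoint sP sN s0) (auto simp: P_def N_def)
  moreover have "(P \<union> N) \<union> {0} = UNIV"
  proof -
    have "n \<in> (P \<union> N) \<union> {0}" for n :: int
    proof -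
      consider "n = 0" | "n > 0" | "n < 0" by linarith
      then show ?thesis
      proof cases
        case 2
        then have "n = int (Suc (nat n - 1))" by simp
        then show ?thesis unfolding P_def by blast
      next
        case 3
        then have "n = - int (Suc (nat (- n) - 1))" by simp
        then show ?thesis unfolding N_def by blast
      qed simp
    qed
    then show ?thesis by blast
  qed
  ultimately have "csum x \<theta> = s + s" using has_sum_unique[OF f, of "s + s"] by simp
  then have half: "csum x \<theta> / 2 = s" by simp
  show ?thesis unfolding half using has_sum_imp_sums[OF g] by (simp add: g_def[abs_def] f_def del: of_nat_Suc)
qed

text \<open>
  The coefficients of the function f(m\<theta>) when x are those of f.
\<close>

definition spread :: "nat \<Rightarrow> (int \<Rightarrow> real) \<Rightarrow> int \<Rightarrow> real" where
  "spread m x n = (if int m dvd n then x (n div int m) else 0)"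

lemma spread_mult: "m > 0 \<Longrightarrow> spread m x (int m * n) = x n"
  by (simp add: spread_def)

lemma spread_reindex:
  fixes f :: "int \<Rightarrow> real"
  assumes m: "m > 0" and f: "\<And>n. \<not> int m dvd n \<Longrightarrow> f n = 0"
  shows "(\<lambda>n. f (int m * n)) summable_on UNIV \<longleftrightarrow> f summable_on UNIV"
    and "(\<Sum>\<^sub>\<infinity>n. f (int m * n)) = (\<Sum>\<^sub>\<infinity>n. f n)"
proof -
  have inj: "inj (\<lambda>n. int m * n)" using m by (auto simp: inj_on_def)
  have out: "f n = 0" if "n \<in> UNIV - range (\<lambda>n. int m * n)" for n
  proof -
    have "\<not> int m dvd n" using that by (auto simp: dvd_def)
    then show ?thesis by (rule f)
  qed
  show "(\<lambda>n. f (int m * n)) summable_on UNIV \<longleftrightarrow> f summable_on UNIV"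
    using summable_on_reindex[OF inj, of f] summable_on_cong_neutral[of "range (\<lambda>n. int m * n)" UNIV f f] out
    by (auto simp: o_def)
  show "(\<Sum>\<^sub>\<infinity>n. f (int m * n)) = (\<Sum>\<^sub>\<infinity>n. f n)"
    using infsum_reindex[OF inj, of f] infsum_cong_neutral[of "range (\<lambda>n. int m * n)" UNIV f f] out
    by (auto simp: o_def)
qed

lemma spread_l1: "m > 0 \<Longrightarrow> l1 (spread m x) \<longleftrightarrow> l1 x"
  unfolding l1_def
  using spread_reindex(1)[of m "\<lambda>n. \<bar>spread m x n\<bar>"] by (simp add: spread_mult) (simp add: spread_def)

lemma spread_l1norm: "m > 0 \<Longrightarrow> l1norm (spread m x) = l1norm x"
  unfolding l1norm_def
  using spread_reindex(2)[of m "\<lambda>n. \<bar>spread m x n\<bar>"] by (simp add: spread_mult) (simp add: spread_def)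

lemma spread_tsum: "m > 0 \<Longrightarrow> tsum h (spread m x) \<theta> = tsum h x (real m * \<theta>)"
  unfolding tsum_def
  using spread_reindex(2)[of m "\<lambda>n. spread m x n * h (of_int n * \<theta>)"]
  by (simp add: spread_mult mult_ac) (simp add: spread_def)

lemma spread_weight: "(\<lambda>n. of_int n * spread m x n) = spread m (\<lambda>n. real m * (of_int n * x n))"
  by (auto simp: spread_def fun_eq_iff elim!: dvdE)

lemma spread_qconv:
  assumes m: "m > 0"
  shows "qconv K (spread m x) (spread m y) n
     = (if int m dvd n then qconv (\<lambda>n k. K (int m * n) (int m * k)) x y (n div int m) else 0)"
proof (cases "int m dvd n")
  case True
  then obtain N where n: "n = int m * N" by (auto simp: dvd_def)
  have "spread m y (int m * N - int m * k) = y (N - k)" for k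
    using spread_mult[OF m, of y "N - k"] by (simp add: right_diff_distrib)
  then show ?thesis
    unfolding qconv_def n
    using spread_reindex(2)[OF m, of "\<lambda>k. K (int m * N) k * spread m x k * spread m y (int m * N - k)"]
    using m by (simp add: spread_mult) (simp add: spread_def)
next
  case False
  have z: "K n k * spread m x k * spread m y (n - k) = 0" for k
  proof (cases "int m dvd k")
    case True
    then have "\<not> int m dvd (n - k)" using False by (metis dvd_diff_commute dvd_add_right_iff diff_add_cancel)
    then show ?thesis by (simp add: spread_def)
  qed (simp add: spread_def)
  show ?thesis using False by (simp only: qconv_def z infsum_0_simp if_False)
qed

section \<open>Weak derivatives\<close>

lemma periodic_deriv:
  assumes "circle_periodic f" "\<And>x. (f has_real_derivative g x) (at x)"
  shows "circle_periodic g"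
  unfolding circle_periodic_def
proof
  fix x
  have "((\<lambda>x. f (x + 2*pi)) has_real_derivative g (x + 2*pi)) (at x)"
    using DERIV_shift[of f "g (x + 2*pi)" x "2*pi"] assms(2) by simp
  then have "(f has_real_derivative g (x + 2*pi)) (at x)"
    using assms(1) by (simp add: circle_periodic_def)
  then show "g (x + 2*pi) = g x" using assms(2) DERIV_unique by blast
qed

lemma deriv_imp_continuous:
  fixes f :: "real \<Rightarrow> real"
  assumes "\<And>x. (f has_real_derivative g x) (at x)"
  shows "continuous_on UNIV f"
  by (rule DERIV_continuous_on) (use assms in simp)

lemma circle_test_facts:
  assumes "circle_test \<phi>"
  shows "(\<phi> has_real_derivative deriv \<phi> x) (at x)" "(deriv \<phi> has_real_derivative deriv (deriv \<phi>) x) (at x)"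
    "circle_periodic \<phi>" "circle_periodic (deriv \<phi>)" "continuous_on UNIV \<phi>" "continuous_on UNIV (deriv \<phi>)"
    "continuous_on UNIV (deriv (deriv \<phi>))" "circle_periodic (deriv (deriv \<phi>))"
proof -
  have d: "((deriv ^^ n) \<phi>) field_differentiable (at x)" for n x using assms unfolding circle_test_def by blast
  show d0: "(\<phi> has_real_derivative deriv \<phi> x) (at x)" for x
    using d[of 0 x] by (simp add: DERIV_deriv_iff_field_differentiable)
  show d1: "(deriv \<phi> has_real_derivative deriv (deriv \<phi>) x) (at x)" for x
    using d[of 1 x] by (simp add: DERIV_deriv_iff_field_differentiable)
  have d2: "(deriv (deriv \<phi>) has_real_derivative deriv (deriv (deriv \<phi>)) x) (at x)" for x
    using d[of 2 x] by (simp add: DERIV_deriv_iff_field_differentiable numeral_2_eq_2)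
  show p: "circle_periodic \<phi>" using assms by (simp add: circle_test_def)
  show p': "circle_periodic (deriv \<phi>)" by (rule periodic_deriv[OF p d0])
  show "circle_periodic (deriv (deriv \<phi>))" by (rule periodic_deriv[OF p' d1])
  show "continuous_on UNIV \<phi>" "continuous_on UNIV (deriv \<phi>)" "continuous_on UNIV (deriv (deriv \<phi>))"
    by (rule deriv_imp_continuous[OF d0], rule deriv_imp_continuous[OF d1], rule deriv_imp_continuous[OF d2])
qed

lemma trig_test:
  shows "circle_test (\<lambda>x. cos (of_int n * x))" "circle_test (\<lambda>x. sin (of_int n * x))"
proof -
  define F where "F A B x = A * cos (of_int n * x) + B * sin (of_int n * x)" for A B x :: real
  have dF: "(F A B has_real_derivative F (B * of_int n) (- A * of_int n) x) (at x)" for A B x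
    unfolding F_def by (auto intro!: derivative_eq_intros simp: algebra_simps)
  have "\<exists>C D. (deriv ^^ k) (F A B) = F C D" for k A B
  proof (induction k)
    case (Suc k)
    then obtain C D where "(deriv ^^ k) (F A B) = F C D" by auto
    then have "(deriv ^^ Suc k) (F A B) = F (D * of_int n) (- C * of_int n)"
      using DERIV_imp_deriv[OF dF[of C D]] by auto
    then show ?case by blast
  qed auto
  then have diff: "((deriv ^^ k) (F A B)) field_differentiable (at x)" for k A B x
    using dF field_differentiable_def by metis
  have per: "circle_periodic (F A B)" for A B
    unfolding circle_periodic_def F_def by (simp only: cos_sin_periodic simp_thms)
  have "(\<lambda>x. cos (of_int n * x)) = F 1 0" "(\<lambda>x. sin (of_int n * x)) = F 0 1" by (auto simp: F_def)
  then show "circle_test (\<lambda>x. cos (of_int n * x))" "circle_test (\<lambda>x. sin (of_int n * x))"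
    using diff per by (simp_all add: circle_test_def)
qed

lemma deriv_trig:
  "deriv (\<lambda>x. cos (of_int n * x)) = (\<lambda>x. - of_int n * sin (of_int n * x))"
  "deriv (\<lambda>x. sin (of_int n * x)) = (\<lambda>x. of_int n * cos (of_int n * x :: real))"
  by (rule ext, rule DERIV_imp_deriv, auto intro!: derivative_eq_intros)+

lemma deriv_deriv_cos:
  "deriv (deriv (\<lambda>x. cos (of_int n * x))) = (\<lambda>x. - (of_int n)\<^sup>2 * cos (of_int n * x :: real))"
  unfolding deriv_trig
  by (rule ext, rule DERIV_imp_deriv, auto intro!: derivative_eq_intros simp: power2_eq_square)

lemma integrable_circ_continuous:
  assumes "continuous_on UNIV f" "circle_periodic f"
  shows "integrable circ f"
proof -
  obtain B where "\<forall>x. \<bar>f x\<bar> \<le> B" using continuous_periodic_bounded[OF assms] by metis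
  then show ?thesis by (intro integrable_circ_bounded[OF borel_measurable_continuous_onI[OF assms(1)], of B]) simp
qed

lemma circle_periodic_mult: "circle_periodic f \<Longrightarrow> circle_periodic g \<Longrightarrow> circle_periodic (\<lambda>x. f x * g x)"
  by (simp add: circle_periodic_def)

lemma continuous_circle_L2:
  assumes "continuous_on UNIV f" "circle_periodic f"
  shows "circle_L2 f"
proof -
  have "integrable circ (\<lambda>x. f x * f x)"
    by (intro integrable_circ_continuous continuous_intros assms circle_periodic_mult)
  then show ?thesis
    using assms by (auto simp: circle_L2_def set_integrable_circ power2_eq_square intro: borel_measurable_continuous_onI)
qed

text \<open>
  Periodicity cancels the boundary terms, so C^1 functions have the expected weak derivative.
\<close>

lemma integral_circ_by_parts:
  assumes f: "\<And>x. (f has_real_derivative f' x) (at x)" "continuous_on UNIV f'" "circle_periodic f"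
    and g: "\<And>x. (g has_real_derivative g' x) (at x)" "continuous_on UNIV g'" "circle_periodic g"
  shows "integral\<^sup>L circ (\<lambda>x. f x * g' x) = - integral\<^sup>L circ (\<lambda>x. f' x * g x)"
proof -
  have c: "continuous_on UNIV f" "continuous_on UNIV g" by (rule deriv_imp_continuous[OF f(1)], rule deriv_imp_continuous[OF g(1)])
  have p: "circle_periodic f'" "circle_periodic g'" using periodic_deriv[OF f(3,1)] periodic_deriv[OF g(3,1)] by auto
  have i: "integrable circ (\<lambda>x. f x * g' x)" "integrable circ (\<lambda>x. f' x * g x)"
    by (intro integrable_circ_continuous continuous_intros circle_periodic_mult c p f g)+
  have "integral\<^sup>L circ (\<lambda>x. f x * g' x + f' x * g x) = f (2*pi) * g (2*pi) - f 0 * g 0"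
    by (rule integral_circ_FTC) (use f g c in \<open>auto intro!: derivative_eq_intros continuous_intros\<close>)
  also have "\<dots> = 0"
    using f(3)[unfolded circle_periodic_def, rule_format, of 0] g(3)[unfolded circle_periodic_def, rule_format, of 0] by simp
  finally show ?thesis using i by simp
qed

lemma C1_has_weak_deriv:
  assumes "\<And>x. (f has_real_derivative g x) (at x)" "continuous_on UNIV g" "circle_periodic f"
  shows "has_weak_deriv f g"
  unfolding has_weak_deriv_def circle_integral_circ
proof (intro conjI allI impI)
  show "circle_L2 f" by (intro continuous_circle_L2 deriv_imp_continuous[OF assms(1)] assms(3))
  show "circle_L2 g" by (rule continuous_circle_L2[OF assms(2) periodic_deriv[OF assms(3,1)]])
  fix \<phi> assume t: "circle_test \<phi>"
  note T = circle_test_facts[OF t]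
  show "integral\<^sup>L circ (\<lambda>x. f x * deriv \<phi> x) = - integral\<^sup>L circ (\<lambda>x. g x * \<phi> x)"
    by (rule integral_circ_by_parts[OF assms T(1,6,3)])
qed

lemma circle_L2_facts:
  assumes "circle_L2 f"
  shows "circle_periodic f" "f \<in> borel_measurable borel" "integrable circ (\<lambda>x. (f x)\<^sup>2)" "integrable circ f"
proof -
  show p: "circle_periodic f" and b: "f \<in> borel_measurable borel" and i: "integrable circ (\<lambda>x. (f x)\<^sup>2)"
    using assms by (simp_all add: circle_L2_def set_integrable_circ)
  show "integrable circ f" by (rule integrable_circ_L2[OF b i])
qed

lemma integrable_circ_trig:
  assumes "integrable circ f"
  shows "integrable circ (\<lambda>x. f x * cos (c * x))" "integrable circ (\<lambda>x. f x * sin (c * x))"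
  by (rule integrable_circ_mult[OF assms, of _ 1]; simp)+

lemma trig_unique:
  assumes f: "circle_L2 f" and g: "circle_L2 g"
    and c: "\<And>n. integral\<^sup>L circ (\<lambda>x. f x * cos (of_int n * x)) = integral\<^sup>L circ (\<lambda>x. g x * cos (of_int n * x))"
    and s: "\<And>n. integral\<^sup>L circ (\<lambda>x. f x * sin (of_int n * x)) = integral\<^sup>L circ (\<lambda>x. g x * sin (of_int n * x))"
  shows "AE x in lborel. f x = g x" "AE x in circ. f x = g x"
proof -
  note F = circle_L2_facts[OF f] and G = circle_L2_facts[OF g]
  have "AE x in circ. f x - g x = 0"
  proof (rule trig_complete)
    show "integrable circ (\<lambda>x. f x - g x)" using F G by simp
    show "integral\<^sup>L circ (\<lambda>x. (f x - g x) * cos (of_nat n * x)) = 0" for n :: nat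
      using c[of "int n"] integrable_circ_trig(1)[OF F(4), of "real n"] integrable_circ_trig(1)[OF G(4), of "real n"]
      by (simp add: left_diff_distrib)
    show "integral\<^sup>L circ (\<lambda>x. (f x - g x) * sin (of_nat n * x)) = 0" for n :: nat
      using s[of "int n"] integrable_circ_trig(2)[OF F(4), of "real n"] integrable_circ_trig(2)[OF G(4), of "real n"]
      by (simp add: left_diff_distrib)
  qed
  then show "AE x in circ. f x = g x" by simp
  then show "AE x in lborel. f x = g x" by (rule AE_periodic[OF F(1) G(1) F(2) G(2)])
qed

text \<open>
  Trigonometric functions are test functions, and by completeness their integrals determine a square
  integrable function up to a null set. Hence every expression in the chosen weak derivative can be computed
  from any other representative.
\<close>

lemma weak_deriv_unique:
  assumes "has_weak_deriv f g" "has_weak_deriv f h"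
  shows "AE x in circ. g x = h x"
proof (rule trig_unique(2))
  show "circle_L2 g" "circle_L2 h" using assms by (auto simp: has_weak_deriv_def)
  have eq: "integral\<^sup>L circ (\<lambda>x. g x * \<phi> x) = integral\<^sup>L circ (\<lambda>x. h x * \<phi> x)" if "circle_test \<phi>" for \<phi>
  proof -
    have "integral\<^sup>L circ (\<lambda>x. f x * deriv \<phi> x) = - integral\<^sup>L circ (\<lambda>x. g x * \<phi> x)"
      by (rule assms(1)[unfolded has_weak_deriv_def circle_integral_circ, THEN conjunct2, THEN conjunct2, rule_format, OF that])
    moreover have "integral\<^sup>L circ (\<lambda>x. f x * deriv \<phi> x) = - integral\<^sup>L circ (\<lambda>x. h x * \<phi> x)"
      by (rule assms(2)[unfolded has_weak_deriv_def circle_integral_circ, THEN conjunct2, THEN conjunct2, rule_format, OF that])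
    ultimately show ?thesis by simp
  qed
  show "integral\<^sup>L circ (\<lambda>x. g x * cos (of_int n * x)) = integral\<^sup>L circ (\<lambda>x. h x * cos (of_int n * x))"
    "integral\<^sup>L circ (\<lambda>x. g x * sin (of_int n * x)) = integral\<^sup>L circ (\<lambda>x. h x * sin (of_int n * x))" for n
    by (rule eq[OF trig_test(1)], rule eq[OF trig_test(2)])
qed

lemma has_weak_deriv_weak_deriv:
  assumes "has_weak_deriv f g"
  shows "has_weak_deriv f (weak_deriv f)" "AE x in circ. weak_deriv f x = g x"
proof -
  show w: "has_weak_deriv f (weak_deriv f)" unfolding weak_deriv_def by (rule someI[of "has_weak_deriv f", OF assms])
  show "AE x in circ. weak_deriv f x = g x" by (rule weak_deriv_unique[OF w assms])
qed

lemma H1_norm_eq: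
  assumes "has_weak_deriv f g"
  shows "H1_norm f = sqrt (integral\<^sup>L circ (\<lambda>x. (f x)\<^sup>2 + (g x)\<^sup>2))"
proof -
  have L: "circle_L2 f" "circle_L2 g" "circle_L2 (weak_deriv f)"
    using assms has_weak_deriv_weak_deriv(1)[OF assms] by (auto simp: has_weak_deriv_def)
  have m: "f \<in> borel_measurable circ" "g \<in> borel_measurable circ" "weak_deriv f \<in> borel_measurable circ"
    using L circle_L2_facts(2) borel_circ by blast+
  have "integral\<^sup>L circ (\<lambda>x. (f x)\<^sup>2 + (weak_deriv f x)\<^sup>2) = integral\<^sup>L circ (\<lambda>x. (f x)\<^sup>2 + (g x)\<^sup>2)"
  proof (rule integral_cong_AE)
    show "AE x in circ. (f x)\<^sup>2 + (weak_deriv f x)\<^sup>2 = (f x)\<^sup>2 + (g x)\<^sup>2"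
      using has_weak_deriv_weak_deriv(2)[OF assms] by eventually_elim simp
    show "(\<lambda>x. (f x)\<^sup>2 + (weak_deriv f x)\<^sup>2) \<in> borel_measurable circ"
      "(\<lambda>x. (f x)\<^sup>2 + (g x)\<^sup>2) \<in> borel_measurable circ"
      by (intro borel_measurable_add borel_measurable_power m)+
  qed
  then show ?thesis by (simp add: H1_norm_def circle_integral_circ)
qed

lemma csum_weak_deriv:
  assumes x: "l1 x" and nx: "l1 (\<lambda>n. of_int n * x n)"
  shows "has_weak_deriv (csum x) (\<lambda>\<theta>. - ssum (\<lambda>n. of_int n * x n) \<theta>)"
  by (intro C1_has_weak_deriv csum_deriv x nx tsum_periodic continuous_on_minus tsum_continuous sin_bd)

lemma l1_weighted_le:
  assumes nx: "l1 (\<lambda>n. of_int n * x n)" and x0: "x 0 = (0::real)"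
  shows "l1 x" "l1norm x \<le> l1norm (\<lambda>n. of_int n * x n)"
proof -
  have "\<bar>x n\<bar> \<le> 1 * \<bar>of_int n * x n\<bar>" for n
  proof (cases "n = 0")
    case False
    then have "1 \<le> \<bar>of_int n :: real\<bar>" by linarith
    then show ?thesis using mult_right_mono[of 1 "\<bar>of_int n :: real\<bar>" "\<bar>x n\<bar>"] by (simp add: abs_mult)
  qed (use x0 in simp)
  from l1_cmult_le[OF nx this] show "l1 x" "l1norm x \<le> l1norm (\<lambda>n. of_int n * x n)" by auto
qed

text \<open>
  The l1 norm of n x_n dominates the series and its derivative uniformly, hence the H^1 norm; 4 absorbs
  the root of 2 \<cdot> 2\<pi>.
\<close>

lemma H1_norm_csum_le:
  assumes nx: "l1 (\<lambda>n. of_int n * x n)" and x0: "x 0 = 0"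
  shows "H1_norm (csum x) \<le> 4 * l1norm (\<lambda>n. of_int n * x n)"
proof -
  note x = l1_weighted_le[OF nx x0]
  define B where "B = l1norm (\<lambda>n. of_int n * x n)"
  have B: "0 \<le> B" unfolding B_def by (rule l1norm_nonneg)
  have b: "\<bar>csum x \<theta>\<bar> \<le> B" "\<bar>ssum (\<lambda>n. of_int n * x n) \<theta>\<bar> \<le> B" for \<theta>
    using tsum_bound[OF cos_bd x(1), of \<theta>] tsum_bound[OF sin_bd nx, of \<theta>] x(2) by (auto simp: B_def)
  have sq: "y\<^sup>2 \<le> B\<^sup>2" if "\<bar>y\<bar> \<le> B" for y :: real using that B abs_le_square_iff[of y B] by simp
  have i: "integrable circ (\<lambda>\<theta>. (csum x \<theta>)\<^sup>2 + (- ssum (\<lambda>n. of_int n * x n) \<theta>)\<^sup>2)"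
  proof -
    have "circle_L2 (csum x)" "circle_L2 (\<lambda>\<theta>. - ssum (\<lambda>n. of_int n * x n) \<theta>)"
      using csum_weak_deriv[OF x(1) nx] unfolding has_weak_deriv_def by blast+
    then show ?thesis by (intro Bochner_Integration.integrable_add circle_L2_facts(3))
  qed
  have "integral\<^sup>L circ (\<lambda>\<theta>. (csum x \<theta>)\<^sup>2 + (- ssum (\<lambda>n. of_int n * x n) \<theta>)\<^sup>2) \<le> integral\<^sup>L circ (\<lambda>\<theta>. (B\<^sup>2 + B\<^sup>2) * cos (of_int 0 * \<theta>))"
  proof (rule integral_mono[OF i])
    show "integrable circ (\<lambda>\<theta>. (B\<^sup>2 + B\<^sup>2) * cos (of_int 0 * \<theta>))"
      by (intro integrable_mult_right integrable_circ_cos)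
    show "(csum x \<theta>)\<^sup>2 + (- ssum (\<lambda>n. of_int n * x n) \<theta>)\<^sup>2 \<le> (B\<^sup>2 + B\<^sup>2) * cos (of_int 0 * \<theta>)" for \<theta>
      using sq[OF b(1)[of \<theta>]] sq[OF b(2)[of \<theta>]] by simp
  qed
  also have "\<dots> = (B\<^sup>2 + B\<^sup>2) * (2 * pi)" using integral_circ_cos[of 0] by simp
  also have "\<dots> = (4 * B\<^sup>2) * pi" by simp
  also have "\<dots> \<le> (4 * B\<^sup>2) * 4" using pi_less_4 by (intro mult_left_mono) auto
  also have "\<dots> = (4 * B)\<^sup>2" by (simp add: power2_eq_square)
  finally have "H1_norm (csum x) \<le> sqrt ((4 * B)\<^sup>2)"
    unfolding H1_norm_eq[OF csum_weak_deriv[OF x(1) nx]] by (rule real_sqrt_le_mono)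
  also have "sqrt ((4 * B)\<^sup>2) = 4 * B" using B by (simp only: real_sqrt_abs)
  finally show ?thesis by (simp add: B_def)
qed

section \<open>The potential and its convolutions\<close>

text \<open>
  Pointwise |f| \<le> e + f^2/e, integrated. With e small, mean square convergence implies convergence in the mean.
\<close>

lemma L1_le_L2:
  assumes f: "f \<in> borel_measurable borel" "integrable circ (\<lambda>x. (f x)\<^sup>2)" and e: "0 < e"
  shows "integral\<^sup>L circ (\<lambda>x. \<bar>f x\<bar>) \<le> e * (2 * pi) + integral\<^sup>L circ (\<lambda>x. (f x)\<^sup>2) / e"
proof -
  have "integral\<^sup>L circ (\<lambda>x. \<bar>f x\<bar>) \<le> integral\<^sup>L circ (\<lambda>x. e * cos (of_int 0 * x) + (f x)\<^sup>2 / e)"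
  proof (rule integral_mono)
    show "integrable circ (\<lambda>x. \<bar>f x\<bar>)" by (rule integrable_abs[OF integrable_circ_L2[OF f]])
    show "integrable circ (\<lambda>x. e * cos (of_int 0 * x) + (f x)\<^sup>2 / e)"
      by (intro Bochner_Integration.integrable_add integrable_mult_right integrable_divide integrable_circ_cos f(2))
    show "\<bar>f x\<bar> \<le> e * cos (of_int 0 * x) + (f x)\<^sup>2 / e" for x
    proof (cases "\<bar>f x\<bar> \<le> e")
      case True
      have "0 \<le> (f x)\<^sup>2 / e" using e by simp
      then have "\<bar>f x\<bar> \<le> e + (f x)\<^sup>2 / e" using True by linarith
      then show ?thesis by simp
    next
      case False
      then have "e * \<bar>f x\<bar> \<le> (f x)\<^sup>2"
        using mult_right_mono[of e "\<bar>f x\<bar>" "\<bar>f x\<bar>"] by (simp add: power2_eq_square)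
      then have "\<bar>f x\<bar> \<le> (f x)\<^sup>2 / e" using e by (simp add: pos_le_divide_eq mult.commute)
      then have "\<bar>f x\<bar> \<le> e + (f x)\<^sup>2 / e" using e by linarith
      then show ?thesis by simp
    qed
  qed
  also have "\<dots> = e * (2 * pi) + integral\<^sup>L circ (\<lambda>x. (f x)\<^sup>2) / e"
    by (subst Bochner_Integration.integral_add[OF integrable_mult_right[OF integrable_circ_cos(1)] integrable_divide[OF f(2)]])
      (simp only: integral_mult_right_zero integral_divide_zero integral_circ_cos, simp)
  finally show ?thesis .
qed

text \<open>
  The two-sided coefficients of W. The value at 0 is set to 0 because the cosine series of W starts at 1,
  whatever a 0 may be.
\<close>

definition even_ext :: "(nat \<Rightarrow> real) \<Rightarrow> int \<Rightarrow> real" where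
  "even_ext a n = (if n = 0 then 0 else a (nat \<bar>n\<bar>))"

text \<open>
  The partial sums converge to W in the mean, and integrating against a bounded function is continuous for
  that convergence; the integrals of the partial sums are eventually constant by orthogonality.
\<close>

lemma potential_coefficients:
  assumes "cosine_potential W a"
  shows "integral\<^sup>L circ (\<lambda>x. W x * cos (of_int n * x)) = pi * even_ext a n"
    and "integral\<^sup>L circ (\<lambda>x. W x * sin (of_int n * x)) = 0"
proof -
  define S where "S N x = (\<Sum>l=1..N. a l * cos (real l * x))" for N x
  have W: "circle_L2 W" and lim: "(\<lambda>N. integral\<^sup>L circ (\<lambda>x. (W x - S N x)\<^sup>2)) \<longlonglongrightarrow> 0"
    using assms by (auto simp: cosine_potential_def circle_integral_circ S_def)
  note WF = circle_L2_facts[OF W]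
  have Sc: "continuous_on UNIV (S N)" for N unfolding S_def by (intro continuous_intros)
  have Sp: "circle_periodic (S N)" for N
    unfolding circle_periodic_def S_def using cos_sin_periodic(1)[of "int _"] by simp
  note SF = circle_L2_facts[OF continuous_circle_L2[OF Sc Sp]]
  have D2: "integrable circ (\<lambda>x. (W x - S N x)\<^sup>2)" for N
  proof -
    have "integrable circ (\<lambda>x. (W x)\<^sup>2 + (S N x)\<^sup>2 - 2 * (W x * S N x))"
      by (intro Bochner_Integration.integrable_add Bochner_Integration.integrable_diff integrable_mult_right
          WF SF integrable_circ_L2_mult)
    then show ?thesis by (simp add: power2_diff mult.assoc)
  qed
  have lim1: "(\<lambda>N. integral\<^sup>L circ (\<lambda>x. \<bar>W x - S N x\<bar>)) \<longlonglongrightarrow> 0"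
  proof (rule LIMSEQ_I)
    fix r :: real assume r: "0 < r"
    define e where "e = r / 16"
    have e: "0 < e" using r by (simp add: e_def)
    obtain N0 where N0: "\<And>N. N \<ge> N0 \<Longrightarrow> \<bar>integral\<^sup>L circ (\<lambda>x. (W x - S N x)\<^sup>2)\<bar> < e * e"
      using LIMSEQ_D[OF lim, of "e * e"] e by auto
    have "norm (integral\<^sup>L circ (\<lambda>x. \<bar>W x - S N x\<bar>) - 0) < r" if "N \<ge> N0" for N
    proof -
      have b: "(\<lambda>x. W x - S N x) \<in> borel_measurable borel" using WF(2) SF(2) by measurable
      have "integral\<^sup>L circ (\<lambda>x. \<bar>W x - S N x\<bar>) \<le> e * (2 * pi) + integral\<^sup>L circ (\<lambda>x. (W x - S N x)\<^sup>2) / e"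
        by (rule L1_le_L2[OF b D2 e])
      also have "integral\<^sup>L circ (\<lambda>x. (W x - S N x)\<^sup>2) / e \<le> (e * e) / e"
        using N0[OF that] e by (intro divide_right_mono) auto
      also have "e * (2 * pi) + (e * e) / e \<le> e * 8 + e"
        using pi_less_4 e by (intro add_mono mult_left_mono) auto
      also have "\<dots> < r" using r by (simp add: e_def)
      finally show ?thesis by simp
    qed
    then show "\<exists>N0. \<forall>N\<ge>N0. norm (integral\<^sup>L circ (\<lambda>x. \<bar>W x - S N x\<bar>) - 0) < r" by blast
  qed
  have conv: "(\<lambda>N. integral\<^sup>L circ (\<lambda>x. S N x * h x)) \<longlonglongrightarrow> integral\<^sup>L circ (\<lambda>x. W x * h x)"
    if h: "h \<in> borel_measurable borel" "\<And>x. \<bar>h x\<bar> \<le> 1" for h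
  proof -
    have i: "integrable circ (\<lambda>x. S N x * h x)" "integrable circ (\<lambda>x. W x * h x)" for N
      by (intro integrable_circ_mult[where B = 1] WF SF h)+
    have "(\<lambda>N. integral\<^sup>L circ (\<lambda>x. S N x * h x) - integral\<^sup>L circ (\<lambda>x. W x * h x)) \<longlonglongrightarrow> 0"
    proof (rule Lim_null_comparison[OF _ lim1], intro always_eventually allI)
      fix N
      have "integral\<^sup>L circ (\<lambda>x. S N x * h x) - integral\<^sup>L circ (\<lambda>x. W x * h x) = integral\<^sup>L circ (\<lambda>x. S N x * h x - W x * h x)"
        using i by simp
      also have "norm \<dots> \<le> integral\<^sup>L circ (\<lambda>x. norm (S N x * h x - W x * h x))" by (rule integral_norm_bound)
      also have "\<dots> \<le> integral\<^sup>L circ (\<lambda>x. \<bar>W x - S N x\<bar>)"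
      proof (rule integral_mono)
        show "integrable circ (\<lambda>x. norm (S N x * h x - W x * h x))"
          by (intro integrable_norm Bochner_Integration.integrable_diff i)
        show "integrable circ (\<lambda>x. \<bar>W x - S N x\<bar>)"
          by (intro integrable_abs Bochner_Integration.integrable_diff WF SF)
        show "norm (S N x * h x - W x * h x) \<le> \<bar>W x - S N x\<bar>" for x
          using mult_left_le[OF h(2)[of x] abs_ge_zero[of "W x - S N x"]]
          by (simp add: left_diff_distrib[symmetric] abs_mult abs_minus_commute)
      qed
      finally show "norm (integral\<^sup>L circ (\<lambda>x. S N x * h x) - integral\<^sup>L circ (\<lambda>x. W x * h x)) \<le> integral\<^sup>L circ (\<lambda>x. \<bar>W x - S N x\<bar>)" .
    qed
    then show ?thesis by (simp add: LIM_zero_iff)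
  qed
  have ccl: "integral\<^sup>L circ (\<lambda>x. cos (real l * x) * cos (of_int n * x)) = pi * of_bool (l = nat \<bar>n\<bar>)" if "l \<ge> 1" for l
    using integral_circ_cos_cos[of "int l" n] that by (auto simp: of_bool_def)
  have icc: "integrable circ (\<lambda>x. cos (real l * x) * cos (of_int n * x))" "integrable circ (\<lambda>x. cos (real l * x) * sin (of_int n * x))" for l
    by (intro integrable_circ_trig integrable_circ_cos)+
  have ev: "integral\<^sup>L circ (\<lambda>x. S N x * cos (of_int n * x)) = pi * even_ext a n" if N: "N \<ge> nat \<bar>n\<bar>" for N
  proof -
    have "integral\<^sup>L circ (\<lambda>x. S N x * cos (of_int n * x)) = (\<Sum>l=1..N. a l * integral\<^sup>L circ (\<lambda>x. cos (real l * x) * cos (of_int n * x)))"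
      unfolding S_def using icc(1) by (simp add: sum_distrib_right mult.assoc)
    also have "\<dots> = (\<Sum>l=1..N. if l = nat \<bar>n\<bar> then pi * a l else 0)"
      by (rule sum.cong) (auto simp: ccl)
    also have "\<dots> = pi * even_ext a n" using N by (auto simp: even_ext_def)
    finally show ?thesis .
  qed
  have "(\<lambda>N. integral\<^sup>L circ (\<lambda>x. S N x * cos (of_int n * x))) \<longlonglongrightarrow> pi * even_ext a n"
    by (rule tendsto_eventually) (use ev eventually_sequentially in blast)
  moreover have "(\<lambda>N. integral\<^sup>L circ (\<lambda>x. S N x * cos (of_int n * x))) \<longlonglongrightarrow> integral\<^sup>L circ (\<lambda>x. W x * cos (of_int n * x))"
    by (rule conv) simp_all
  ultimately show "integral\<^sup>L circ (\<lambda>x. W x * cos (of_int n * x)) = pi * even_ext a n"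
    using LIMSEQ_unique by blast
  have S0: "integral\<^sup>L circ (\<lambda>x. S N x * sin (of_int n * x)) = 0" for N
  proof -
    have "integral\<^sup>L circ (\<lambda>x. cos (real l * x) * sin (of_int n * x)) = 0" for l
      using integral_circ_sin_cos[of n "int l"] by (simp add: mult.commute)
    then show ?thesis unfolding S_def using icc(2) by (simp add: sum_distrib_right mult.assoc)
  qed
  have "(\<lambda>N. integral\<^sup>L circ (\<lambda>x. S N x * sin (of_int n * x))) \<longlonglongrightarrow> integral\<^sup>L circ (\<lambda>x. W x * sin (of_int n * x))"
    by (rule conv) simp_all
  then show "integral\<^sup>L circ (\<lambda>x. W x * sin (of_int n * x)) = 0"
    unfolding S0 by (simp add: LIMSEQ_const_iff)
qed

text \<open>
  Convolution multiplies Fourier coefficients. The factor 1/2 reflects that the two-sided series counts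
  each cosine twice, and the constant part of p is annihilated because W has mean zero.
\<close>

lemma circle_conv_csum:
  assumes W: "cosine_potential W a" and U: "l1 U" "U 0 = 0"
    and p: "p \<in> borel_measurable borel" "AE x in circ. p x = 1 + csum U x"
  shows "circle_conv W p \<theta> = 1/2 * csum (\<lambda>n. even_ext a n * U n) \<theta>"
proof -
  have WL: "circle_L2 W" using W by (simp add: cosine_potential_def)
  note WF = circle_L2_facts[OF WL]
  note refl = circ_reflect[OF WF(1,4)]
  define w where "w x = W (\<theta> - x)" for x
  have w: "integrable circ w" unfolding w_def by (rule refl)
  have wb: "w \<in> borel_measurable borel" unfolding w_def using WF(2) by measurable
  have wc: "integral\<^sup>L circ (\<lambda>x. w x * cos (of_int n * x)) = pi * even_ext a n * cos (of_int n * \<theta>)" for n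
  proof -
    define f where "f y = W y * cos (of_int n * (\<theta> - y))" for y
    have fe: "f y = cos (of_int n * \<theta>) * (W y * cos (of_int n * y)) + sin (of_int n * \<theta>) * (W y * sin (of_int n * y))" for y
      by (simp add: f_def right_diff_distrib cos_diff algebra_simps)
    have i: "integrable circ (\<lambda>y. W y * cos (of_int n * y))" "integrable circ (\<lambda>y. W y * sin (of_int n * y))"
      by (intro integrable_circ_trig WF)+
    have "circle_periodic (\<lambda>y. cos (of_int n * (\<theta> - y)))"
      unfolding circle_periodic_def
    proof
      fix y
      have "cos (of_int n * (\<theta> - (y + 2*pi))) = cos (of_int n * ((\<theta> - (y + 2*pi)) + 2*pi))"
        by (rule cos_sin_periodic(1)[symmetric])
      then show "cos (of_int n * (\<theta> - (y + 2*pi))) = cos (of_int n * (\<theta> - y))" by (simp add: algebra_simps)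
    qed
    then have fp: "circle_periodic f" unfolding f_def by (rule circle_periodic_mult[OF WF(1)])
    have fi: "integrable circ f" unfolding fe[abs_def]
      by (intro Bochner_Integration.integrable_add integrable_mult_right i)
    have "integral\<^sup>L circ (\<lambda>x. w x * cos (of_int n * x)) = integral\<^sup>L circ (\<lambda>x. f (\<theta> - x))"
      by (simp add: w_def f_def)
    also have "\<dots> = integral\<^sup>L circ f" by (rule circ_reflect(2)[OF fp fi])
    also have "\<dots> = pi * even_ext a n * cos (of_int n * \<theta>)"
      unfolding fe[abs_def] using i potential_coefficients[OF W]
      by (subst Bochner_Integration.integral_add) simp_all
    finally show ?thesis .
  qed
  have "integral\<^sup>L circ (\<lambda>x. w x * p x) = integral\<^sup>L circ (\<lambda>x. w x * cos (of_int 0 * x) + w x * csum U x)"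
  proof (rule integral_cong_AE)
    show "(\<lambda>x. w x * p x) \<in> borel_measurable circ" by (intro borel_circ borel_measurable_times wb p(1))
    show "(\<lambda>x. w x * cos (of_int 0 * x) + w x * csum U x) \<in> borel_measurable circ"
      by (intro borel_circ borel_measurable_add borel_measurable_times wb tsum_borel[OF cos_bd U(1)]) simp
    show "AE x in circ. w x * p x = w x * cos (of_int 0 * x) + w x * csum U x"
      using p(2) by eventually_elim (simp add: distrib_left)
  qed
  also have "\<dots> = integral\<^sup>L circ (\<lambda>x. w x * cos (of_int 0 * x)) + integral\<^sup>L circ (\<lambda>x. w x * csum U x)"
    by (intro Bochner_Integration.integral_add integrable_circ_trig w
        integrable_circ_mult[OF w tsum_borel[OF cos_bd U(1)] tsum_bound[OF cos_bd U(1)]])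
  also have "integral\<^sup>L circ (\<lambda>x. w x * cos (of_int 0 * x)) = 0"
    unfolding wc by (simp add: even_ext_def)
  also have "integral\<^sup>L circ (\<lambda>x. w x * csum U x) = pi * csum (\<lambda>n. even_ext a n * U n) \<theta>"
  proof -
    have "integral\<^sup>L circ (\<lambda>x. w x * csum U x) = (\<Sum>\<^sub>\<infinity>n. U n * (pi * even_ext a n * cos (of_int n * \<theta>)))"
      using infsumI[OF tsum_integral[OF cos_bd w U(1)]] unfolding wc by simp
    also have "\<dots> = (\<Sum>\<^sub>\<infinity>n. pi * (even_ext a n * U n * cos (of_int n * \<theta>)))" by (simp add: mult_ac)
    finally show ?thesis by (simp add: infsum_cmult_right' tsum_def)
  qed
  finally show ?thesis by (simp add: circle_conv_def circle_integral_circ w_def)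
qed

section \<open>Stationary solutions and their Fourier coefficients\<close>

lemma tsum_cmult: "tsum h (\<lambda>n. c * x n) \<theta> = c * tsum h x \<theta>"
  unfolding tsum_def by (simp add: mult.assoc infsum_cmult_right')

lemma tsum_add:
  assumes h: "continuous_on UNIV h" "\<And>y. \<bar>h y\<bar> \<le> 1" and "l1 x" "l1 y"
  shows "tsum h (\<lambda>n. x n + y n) \<theta> = tsum h x \<theta> + tsum h y \<theta>"
proof -
  have "((\<lambda>n. x n * h (of_int n * \<theta>) + y n * h (of_int n * \<theta>)) has_sum (tsum h x \<theta> + tsum h y \<theta>)) UNIV"
    by (intro has_sum_add tsum_has_sum assms)
  then show ?thesis unfolding tsum_def[of h "\<lambda>n. x n + y n"] by (intro infsumI) (simp add: distrib_right)
qed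

lemma tsum_diff:
  assumes h: "continuous_on UNIV h" "\<And>y. \<bar>h y\<bar> \<le> 1" and "l1 x" "l1 y"
  shows "tsum h (\<lambda>n. x n - y n) \<theta> = tsum h x \<theta> - tsum h y \<theta>"
proof -
  have "l1 (\<lambda>n. (- 1) * y n)" by (rule l1_cmult_le(1)[OF assms(4), of _ 1]) simp
  from tsum_add[OF h assms(3) this, of \<theta>] show ?thesis unfolding tsum_cmult by simp
qed

text \<open>
  The Fourier coefficients of the stationary equation p'' = \<kappa> (p (W * p)')' for p = 1 + csum U.
\<close>

definition full_balance :: "(nat \<Rightarrow> real) \<Rightarrow> real \<Rightarrow> (int \<Rightarrow> real) \<Rightarrow> bool" where
  "full_balance a \<kappa> U \<longleftrightarrow> (\<forall>n. of_int n * (2 - \<kappa> * even_ext a n) * U n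
     = \<kappa> * qconv (\<lambda>_ k. of_int k * even_ext a k) U U n)"

lemma even_ext_bounds:
  assumes "\<And>l. l \<ge> 1 \<Longrightarrow> real l * \<bar>a l\<bar> \<le> A"
  shows "\<bar>of_int n * even_ext a n\<bar> \<le> A" "\<bar>even_ext a n\<bar> \<le> A"
proof -
  have A: "0 \<le> A" using order_trans[OF abs_ge_zero assms[of 1, simplified]] .
  have "\<bar>of_int n * even_ext a n\<bar> \<le> A \<and> \<bar>even_ext a n\<bar> \<le> A"
  proof (cases "n = 0")
    case False
    define l where "l = nat \<bar>n\<bar>"
    have l: "l \<ge> 1" "real l = \<bar>of_int n\<bar>" using False by (auto simp: l_def)
    have "1 * \<bar>a l\<bar> \<le> real l * \<bar>a l\<bar>" using l(1) by (intro mult_right_mono) auto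
    then show ?thesis using assms[OF l(1)] False l(2) by (simp add: even_ext_def abs_mult l_def[symmetric])
  qed (use A in \<open>simp add: even_ext_def\<close>)
  then show "\<bar>of_int n * even_ext a n\<bar> \<le> A" "\<bar>even_ext a n\<bar> \<le> A" by auto
qed

lemma even_ext_minus: "even_ext a (- n) = even_ext a n" by (simp add: even_ext_def)

text \<open>
  A density p with summable even coefficients U. The series csum X is W * p, and (D + Q)/2 are the
  coefficients of the drift flux: D comes from the constant part of p and Q from the rest.
\<close>

locale trig_density =
  fixes W :: "real \<Rightarrow> real" and a :: "nat \<Rightarrow> real" and A :: real and U :: "int \<Rightarrow> real"
  assumes W: "cosine_potential W a" and aA: "\<And>l. l \<ge> 1 \<Longrightarrow> real l * \<bar>a l\<bar> \<le> A"
    and U: "l1 U" "\<And>n. U (- n) = U n" "U 0 = 0"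
begin

definition "D n = of_int n * even_ext a n * U n"
definition "Q = qconv (\<lambda>_ k. of_int k * even_ext a k) U U"
definition "X n = even_ext a n * U n / 2"
definition "p \<theta> = 1 + csum U \<theta>"

lemma D_l1: "l1 D"
  using l1_mult_bounded(1)[where c = "\<lambda>n. of_int n * even_ext a n" and C = A,
      OF U(1) even_ext_bounds(1)[where a = a and A = A, OF aA]]
  by (simp add: D_def[abs_def] mult_ac)

lemma X_l1: "l1 X" and nX_l1: "l1 (\<lambda>n. of_int n * X n)"
proof -
  have "\<bar>X n\<bar> \<le> A * \<bar>U n\<bar>" for n
    using even_ext_bounds(2)[where a = a and A = A, OF aA, of n] mult_right_mono[of "\<bar>even_ext a n\<bar>" A "\<bar>U n\<bar>"]
    by (simp add: X_def abs_mult) (use mult_nonneg_nonneg[of "\<bar>even_ext a n\<bar>" "\<bar>U n\<bar>"] in linarith)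
  then show "l1 X" by (rule l1_cmult_le(1)[OF U(1)])
  show "l1 (\<lambda>n. of_int n * X n)"
    by (rule l1_cmult_le(1)[OF D_l1, of _ "1/2"]) (simp add: X_def D_def abs_mult)
qed

lemma Q_alt: "Q = qconv (\<lambda>_ _. 1) D U"
  unfolding Q_def qconv_def D_def by simp

lemma Q_l1: "l1 Q"
  unfolding Q_alt by (rule young_l1(1)[where K = "\<lambda>_ _. 1" and A = 1, OF D_l1 U(1)]) simp

lemma nX_eq: "(\<lambda>n. of_int n * X n) = (\<lambda>n. 1/2 * D n)"
  by (auto simp: X_def D_def)

text \<open>
  Since -(W * p)' is the sine series of n X_n, this is the Fourier series of -p (W * p)'.
\<close>

lemma flux_eq: "ssum (\<lambda>n. of_int n * X n) \<theta> * p \<theta> = ssum (\<lambda>n. 1/2 * (D n + Q n)) \<theta>"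
proof -
  have "ssum (\<lambda>n. of_int n * X n) \<theta> * p \<theta> = 1/2 * (ssum D \<theta> + ssum D \<theta> * csum U \<theta>)"
    unfolding nX_eq tsum_cmult p_def by (simp add: distrib_left)
  also have "\<dots> = 1/2 * ssum (\<lambda>n. D n + Q n) \<theta>"
    unfolding ssum_csum_product[OF D_l1 U(1,2)] Q_alt[symmetric] tsum_add[OF sin_bd D_l1 Q_l1] ..
  finally show ?thesis by (simp only: tsum_cmult)
qed

lemma p_continuous: "continuous_on UNIV p" and p_periodic: "circle_periodic p"
  unfolding p_def[abs_def] using tsum_periodic(1)[of U]
  by (auto intro!: continuous_intros tsum_continuous[OF cos_bd U(1)] simp: circle_periodic_def)

lemma p_even: "p (- \<theta>) = p \<theta>" by (simp add: p_def tsum_def)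

lemma p_L2: "circle_L2 p" by (rule continuous_circle_L2[OF p_continuous p_periodic])

lemma p_integral: "integral\<^sup>L circ p = 2 * pi"
proof -
  have "integral\<^sup>L circ p = integral\<^sup>L circ (\<lambda>\<theta>. cos (of_int 0 * \<theta>) + cos (of_int 0 * \<theta>) * csum U \<theta>)"
    by (simp add: p_def[abs_def])
  also have "\<dots> = 2 * pi + pi * (U 0 + U (- 0))"
    unfolding integral_cos_csum[OF U(1), symmetric]
    by (subst Bochner_Integration.integral_add[OF integrable_circ_cos(1)
          integrable_circ_mult[OF integrable_circ_cos(1) tsum_borel[OF cos_bd U(1)] tsum_bound[OF cos_bd U(1)]]])
      (simp only: integral_circ_cos, simp)
  finally show ?thesis by (simp add: U(3))
qed

lemma p_cos: "integral\<^sup>L circ (\<lambda>\<theta>. p \<theta> * cos (of_int n * \<theta>)) = 2 * pi * (of_bool (n = 0) + U n)"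
proof -
  have "integral\<^sup>L circ (\<lambda>\<theta>. p \<theta> * cos (of_int n * \<theta>)) = integral\<^sup>L circ (\<lambda>\<theta>. cos (of_int n * \<theta>) + cos (of_int n * \<theta>) * csum U \<theta>)"
    by (intro Bochner_Integration.integral_cong refl) (simp add: p_def algebra_simps)
  also have "\<dots> = integral\<^sup>L circ (\<lambda>\<theta>. cos (of_int n * \<theta>)) + pi * (U n + U (- n))"
    unfolding integral_cos_csum[OF U(1), symmetric]
    by (rule Bochner_Integration.integral_add[OF integrable_circ_cos(1)
          integrable_circ_mult[OF integrable_circ_cos(1) tsum_borel[OF cos_bd U(1)] tsum_bound[OF cos_bd U(1)]]])
  finally show ?thesis by (simp add: U(2) integral_circ_cos distrib_left)
qed

lemma p_sin: "integral\<^sup>L circ (\<lambda>\<theta>. p \<theta> * sin (of_int n * \<theta>)) = 0"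
proof -
  have "integral\<^sup>L circ (\<lambda>\<theta>. p \<theta> * sin (of_int n * \<theta>)) = integral\<^sup>L circ (\<lambda>\<theta>. sin (of_int n * \<theta>) + sin (of_int n * \<theta>) * csum U \<theta>)"
    by (intro Bochner_Integration.integral_cong refl) (simp add: p_def algebra_simps)
  also have "\<dots> = integral\<^sup>L circ (\<lambda>\<theta>. sin (of_int n * \<theta>)) + 0"
    unfolding integral_sin_csum[OF U(1), symmetric, of n]
    by (rule Bochner_Integration.integral_add[OF integrable_circ_cos(2)
          integrable_circ_mult[OF integrable_circ_cos(2) tsum_borel[OF cos_bd U(1)] tsum_bound[OF cos_bd U(1)]]])
  finally show ?thesis by (simp add: integral_circ_sin)
qed

lemma conv_eq:
  assumes "q \<in> borel_measurable borel" "AE x in circ. q x = p x"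
  shows "circle_conv W q = csum X"
proof
  fix \<theta>
  have "circle_conv W q \<theta> = 1/2 * csum (\<lambda>n. even_ext a n * U n) \<theta>"
    using circle_conv_csum[OF W U(1,3) assms[unfolded p_def]] .
  then show "circle_conv W q \<theta> = csum X \<theta>"
    using tsum_cmult[of cos "1/2" "\<lambda>n. even_ext a n * U n" \<theta>] by (simp add: X_def[abs_def])
qed

lemma conv_weak_deriv:
  assumes "q \<in> borel_measurable borel" "AE x in circ. q x = p x"
  shows "circle_H1 (circle_conv W q)"
    and "AE x in circ. weak_deriv (circle_conv W q) x = - ssum (\<lambda>n. of_int n * X n) x"
    and "weak_deriv (circle_conv W q) \<in> borel_measurable borel"
proof -
  note w = csum_weak_deriv[OF X_l1 nX_l1]
  note w' = has_weak_deriv_weak_deriv[OF w]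
  show "circle_H1 (circle_conv W q)" unfolding conv_eq[OF assms] circle_H1_def using w by blast
  show "AE x in circ. weak_deriv (circle_conv W q) x = - ssum (\<lambda>n. of_int n * X n) x"
    unfolding conv_eq[OF assms] by (rule w')
  show "weak_deriv (circle_conv W q) \<in> borel_measurable borel"
    unfolding conv_eq[OF assms] using w'(1) circle_L2_facts(2) unfolding has_weak_deriv_def by blast
qed

text \<open>
  The balance equations say that p' = V' p with V = \<kappa> (W * p). Then p exp(-V) has derivative zero,
  so p is a multiple of exp V. The integral of p is 2\<pi>, hence the multiple is positive and equal to the
  normalising constant; positivity of p follows without any smallness of U. The weak equation then
  results from p' = V' p by one integration by parts.
\<close>

lemma solution_from_coefficients:
  assumes bal: "full_balance a \<kappa> U" and nU: "l1 (\<lambda>n. of_int n * U n)"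
  shows "stationary_solution W \<kappa> p" "p \<in> H1s"
    and "p \<theta> = 1 / (1 / (2*pi) * circle_integral (\<lambda>\<theta>. exp (\<kappa> * csum X \<theta>))) * exp (\<kappa> * csum X \<theta>)"
proof -
  define V where "V \<theta> = \<kappa> * csum X \<theta>" for \<theta>
  define p' where "p' \<theta> = - ssum (\<lambda>n. of_int n * U n) \<theta>" for \<theta>
  define V' where "V' \<theta> = \<kappa> * (- ssum (\<lambda>n. of_int n * X n) \<theta>)" for \<theta>
  have dp: "(p has_real_derivative p' \<theta>) (at \<theta>)" for \<theta>
    unfolding p_def[abs_def] p'_def using csum_deriv[OF U(1) nU, of \<theta>] by (auto intro!: derivative_eq_intros)
  have dV: "(V has_real_derivative V' \<theta>) (at \<theta>)" for \<theta>
    unfolding V_def[abs_def] V'_def by (rule DERIV_cmult[OF csum_deriv[OF X_l1 nX_l1]])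
  have pc': "continuous_on UNIV p'"
    unfolding p'_def by (intro continuous_intros tsum_continuous[OF sin_bd nU])
  have ode: "p' \<theta> = V' \<theta> * p \<theta>" for \<theta>
  proof -
    have "of_int n * U n = \<kappa> * (1/2 * (D n + Q n))" for n
      using bal[unfolded full_balance_def, rule_format, of n] by (simp add: D_def Q_def algebra_simps)
    then have "(\<lambda>n. of_int n * U n) = (\<lambda>n. \<kappa> * (1/2 * (D n + Q n)))" by auto
    then have "p' \<theta> = - (\<kappa> * ssum (\<lambda>n. 1/2 * (D n + Q n)) \<theta>)" unfolding p'_def by (simp only: tsum_cmult)
    also have "\<dots> = - (\<kappa> * (ssum (\<lambda>n. of_int n * X n) \<theta> * p \<theta>))" by (simp only: flux_eq)
    finally show ?thesis by (simp add: V'_def)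
  qed
  have "((\<lambda>\<theta>. p \<theta> * exp (- V \<theta>)) has_real_derivative 0) (at \<theta>)" for \<theta>
  proof -
    have "((\<lambda>\<theta>. p \<theta> * exp (- V \<theta>)) has_real_derivative (p' \<theta> * exp (- V \<theta>) + exp (- V \<theta>) * (- V' \<theta>) * p \<theta>)) (at \<theta>)"
      by (auto intro!: derivative_eq_intros dp dV)
    then show ?thesis by (simp add: ode)
  qed
  then have const: "p \<theta> * exp (- V \<theta>) = p 0 * exp (- V 0)" for \<theta>
    using DERIV_isconst_all[of "\<lambda>\<theta>. p \<theta> * exp (- V \<theta>)" \<theta> 0] by blast
  define c where "c = p 0 * exp (- V 0)"
  have pE: "p \<theta> = c * exp (V \<theta>)" for \<theta>
    using const[of \<theta>] by (simp add: c_def exp_minus field_simps)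
  define I where "I = integral\<^sup>L circ (\<lambda>\<theta>. exp (V \<theta>))"
  have cI: "c * I = 2 * pi"
    using p_integral unfolding I_def pE[abs_def] by simp
  have I: "0 \<le> I" unfolding I_def by simp
  have "c * I > 0" using cI by simp
  then have c: "0 < c" and I0: "0 < I" using I by (auto simp: zero_less_mult_iff)
  have "c = 1 / (1 / (2*pi) * I)" using cI I0 by (simp add: field_simps)
  then show "p \<theta> = 1 / (1 / (2*pi) * circle_integral (\<lambda>\<theta>. exp (\<kappa> * csum X \<theta>))) * exp (\<kappa> * csum X \<theta>)"
    using pE[of \<theta>] unfolding circle_integral_circ I_def V_def by simp
  have ppos: "0 \<le> p \<theta>" for \<theta> using c pE[of \<theta>] by simp
  have wd: "has_weak_deriv p p'" by (rule C1_has_weak_deriv[OF dp pc' p_periodic])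
  then show "p \<in> H1s" unfolding H1s_def circle_H1_def circle_even_def using p_even by auto
  have pb: "p \<in> borel_measurable borel" by (rule borel_measurable_continuous_onI[OF p_continuous])
  have pp: "AE x in circ. p x = p x" by simp
  note cw = conv_weak_deriv[OF pb pp]
  show "stationary_solution W \<kappa> p"
    unfolding stationary_solution_def circle_integral_circ
  proof (intro conjI allI impI)
    show "circle_L2 p" by (rule p_L2)
    show "circle_density p" unfolding circle_density_def circle_integral_circ using ppos p_integral by simp
    show "circle_H1 (circle_conv W p)" by (rule cw)
    fix \<phi> assume t: "circle_test \<phi>"
    note T = circle_test_facts[OF t]
    have "integral\<^sup>L circ (\<lambda>\<theta>. p \<theta> * deriv (deriv \<phi>) \<theta>) = - integral\<^sup>L circ (\<lambda>\<theta>. p' \<theta> * deriv \<phi> \<theta>)"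
      by (rule integral_circ_by_parts[OF dp pc' p_periodic T(2,7,4)])
    also have "integral\<^sup>L circ (\<lambda>\<theta>. p' \<theta> * deriv \<phi> \<theta>) = integral\<^sup>L circ (\<lambda>\<theta>. \<kappa> * (p \<theta> * weak_deriv (circle_conv W p) \<theta> * deriv \<phi> \<theta>))"
    proof (rule integral_cong_AE)
      show "(\<lambda>\<theta>. p' \<theta> * deriv \<phi> \<theta>) \<in> borel_measurable circ"
        by (intro borel_circ borel_measurable_times borel_measurable_continuous_onI pc' T)
      show "(\<lambda>\<theta>. \<kappa> * (p \<theta> * weak_deriv (circle_conv W p) \<theta> * deriv \<phi> \<theta>)) \<in> borel_measurable circ"
        by (intro borel_circ borel_measurable_times borel_measurable_const borel_measurable_continuous_onI[OF T(6)] cw pb)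
      show "AE \<theta> in circ. p' \<theta> * deriv \<phi> \<theta> = \<kappa> * (p \<theta> * weak_deriv (circle_conv W p) \<theta> * deriv \<phi> \<theta>)"
        using cw(2) by eventually_elim (simp add: ode V'_def)
    qed
    finally show "integral\<^sup>L circ (\<lambda>\<theta>. p \<theta> * deriv (deriv \<phi>) \<theta>)
        = - \<kappa> * integral\<^sup>L circ (\<lambda>\<theta>. p \<theta> * weak_deriv (circle_conv W p) \<theta> * deriv \<phi> \<theta>)" by simp
  qed
qed

text \<open>
  Testing the weak equation with cos n\<theta> extracts the balance equation of mode n.
\<close>

lemma balance_from_solution:
  assumes sol: "stationary_solution W \<kappa> q" and q: "AE x in circ. q x = p x"
  shows "full_balance a \<kappa> U"
  unfolding full_balance_def
proof
  fix n :: int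
  have qL: "circle_L2 q" using sol by (simp add: stationary_solution_def)
  note qF = circle_L2_facts[OF qL]
  note cw = conv_weak_deriv[OF qF(2) q]
  have pb: "p \<in> borel_measurable borel" by (rule borel_measurable_continuous_onI[OF p_continuous])
  define \<phi> where "\<phi> x = cos (of_int n * x)" for x :: real
  have t: "circle_test \<phi>" unfolding \<phi>_def by (rule trig_test)
  have d1: "deriv \<phi> = (\<lambda>x. - of_int n * sin (of_int n * x))" unfolding \<phi>_def by (rule deriv_trig)
  have d2: "deriv (deriv \<phi>) = (\<lambda>x. - (of_int n)\<^sup>2 * cos (of_int n * x))" unfolding \<phi>_def by (rule deriv_deriv_cos)
  have eq: "integral\<^sup>L circ (\<lambda>\<theta>. q \<theta> * deriv (deriv \<phi>) \<theta>)
      = - \<kappa> * integral\<^sup>L circ (\<lambda>\<theta>. q \<theta> * weak_deriv (circle_conv W q) \<theta> * deriv \<phi> \<theta>)"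
    using sol t unfolding stationary_solution_def circle_integral_circ by blast
  have "integral\<^sup>L circ (\<lambda>\<theta>. q \<theta> * deriv (deriv \<phi>) \<theta>) = integral\<^sup>L circ (\<lambda>\<theta>. - (of_int n)\<^sup>2 * (p \<theta> * cos (of_int n * \<theta>)))"
  proof (rule integral_cong_AE)
    show "(\<lambda>\<theta>. q \<theta> * deriv (deriv \<phi>) \<theta>) \<in> borel_measurable circ"
      unfolding d2 by (intro borel_circ borel_measurable_times qF) simp_all
    show "(\<lambda>\<theta>. - (of_int n)\<^sup>2 * (p \<theta> * cos (of_int n * \<theta>))) \<in> borel_measurable circ"
      by (intro borel_circ borel_measurable_times pb) simp_all
    show "AE \<theta> in circ. q \<theta> * deriv (deriv \<phi>) \<theta> = - (of_int n)\<^sup>2 * (p \<theta> * cos (of_int n * \<theta>))"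
      using q by eventually_elim (simp add: d2)
  qed
  also have "\<dots> = - (of_int n)\<^sup>2 * (2 * pi * (of_bool (n = 0) + U n))"
    by (simp only: integral_mult_right_zero p_cos)
  also have "\<dots> = - (of_int n)\<^sup>2 * (2 * pi * U n)" by (cases "n = 0") auto
  finally have lhs: "integral\<^sup>L circ (\<lambda>\<theta>. q \<theta> * deriv (deriv \<phi>) \<theta>) = - (of_int n)\<^sup>2 * (2 * pi * U n)" .
  have "\<bar>1/2 * (D n + Q n)\<bar> \<le> 1/2 * \<bar>D n\<bar> + 1/2 * \<bar>Q n\<bar>" for n
    using abs_triangle_ineq[of "D n" "Q n"] unfolding abs_mult by simp
  then have S: "l1 (\<lambda>n. 1/2 * (D n + Q n))" by (rule l1_add_le(1)[OF D_l1 Q_l1])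
  have "integral\<^sup>L circ (\<lambda>\<theta>. q \<theta> * weak_deriv (circle_conv W q) \<theta> * deriv \<phi> \<theta>)
      = integral\<^sup>L circ (\<lambda>\<theta>. of_int n * (sin (of_int n * \<theta>) * ssum (\<lambda>n. 1/2 * (D n + Q n)) \<theta>))"
  proof (rule integral_cong_AE)
    show "(\<lambda>\<theta>. q \<theta> * weak_deriv (circle_conv W q) \<theta> * deriv \<phi> \<theta>) \<in> borel_measurable circ"
      unfolding d1 by (intro borel_circ borel_measurable_times qF cw) simp_all
    show "(\<lambda>\<theta>. of_int n * (sin (of_int n * \<theta>) * ssum (\<lambda>n. 1/2 * (D n + Q n)) \<theta>)) \<in> borel_measurable circ"
      by (intro borel_circ borel_measurable_times tsum_borel[OF sin_bd S]) simp_all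
    show "AE \<theta> in circ. q \<theta> * weak_deriv (circle_conv W q) \<theta> * deriv \<phi> \<theta>
        = of_int n * (sin (of_int n * \<theta>) * ssum (\<lambda>n. 1/2 * (D n + Q n)) \<theta>)"
      using q cw(2) by eventually_elim (simp only: d1 flux_eq[symmetric], simp)
  qed
  also have "\<dots> = of_int n * (pi * (1/2 * (D n + Q n) - 1/2 * (D (- n) + Q (- n))))"
    by (simp only: integral_mult_right_zero integral_sin_ssum[OF S])
  also have "\<dots> = of_int n * (pi * (D n + Q n))"
  proof -
    have "Q (- n) = - Q n" unfolding Q_def
      by (rule qconv_even_odd[where x = U and y = U, OF U(2) U(2)]) (simp add: even_ext_minus)
    moreover have "D (- n) = - D n" by (simp add: D_def U(2) even_ext_minus)
    ultimately have "1/2 * (D n + Q n) - 1/2 * (D (- n) + Q (- n)) = D n + Q n" by (simp add: field_simps)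
    then show ?thesis by (simp only:)
  qed
  finally have rhs: "integral\<^sup>L circ (\<lambda>\<theta>. q \<theta> * weak_deriv (circle_conv W q) \<theta> * deriv \<phi> \<theta>) = of_int n * (pi * (D n + Q n))" .
  have main: "(of_int n)\<^sup>2 * (2 * pi * U n) = \<kappa> * (of_int n * (pi * (D n + Q n)))"
    using eq unfolding lhs rhs by simp
  show "of_int n * (2 - \<kappa> * even_ext a n) * U n = \<kappa> * qconv (\<lambda>_ k. of_int k * even_ext a k) U U n"
  proof (cases "n = 0")
    case True
    have "Q (- 0) = - Q 0" unfolding Q_def
      by (rule qconv_even_odd[where x = U and y = U, OF U(2) U(2)]) (simp add: even_ext_minus)
    then show ?thesis using True by (simp add: Q_def)
  next
    case False
    have "pi * of_int n * (of_int n * (2 * U n)) = pi * of_int n * (\<kappa> * (D n + Q n))"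
      using main by (simp add: power2_eq_square mult_ac)
    then have "of_int n * (2 * U n) = \<kappa> * (D n + Q n)" using False by simp
    then show ?thesis by (simp add: D_def Q_def algebra_simps)
  qed
qed

end

text \<open>
  The square of the distance of g to its projection on the span of sin x, ..., sin N x is nonnegative.
\<close>

lemma bessel_sin:
  assumes g: "circle_L2 g"
  shows "(\<Sum>l=1..N. (integral\<^sup>L circ (\<lambda>x. g x * sin (real l * x)))\<^sup>2) \<le> pi * integral\<^sup>L circ (\<lambda>x. (g x)\<^sup>2)"
proof -
  note gF = circle_L2_facts[OF g]
  define s where "s l = integral\<^sup>L circ (\<lambda>x. g x * sin (real l * x)) / pi" for l :: nat
  define T where "T x = (\<Sum>l=1..N. s l * sin (real l * x))" for x
  have gs: "integral\<^sup>L circ (\<lambda>x. g x * sin (real l * x)) = pi * s l" for l by (simp add: s_def)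
  have ss: "integral\<^sup>L circ (\<lambda>x. sin (real l * x) * sin (real k * x)) = pi * of_bool (l = k)" if "l \<ge> 1" for l k
    using integral_circ_sin_sin[of "int l" "int k"] that by (auto simp: of_bool_def)
  have i1: "integrable circ (\<lambda>x. g x * sin (real l * x))" "integrable circ (\<lambda>x. sin (real l * x) * sin (real k * x))" for l k
    by (intro integrable_circ_trig gF integrable_circ_cos)+
  have gT: "(\<lambda>x. g x * T x) = (\<lambda>x. \<Sum>l=1..N. s l * (g x * sin (real l * x)))"
    by (simp add: T_def sum_distrib_left mult_ac)
  have TT: "(\<lambda>x. T x * T x) = (\<lambda>x. \<Sum>l=1..N. \<Sum>k=1..N. s l * s k * (sin (real l * x) * sin (real k * x)))"
    by (simp add: T_def sum_product mult_ac)
  have igT: "integrable circ (\<lambda>x. g x * T x)" unfolding gT using i1 by simp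
  have iTT: "integrable circ (\<lambda>x. T x * T x)" unfolding TT using i1 by simp
  have IgT: "integral\<^sup>L circ (\<lambda>x. g x * T x) = pi * (\<Sum>l=1..N. (s l)\<^sup>2)"
  proof -
    have "integral\<^sup>L circ (\<lambda>x. g x * T x) = (\<Sum>l=1..N. s l * (pi * s l))"
      unfolding gT using i1 by (simp add: gs)
    then show ?thesis by (simp add: sum_distrib_left power2_eq_square mult_ac)
  qed
  have "integral\<^sup>L circ (\<lambda>x. T x * T x) = (\<Sum>l=1..N. \<Sum>k=1..N. s l * s k * (pi * of_bool (l = k)))"
    unfolding TT using i1 by (simp add: ss)
  also have "\<dots> = (\<Sum>l=1..N. pi * (s l)\<^sup>2)"
    by (rule sum.cong) (auto simp: power2_eq_square mult_ac of_bool_def if_distrib[of "\<lambda>y. _ * y"] cong: if_cong)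
  finally have ITT: "integral\<^sup>L circ (\<lambda>x. T x * T x) = pi * (\<Sum>l=1..N. (s l)\<^sup>2)" by (simp add: sum_distrib_left)
  have "0 \<le> integral\<^sup>L circ (\<lambda>x. (g x - T x)\<^sup>2)" by simp
  also have "(\<lambda>x. (g x - T x)\<^sup>2) = (\<lambda>x. (g x)\<^sup>2 - 2 * (g x * T x) + T x * T x)"
    by (rule ext) (simp add: power2_eq_square algebra_simps)
  also have "integral\<^sup>L circ \<dots> = integral\<^sup>L circ (\<lambda>x. (g x)\<^sup>2) - 2 * (pi * (\<Sum>l=1..N. (s l)\<^sup>2)) + pi * (\<Sum>l=1..N. (s l)\<^sup>2)"
    using gF(3) igT iTT by (simp add: IgT ITT)
  finally have "pi * (\<Sum>l=1..N. (s l)\<^sup>2) \<le> integral\<^sup>L circ (\<lambda>x. (g x)\<^sup>2)" by simp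
  then have "pi * (pi * (\<Sum>l=1..N. (s l)\<^sup>2)) \<le> pi * integral\<^sup>L circ (\<lambda>x. (g x)\<^sup>2)" by (intro mult_left_mono) auto
  moreover have "(\<Sum>l=1..N. (integral\<^sup>L circ (\<lambda>x. g x * sin (real l * x)))\<^sup>2) = pi * (pi * (\<Sum>l=1..N. (s l)\<^sup>2))"
    unfolding gs by (simp add: sum_distrib_left power2_eq_square mult_ac)
  ultimately show ?thesis by (simp only:)
qed

lemma sum_inverse_squares_le: "(\<Sum>l=1..N. (1 / real l)\<^sup>2) \<le> 2"
proof -
  have "(\<Sum>l=1..Suc n. (1 / real l)\<^sup>2) \<le> 2 - 1 / real (Suc n)" for n
  proof (induction n)
    case (Suc n)
    have "(1 / real (Suc (Suc n)))\<^sup>2 = 1 / (real (Suc (Suc n)) * real (Suc (Suc n)))"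
      by (simp add: power2_eq_square)
    also have "\<dots> \<le> 1 / (real (Suc n) * real (Suc (Suc n)))"
      by (intro divide_left_mono mult_right_mono mult_pos_pos) auto
    also have "\<dots> = 1 / real (Suc n) - 1 / real (Suc (Suc n))" by (simp add: field_simps)
    finally have "(1 / real (Suc (Suc n)))\<^sup>2 \<le> 1 / real (Suc n) - 1 / real (Suc (Suc n))" .
    then show ?case using Suc by simp
  qed simp
  then show ?thesis
  proof (cases N)
    case (Suc n)
    then show ?thesis using \<open>\<And>n. (\<Sum>l=1..Suc n. (1 / real l)\<^sup>2) \<le> 2 - 1 / real (Suc n)\<close>[of n]
      by (auto intro: order_trans)
  qed simp
qed

lemma l1_even_bound:
  assumes ev: "\<And>n. U (- n) = U n" "U 0 = 0" and b: "\<And>N. (\<Sum>l=1..N. \<bar>U (int l)\<bar>) \<le> M"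
  shows "l1 U" "l1norm U \<le> 2 * M"
proof -
  have "(\<Sum>n\<in>F. \<bar>U n\<bar>) \<le> 2 * M" if F: "finite F" for F
  proof -
    obtain N :: nat where N: "\<And>n. n \<in> F \<Longrightarrow> nat \<bar>n\<bar> \<le> N"
      using finite_nat_set_iff_bounded_le[of "(\<lambda>n. nat \<bar>n\<bar>) ` F"] F by auto
    define P where "P = int ` {1..N}"
    define Q where "Q = (\<lambda>l. - int l) ` {1..N}"
    have sub: "F \<subseteq> {0} \<union> (P \<union> Q)"
    proof
      fix n assume n: "n \<in> F"
      consider "n = 0" | "n > 0" | "n < 0" by linarith
      then show "n \<in> {0} \<union> (P \<union> Q)"
      proof cases
        case 2
        then have "n = int (nat \<bar>n\<bar>)" "nat \<bar>n\<bar> \<in> {1..N}" using N[OF n] by auto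
        then show ?thesis unfolding P_def by blast
      next
        case 3
        then have "n = - int (nat \<bar>n\<bar>)" "nat \<bar>n\<bar> \<in> {1..N}" using N[OF n] by auto
        then show ?thesis unfolding Q_def by blast
      qed simp
    qed
    have "(\<Sum>n\<in>F. \<bar>U n\<bar>) \<le> (\<Sum>n\<in>{0} \<union> (P \<union> Q). \<bar>U n\<bar>)"
      by (rule sum_mono2[OF _ sub]) (auto simp: P_def Q_def)
    also have "\<dots> \<le> (\<Sum>n\<in>{0}. \<bar>U n\<bar>) + ((\<Sum>n\<in>P. \<bar>U n\<bar>) + (\<Sum>n\<in>Q. \<bar>U n\<bar>))"
    proof -
      have fin: "finite P" "finite Q" by (auto simp: P_def Q_def)
      have u: "(\<Sum>n\<in>S \<union> T. \<bar>U n\<bar>) \<le> (\<Sum>n\<in>S. \<bar>U n\<bar>) + (\<Sum>n\<in>T. \<bar>U n\<bar>)" if "finite S" "finite T" for S T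
      proof -
        have "0 \<le> (\<Sum>n\<in>S \<inter> T. \<bar>U n\<bar>)" by (rule sum_nonneg) simp
        then show ?thesis using sum.union_inter[OF that, of "\<lambda>n. \<bar>U n\<bar>"] by linarith
      qed
      show ?thesis using u[of "{0}" "P \<union> Q"] u[of P Q] fin by simp
    qed
    also have "(\<Sum>n\<in>P. \<bar>U n\<bar>) = (\<Sum>l=1..N. \<bar>U (int l)\<bar>)"
      unfolding P_def by (simp add: sum.reindex)
    also have "(\<Sum>n\<in>Q. \<bar>U n\<bar>) = (\<Sum>l=1..N. \<bar>U (int l)\<bar>)"
      unfolding Q_def by (subst sum.reindex) (auto simp: inj_on_def ev)
    finally show ?thesis using b[of N] ev(2) by simp
  qed
  note fb = this
  show "l1 U" "l1norm U \<le> 2 * M" using l1_finite_bound[of U "2 * M", OF fb] by blast+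
qed

text \<open>
  Membership in the H^1 ball gives square summability of n U_n by Bessel's inequality for the weak
  derivative, and Cauchy-Schwarz against 1/n makes U summable with norm at most \<delta>. By completeness of the
  trigonometric system q agrees with the density built from U almost everywhere.
\<close>

lemma coefficients_of_solution:
  assumes W: "cosine_potential W a" and aA: "\<And>l. l \<ge> 1 \<Longrightarrow> real l * \<bar>a l\<bar> \<le> A"
    and q: "q \<in> H1s_ball uniform_density \<delta>" and sol: "stationary_solution W \<kappa> q"
  obtains U where "l1 U" "\<And>n. U (- n) = U n" "U 0 = 0" "l1norm U \<le> \<delta>"
    "full_balance a \<kappa> U" "AE x in lborel. q x = 1 + csum U x"
proof -
  have qL: "circle_L2 q" and qd: "circle_density q" using sol by (auto simp: stationary_solution_def)
  note qF = circle_L2_facts[OF qL]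
  have q1: "integral\<^sup>L circ q = 2 * pi" using qd by (simp add: circle_density_def circle_integral_circ)
  have qev: "circle_even q" using q by (simp add: H1s_ball_def H1s_def)
  obtain g where g: "has_weak_deriv q g" using q by (auto simp: H1s_ball_def H1s_def circle_H1_def)
  then have gL: "circle_L2 g" by (simp add: has_weak_deriv_def)
  note gF = circle_L2_facts[OF gL]
  define c where "c n = integral\<^sup>L circ (\<lambda>x. q x * cos (of_int n * x)) / (2 * pi)" for n :: int
  define U where "U n = (if n = 0 then 0 else c n)" for n
  have c0: "c 0 = 1" using q1 by (simp add: c_def)
  have Uev: "U (- n) = U n" for n by (simp add: U_def c_def)
  have U0: "U 0 = 0" by (simp add: U_def)
  have qsin: "integral\<^sup>L circ (\<lambda>x. q x * sin (of_int n * x)) = 0" for n :: int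
  proof -
    define f where "f x = q x * sin (of_int n * x)" for x
    have fp: "circle_periodic f"
      using qF(1) unfolding f_def circle_periodic_def by (simp only: cos_sin_periodic simp_thms)
    have fi: "integrable circ f" unfolding f_def by (rule integrable_circ_trig[OF qF(4)])
    have fb: "f \<in> borel_measurable borel" unfolding f_def using qF(2) by measurable
    have "integral\<^sup>L circ f = integral\<^sup>L circ (\<lambda>x. f (0 - x))" by (rule circ_reflect(2)[OF fp fi, symmetric])
    also have "\<dots> = integral\<^sup>L circ (\<lambda>x. - f x)"
    proof (rule integral_cong_AE)
      show "(\<lambda>x. f (0 - x)) \<in> borel_measurable circ" "(\<lambda>x. - f x) \<in> borel_measurable circ"
        by (rule borel_circ, use fb in measurable)+
      have "AE x in circ. q (- x) = q x" using qev unfolding circle_even_def AE_circ_iff by eventually_elim simp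
      then show "AE x in circ. f (0 - x) = - f x" by eventually_elim (simp add: f_def)
    qed
    finally show ?thesis by (simp add: f_def[abs_def])
  qed
  have gsin: "of_int n * (2 * pi * c n) = - integral\<^sup>L circ (\<lambda>x. g x * sin (of_int n * x))" for n :: int
  proof -
    have "integral\<^sup>L circ (\<lambda>x. q x * deriv (\<lambda>x. sin (of_int n * x)) x) = - integral\<^sup>L circ (\<lambda>x. g x * sin (of_int n * x))"
      using g trig_test(2)[of n] unfolding has_weak_deriv_def circle_integral_circ by blast
    moreover have "integral\<^sup>L circ (\<lambda>x. q x * deriv (\<lambda>x. sin (of_int n * x)) x) = integral\<^sup>L circ (\<lambda>x. of_int n * (q x * cos (of_int n * x)))"
      unfolding deriv_trig by (simp add: mult_ac)
    ultimately show ?thesis by (simp add: c_def)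
  qed
  have "has_weak_deriv (\<lambda>x. q x - 1) g"
    unfolding has_weak_deriv_def
  proof (intro conjI allI impI)
    have "integrable circ (\<lambda>x. (q x)\<^sup>2 - 2 * q x + cos (of_int 0 * x))"
      by (intro Bochner_Integration.integrable_add Bochner_Integration.integrable_diff integrable_mult_right qF integrable_circ_cos)
    moreover have "(\<lambda>x. (q x)\<^sup>2 - 2 * q x + cos (of_int 0 * x)) = (\<lambda>x. (q x - 1)\<^sup>2)"
      by (rule ext) (simp add: power2_diff)
    ultimately have "integrable circ (\<lambda>x. (q x - 1)\<^sup>2)" by simp
    moreover have "circle_periodic (\<lambda>x. q x - 1)" using qF(1) by (simp add: circle_periodic_def)
    moreover have "(\<lambda>x. q x - 1) \<in> borel_measurable borel" using qF(2) by measurable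
    ultimately show "circle_L2 (\<lambda>x. q x - 1)" unfolding circle_L2_def set_integrable_circ by blast
    show "circle_L2 g" by (rule gL)
    fix \<phi> assume t: "circle_test \<phi>"
    note T = circle_test_facts[OF t]
    obtain B where B: "\<forall>x. \<bar>deriv \<phi> x\<bar> \<le> B" using continuous_periodic_bounded[OF T(6,4)] by metis
    have i: "integrable circ (\<lambda>x. q x * deriv \<phi> x)" "integrable circ (deriv \<phi>)"
      using B by (auto intro!: integrable_circ_mult[OF qF(4) borel_measurable_continuous_onI[OF T(6)], of B]
          integrable_circ_continuous[OF T(6,4)])
    have "integral\<^sup>L circ (deriv \<phi>) = \<phi> (2*pi) - \<phi> 0" by (rule integral_circ_FTC[OF T(1,6)])
    also have "\<dots> = 0" using T(3)[unfolded circle_periodic_def, rule_format, of 0] by simp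
    finally have z: "integral\<^sup>L circ (deriv \<phi>) = 0" .
    have "integral\<^sup>L circ (\<lambda>x. (q x - 1) * deriv \<phi> x) = integral\<^sup>L circ (\<lambda>x. q x * deriv \<phi> x)"
      using i z by (simp add: left_diff_distrib)
    also have "\<dots> = - integral\<^sup>L circ (\<lambda>x. g x * \<phi> x)"
      using g t unfolding has_weak_deriv_def circle_integral_circ by blast
    finally show "circle_integral (\<lambda>x. (q x - 1) * deriv \<phi> x) = - circle_integral (\<lambda>x. g x * \<phi> x)"
      unfolding circle_integral_circ .
  qed
  note g1 = this
  have nm: "sqrt (integral\<^sup>L circ (\<lambda>x. (q x - 1)\<^sup>2 + (g x)\<^sup>2)) < \<delta>"
  proof -
    have "H1_norm (\<lambda>x. q x - 1) < \<delta>" using q by (simp add: H1s_ball_def)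
    then show ?thesis unfolding H1_norm_eq[OF g1] .
  qed
  have \<delta>: "0 < \<delta>" by (rule le_less_trans[OF _ nm]) simp
  have "circle_L2 (\<lambda>x. q x - 1)" using g1 by (simp add: has_weak_deriv_def)
  note q1F = circle_L2_facts[OF this]
  have "integral\<^sup>L circ (\<lambda>x. (g x)\<^sup>2) \<le> integral\<^sup>L circ (\<lambda>x. (q x - 1)\<^sup>2 + (g x)\<^sup>2)"
    by (rule integral_mono) (use gF(3) q1F(3) in auto)
  also have "\<dots> \<le> \<delta>\<^sup>2"
  proof -
    have "sqrt (integral\<^sup>L circ (\<lambda>x. (q x - 1)\<^sup>2 + (g x)\<^sup>2)) \<le> \<delta>" using nm by simp
    then show ?thesis by (rule sqrt_le_D)
  qed
  finally have g\<delta>: "integral\<^sup>L circ (\<lambda>x. (g x)\<^sup>2) \<le> \<delta>\<^sup>2" .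
  have bound: "(\<Sum>l=1..N. \<bar>U (int l)\<bar>) \<le> \<delta> / 2" for N
  proof -
    define G where "G l = integral\<^sup>L circ (\<lambda>x. g x * sin (real l * x))" for l :: nat
    have Ul: "\<bar>U (int l)\<bar> = (1 / real l) * (\<bar>G l\<bar> / (2 * pi))" if "l \<in> {1..N}" for l
    proof -
      have "real l * (2 * pi * c (int l)) = - G l" using gsin[of "int l"] by (simp add: G_def)
      then have "c (int l) = - G l / (real l * (2 * pi))" using that by (simp add: field_simps)
      then show ?thesis using that by (simp add: U_def abs_mult)
    qed
    have "(\<Sum>l=1..N. \<bar>U (int l)\<bar>)\<^sup>2 = (\<Sum>l=1..N. (1 / real l) * (\<bar>G l\<bar> / (2 * pi)))\<^sup>2"
      by (simp only: Ul cong: sum.cong)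
    also have "\<dots> \<le> (\<Sum>l=1..N. (1 / real l)\<^sup>2) * (\<Sum>l=1..N. (\<bar>G l\<bar> / (2 * pi))\<^sup>2)"
      by (rule Cauchy_Schwarz_ineq_sum)
    also have "\<dots> \<le> 2 * (\<Sum>l=1..N. (\<bar>G l\<bar> / (2 * pi))\<^sup>2)"
      by (intro mult_right_mono sum_inverse_squares_le sum_nonneg) auto
    also have "(\<Sum>l=1..N. (\<bar>G l\<bar> / (2 * pi))\<^sup>2) = (\<Sum>l=1..N. (G l)\<^sup>2) / (2 * pi)\<^sup>2"
      by (simp add: power_divide sum_divide_distrib)
    also have "\<dots> \<le> (pi * \<delta>\<^sup>2) / (2 * pi)\<^sup>2"
    proof (rule divide_right_mono)
      show "(\<Sum>l=1..N. (G l)\<^sup>2) \<le> pi * \<delta>\<^sup>2"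
        using order_trans[OF bessel_sin[OF gL, of N] mult_left_mono[OF g\<delta>, of pi]] by (simp add: G_def)
    qed simp
    also have "2 * ((pi * \<delta>\<^sup>2) / (2 * pi)\<^sup>2) = \<delta>\<^sup>2 / (2 * pi)" by (simp add: power2_eq_square)
    also have "\<dots> \<le> \<delta>\<^sup>2 / 4" using pi_ge_two by (intro divide_left_mono) auto
    also have "\<dots> = (\<delta> / 2)\<^sup>2" by (simp add: power_divide)
    finally have "(\<Sum>l=1..N. \<bar>U (int l)\<bar>)\<^sup>2 \<le> (\<delta> / 2)\<^sup>2" by simp
    then show ?thesis by (rule power2_le_imp_le) (use \<delta> in simp)
  qed
  note Ul1 = l1_even_bound[where U = U, OF Uev U0 bound]
  interpret trig_density W a A U
  proof unfold_locales
    show "cosine_potential W a" by (rule W)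
    show "real l * \<bar>a l\<bar> \<le> A" if "1 \<le> l" for l by (rule aA[OF that])
    show "l1 U" by (rule Ul1(1))
    show "U (- n) = U n" for n by (rule Uev)
    show "U 0 = 0" by (rule U0)
  qed
  have qp: "AE x in lborel. q x = p x" "AE x in circ. q x = p x"
  proof -
    have cc: "integral\<^sup>L circ (\<lambda>x. q x * cos (of_int n * x)) = integral\<^sup>L circ (\<lambda>x. p x * cos (of_int n * x))" for n
    proof -
      have "integral\<^sup>L circ (\<lambda>x. q x * cos (of_int n * x)) = 2 * pi * c n" by (simp add: c_def)
      also have "c n = of_bool (n = 0) + U n" using c0 by (simp add: U_def)
      finally show ?thesis unfolding p_cos .
    qed
    show "AE x in lborel. q x = p x" "AE x in circ. q x = p x"
      by (rule trig_unique[OF qL p_L2 cc], simp only: qsin p_sin)+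
  qed
  show ?thesis
  proof (rule that[of U])
    show "l1norm U \<le> \<delta>" using Ul1(2) by simp
    show "full_balance a \<kappa> U" by (rule balance_from_solution[OF sol qp(2)])
    show "AE x in lborel. q x = 1 + csum U x" using qp(1) by (simp add: p_def)
  qed (use Ul1 Uev U0 in auto)
qed

text \<open>
  Coefficients are recovered by integration. Comparing them at the critical mode distinguishes the two
  branches from each other and from the uniform density.
\<close>

lemma csum_AE_coefficients:
  assumes "l1 U" "\<And>n. U (- n) = U n" "l1 U'" "\<And>n. U' (- n) = U' n"
    and ae: "AE x in lborel. 1 + csum U x = 1 + csum U' x"
  shows "U n = U' n"
proof -
  have "integral\<^sup>L circ (\<lambda>x. cos (of_int n * x) * csum U x) = integral\<^sup>L circ (\<lambda>x. cos (of_int n * x) * csum U' x)"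
  proof (rule integral_cong_AE)
    show "(\<lambda>x. cos (of_int n * x) * csum U x) \<in> borel_measurable circ"
      "(\<lambda>x. cos (of_int n * x) * csum U' x) \<in> borel_measurable circ"
      using tsum_borel[OF cos_bd assms(1)] tsum_borel[OF cos_bd assms(3)] by (intro borel_circ borel_measurable_times; simp)+
    have "AE x in circ. 1 + csum U x = 1 + csum U' x" unfolding AE_circ_iff using ae by eventually_elim simp
    then show "AE x in circ. cos (of_int n * x) * csum U x = cos (of_int n * x) * csum U' x" by eventually_elim simp
  qed
  then show ?thesis unfolding integral_cos_csum[OF assms(1)] integral_cos_csum[OF assms(3)] by (simp add: assms(2,4))
qed

text \<open>
  Let x be the part of U on frequencies not divisible by m. If n is not divisible by m, then k or n - k
  is not, so the quadratic term at n is bilinear with at least one factor from x. Inverting the linear part,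
  which is possible at these modes, gives \<parallel>x\<parallel> \<le> 2 A L \<parallel>U\<parallel> \<parallel>x\<parallel>, and \<parallel>x\<parallel> = 0.
\<close>

lemma nonresonant_modes_vanish:
  assumes aA: "\<And>l. l \<ge> 1 \<Longrightarrow> real l * \<bar>a l\<bar> \<le> A"
    and U: "l1 U" and bal: "full_balance a \<kappa> U" and m: "m > 0"
    and L: "\<And>l. l \<ge> 1 \<Longrightarrow> l \<noteq> m \<Longrightarrow> 2 - \<kappa> * a l \<noteq> 0 \<and> \<bar>\<kappa> / (2 - \<kappa> * a l)\<bar> \<le> L"
    and small: "2 * A * L * l1norm U < 1" and n: "\<not> int m dvd n"
  shows "U n = 0"
proof -
  have A: "0 \<le> A" using order_trans[OF abs_ge_zero aA[of 1, simplified]] .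
  have L0: "0 \<le> L" using order_trans[OF abs_ge_zero conjunct2[OF L[of "m + 1"]]] by simp
  define x where "x n = (if int m dvd n then 0 else U n)" for n
  define K where "K = (\<lambda>(_::int) k. of_int k * even_ext a k)"
  have K: "\<bar>K n k\<bar> \<le> A" for n k unfolding K_def by (rule even_ext_bounds(1)[OF aA])
  define ax where "ax n = \<bar>x n\<bar>" for n
  define aU where "aU n = \<bar>U n\<bar>" for n
  have xU: "\<bar>x n\<bar> \<le> 1 * \<bar>U n\<bar>" for n by (simp add: x_def)
  have l: "l1 x" "l1 ax" "l1 aU" using l1_cmult_le(1)[OF U xU] U by (auto simp: l1_def ax_def aU_def)
  have nm: "l1norm ax = l1norm x" "l1norm aU = l1norm U" by (auto simp: l1norm_def ax_def aU_def)
  have one: "\<bar>1 :: real\<bar> \<le> 1" by simp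
  define q1 where "q1 = qconv (\<lambda>_ _. 1) ax aU"
  define q2 where "q2 = qconv (\<lambda>_ _. 1) aU ax"
  note Q1 = young_l1[where K = "\<lambda>_ _. 1", OF l(2,3) one, folded q1_def]
    and Q2 = young_l1[where K = "\<lambda>_ _. 1", OF l(3,2) one, folded q2_def]
  have le: "\<bar>x n\<bar> \<le> (L * A) * \<bar>q1 n\<bar> + (L * A) * \<bar>q2 n\<bar>" for n
  proof (cases "int m dvd n")
    case True
    then show ?thesis using L0 A by (simp add: x_def)
  next
    case False
    define l where "l = nat \<bar>n\<bar>"
    have n0: "n \<noteq> 0" using False by auto
    have lm: "l \<ge> 1" "l \<noteq> m" using False n0 unfolding l_def by (auto simp: abs_if split: if_splits)
    have s1: "(\<lambda>k. 1 * ax k * aU (n - k)) summable_on UNIV" "(\<lambda>k. 1 * aU k * ax (n - k)) summable_on UNIV"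
      by (rule qconv_summable(3)[where K = "\<lambda>_ _. 1", OF l(2,3) one], rule qconv_summable(3)[where K = "\<lambda>_ _. 1", OF l(3,2) one])
    have sU: "(\<lambda>k. \<bar>U k\<bar> * \<bar>U (n - k)\<bar>) summable_on UNIV"
      by (rule qconv_summable(1)[where K = K, OF U U K])
    have "(\<Sum>\<^sub>\<infinity>k. \<bar>U k\<bar> * \<bar>U (n - k)\<bar>) \<le> (\<Sum>\<^sub>\<infinity>k. 1 * ax k * aU (n - k) + 1 * aU k * ax (n - k))"
    proof (rule infsum_mono[OF sU summable_on_add[OF s1]])
      fix k
      show "\<bar>U k\<bar> * \<bar>U (n - k)\<bar> \<le> 1 * ax k * aU (n - k) + 1 * aU k * ax (n - k)"
      proof (cases "int m dvd k")
        case True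
        then have "\<not> int m dvd (n - k)" using False by (metis dvd_add diff_add_cancel)
        then show ?thesis by (simp add: ax_def aU_def x_def)
      qed (simp add: ax_def aU_def x_def)
    qed
    also have "\<dots> = q1 n + q2 n" unfolding infsum_add[OF s1] by (simp add: q1_def q2_def qconv_def)
    finally have "A * (\<Sum>\<^sub>\<infinity>k. \<bar>U k\<bar> * \<bar>U (n - k)\<bar>) \<le> A * (\<bar>q1 n\<bar> + \<bar>q2 n\<bar>)"
      using A by (intro mult_left_mono) auto
    then have q: "\<bar>qconv K U U n\<bar> \<le> A * (\<bar>q1 n\<bar> + \<bar>q2 n\<bar>)"
      using qconv_abs_le[where K = K and n = n, OF U U K] by linarith
    have "of_int n * (2 - \<kappa> * a l) * U n = \<kappa> * qconv K U U n"
      using bal[unfolded full_balance_def, rule_format, of n] n0 by (simp add: even_ext_def l_def K_def)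
    then have "of_int n * U n = \<kappa> / (2 - \<kappa> * a l) * qconv K U U n"
      using L[OF lm] by (simp add: field_simps)
    then have "\<bar>of_int n * U n\<bar> \<le> L * (A * (\<bar>q1 n\<bar> + \<bar>q2 n\<bar>))"
      using L[OF lm] q L0 unfolding abs_mult by (metis (no_types, lifting) abs_ge_zero abs_mult mult_mono)
    moreover have "1 * \<bar>U n\<bar> \<le> \<bar>of_int n * U n\<bar>"
    proof -
      have "1 \<le> \<bar>of_int n :: real\<bar>" using n0 by linarith
      then show ?thesis unfolding abs_mult by (intro mult_right_mono) auto
    qed
    ultimately show ?thesis using False by (simp add: x_def algebra_simps)
  qed
  have "l1norm x \<le> (L * A) * l1norm q1 + (L * A) * l1norm q2" by (rule l1_add_le(2)[OF Q1(1) Q2(1) le])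
  also have "\<dots> \<le> (L * A) * (1 * (l1norm x * l1norm U)) + (L * A) * (1 * (l1norm U * l1norm x))"
    using Q1(2) Q2(2) L0 A unfolding nm by (intro add_mono mult_left_mono) auto
  also have "\<dots> = (2 * A * L * l1norm U) * l1norm x" by simp
  finally have "l1norm x \<le> 0"
  proof -
    assume le: "l1norm x \<le> 2 * A * L * l1norm U * l1norm x"
    show ?thesis
    proof (rule ccontr)
      assume "\<not> ?thesis"
      then have "(2 * A * L * l1norm U) * l1norm x < 1 * l1norm x" using small by (intro mult_strict_right_mono) auto
      then show False using le by simp
    qed
  qed
  then have "x n = 0" using l1norm_eq_0[OF l(1)] by blast
  then show ?thesis using n by (simp add: x_def)
qed

text \<open>
  For functions of period 2\<pi>/m the full system reduces to that of the multiples of m: both sides acquire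
  the same factor m.
\<close>

lemma (in mode_system) spread_balance:
  assumes m: "m > 0" and ab: "\<And>l. b l = a (l * m)"
  shows "full_balance a \<kappa> (spread m u) \<longleftrightarrow> balance \<kappa> u"
proof -
  have K: "of_int (int m * k) * even_ext a (int m * k) = real m * \<beta> k" for k
  proof (cases "k = 0")
    case False
    have "nat \<bar>int m * k\<bar> = nat \<bar>k\<bar> * m" by (simp add: abs_mult nat_mult_distrib)
    then show ?thesis using False m by (simp add: even_ext_def \<beta>_def ab)
  qed (simp add: even_ext_def \<beta>_def)
  have q: "qconv (\<lambda>_ k. of_int k * even_ext a k) (spread m u) (spread m u) n
     = (if int m dvd n then real m * qconv (\<lambda>n. \<beta>) u u (n div int m) else 0)" for n
    unfolding spread_qconv[OF m] K by (simp add: qconv_def mult.assoc infsum_cmult_right')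
  have eq: "of_int (int m * n) * (2 - \<kappa> * even_ext a (int m * n)) * spread m u (int m * n)
        = real m * (of_int n * (2 - \<kappa> * b (nat \<bar>n\<bar>)) * u n)" for n
  proof -
    have "of_int (int m * n) * (2 - \<kappa> * even_ext a (int m * n)) * u n
       = (2 * of_int (int m * n) - \<kappa> * (of_int (int m * n) * even_ext a (int m * n))) * u n"
      by (simp only: right_diff_distrib left_diff_distrib mult_ac)
    also have "\<dots> = (2 * of_int (int m * n) - \<kappa> * (real m * \<beta> n)) * u n" by (simp only: K)
    also have "\<dots> = real m * (of_int n * (2 - \<kappa> * b (nat \<bar>n\<bar>)) * u n)"
      by (simp add: \<beta>_def algebra_simps)
    finally show ?thesis unfolding spread_mult[OF m] .
  qed
  have q': "qconv (\<lambda>_ k. of_int k * even_ext a k) (spread m u) (spread m u) (int m * n) = real m * qconv (\<lambda>n. \<beta>) u u n" for n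
    unfolding q using m by simp
  show ?thesis
  proof
    assume f: "full_balance a \<kappa> (spread m u)"
    show "balance \<kappa> u" unfolding balance_def
    proof
      fix n
      have "real m * (of_int n * (2 - \<kappa> * b (nat \<bar>n\<bar>)) * u n) = real m * (\<kappa> * qconv (\<lambda>n. \<beta>) u u n)"
        using f[unfolded full_balance_def, rule_format, of "int m * n"] unfolding eq q' by (simp add: mult_ac)
      then show "of_int n * (2 - \<kappa> * b (nat \<bar>n\<bar>)) * u n = \<kappa> * qconv (\<lambda>n. \<beta>) u u n" using m by simp
    qed
  next
    assume f: "balance \<kappa> u"
    show "full_balance a \<kappa> (spread m u)" unfolding full_balance_def
    proof
      fix n
      show "of_int n * (2 - \<kappa> * even_ext a n) * spread m u n = \<kappa> * qconv (\<lambda>_ k. of_int k * even_ext a k) (spread m u) (spread m u) n"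
      proof (cases "int m dvd n")
        case True
        then obtain N where n: "n = int m * N" by (auto simp: dvd_def)
        show ?thesis unfolding n eq q' using f[unfolded balance_def, rule_format, of N] by simp
      next
        case False
        then show ?thesis unfolding q by (simp add: spread_def)
      qed
    qed
  qed
qed

section \<open>The bifurcating branches\<close>

text \<open>
  The coefficients c_l tend to 0, so 2 - \<kappa> c_l stays near 2 for all but finitely many l, while for each of
  the remaining l it is nonzero at \<kappa> = 2/\<alpha>. Hence it is bounded away from 0 uniformly in l, and for \<kappa> in
  a neighbourhood of 2/\<alpha>.
\<close>

lemma nonresonance_bounds:
  fixes c :: "nat \<Rightarrow> real"
  assumes cA': "\<forall>l\<ge>1. real l * \<bar>c l\<bar> \<le> A" and \<alpha>: "0 < \<alpha>"
    and S': "\<forall>l\<in>S. l \<ge> 1 \<and> c l \<noteq> \<alpha>"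
  shows "\<exists>\<eta> L. 0 < \<eta> \<and> \<eta> \<le> 1 / \<alpha> \<and> 1 \<le> L \<and>
    (\<forall>\<kappa> l. \<bar>\<kappa> - 2 / \<alpha>\<bar> \<le> \<eta> \<and> l \<in> S \<longrightarrow> 2 - \<kappa> * c l \<noteq> 0 \<and> \<bar>\<kappa> / (2 - \<kappa> * c l)\<bar> \<le> L) \<and>
    (\<forall>\<kappa> \<kappa>' l. \<bar>\<kappa> - 2 / \<alpha>\<bar> \<le> \<eta> \<and> \<bar>\<kappa>' - 2 / \<alpha>\<bar> \<le> \<eta> \<and> l \<in> S \<longrightarrow>
       \<bar>\<kappa> / (2 - \<kappa> * c l) - \<kappa>' / (2 - \<kappa>' * c l)\<bar> \<le> L * \<bar>\<kappa> - \<kappa>'\<bar>)"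
proof -
  note cA = cA'[rule_format] and S = S'[rule_format]
  define \<kappa>c where "\<kappa>c = 2 / \<alpha>"
  have \<kappa>c: "0 < \<kappa>c" using \<alpha> by (simp add: \<kappa>c_def)
  have A: "0 \<le> A" using order_trans[OF abs_ge_zero cA[of 1, simplified]] .
  have cle: "\<bar>c l\<bar> \<le> A" if "l \<ge> 1" for l
    using cA[OF that] mult_right_mono[of 1 "real l" "\<bar>c l\<bar>"] that by simp
  obtain N :: nat where N: "\<kappa>c * A < real N" using reals_Archimedean2 by blast
  define f where "f l = \<bar>2 - \<kappa>c * c l\<bar>" for l
  define d where "d = Min (insert 1 (f ` (S \<inter> {..N})))"
  have fin: "finite (insert 1 (f ` (S \<inter> {..N})))" by simp
  have fpos: "0 < f l" if "l \<in> S" for l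
  proof -
    have "\<kappa>c * c l \<noteq> \<kappa>c * \<alpha>" using S[OF that] \<kappa>c by simp
    moreover have "\<kappa>c * \<alpha> = 2" using \<alpha> by (simp add: \<kappa>c_def)
    ultimately show ?thesis by (simp add: f_def)
  qed
  have d: "0 < d" unfolding d_def using fpos fin by (subst Min_gr_iff) auto
  have d1: "d \<le> 1" unfolding d_def using fin by (intro Min_le) auto
  have df: "d \<le> f l" if "l \<in> S" for l
  proof (cases "l \<le> N")
    case True
    then show ?thesis unfolding d_def using that fin by (intro Min_le) auto
  next
    case False
    then have l: "l \<ge> 1" "real N < real l" by auto
    have "real l * \<bar>\<kappa>c * c l\<bar> = \<kappa>c * (real l * \<bar>c l\<bar>)" using \<kappa>c by (simp add: abs_mult)
    also have "\<dots> \<le> \<kappa>c * A" using cA[OF l(1)] \<kappa>c by (intro mult_left_mono) auto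
    also have "\<dots> \<le> real l * 1" using N l(2) by simp
    finally have "\<bar>\<kappa>c * c l\<bar> \<le> 1" using l(1) by (simp only: mult_le_cancel_left_pos of_nat_0_less_iff)
    then have "1 \<le> f l" unfolding f_def by linarith
    then show ?thesis using d1 by simp
  qed
  define \<eta> where "\<eta> = min (1 / \<alpha>) (d / (2 * (A + 1)))"
  have \<eta>: "0 < \<eta>" "\<eta> \<le> 1 / \<alpha>" using \<alpha> d A by (auto simp: \<eta>_def)
  have "\<eta> \<le> d / (2 * (A + 1))" by (simp add: \<eta>_def)
  then have "\<eta> * (2 * (A + 1)) \<le> d" using A by (simp add: pos_le_divide_eq)
  then have \<eta>A: "\<eta> * A \<le> d / 2" using \<eta> by (simp add: algebra_simps)
  have den: "d / 2 \<le> \<bar>2 - \<kappa> * c l\<bar>" if "\<bar>\<kappa> - 2 / \<alpha>\<bar> \<le> \<eta>" "l \<in> S" for \<kappa> l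
  proof -
    have "\<bar>(\<kappa> - \<kappa>c) * c l\<bar> \<le> \<eta> * A"
      unfolding abs_mult using that(1) cle[of l] S[OF that(2)] \<eta> by (intro mult_mono) (auto simp: \<kappa>c_def)
    then have "\<bar>(\<kappa> - \<kappa>c) * c l\<bar> \<le> d / 2" using \<eta>A by linarith
    moreover have "2 - \<kappa> * c l = (2 - \<kappa>c * c l) - (\<kappa> - \<kappa>c) * c l" by (simp add: algebra_simps)
    ultimately show ?thesis using df[OF that(2)] unfolding f_def by linarith
  qed
  have den0: "2 - \<kappa> * c l \<noteq> 0" if "\<bar>\<kappa> - 2 / \<alpha>\<bar> \<le> \<eta>" "l \<in> S" for \<kappa> l
    using den[OF that] d by auto
  define L where "L = max 1 (max (2 * \<kappa>c / (d / 2)) (2 / (d / 2)\<^sup>2))"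
  have L: "1 \<le> L" "2 * \<kappa>c / (d / 2) \<le> L" "2 / (d / 2)\<^sup>2 \<le> L" by (auto simp: L_def)
  show ?thesis
  proof (rule exI[of _ \<eta>], rule exI[of _ L], intro conjI allI impI; (elim conjE)?)
    show "0 < \<eta>" "\<eta> \<le> 1 / \<alpha>" "1 \<le> L" by (rule \<eta> L)+
    show "2 - \<kappa> * c l \<noteq> 0" if "\<bar>\<kappa> - 2 / \<alpha>\<bar> \<le> \<eta>" "l \<in> S" for \<kappa> l by (rule den0[OF that])
  next
    fix \<kappa> l assume a: "\<bar>\<kappa> - 2 / \<alpha>\<bar> \<le> \<eta>" "l \<in> S"
    have "\<bar>\<kappa>\<bar> \<le> 2 * \<kappa>c" using a(1) \<eta>(2) \<kappa>c by (simp add: \<kappa>c_def field_simps)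
    then have "\<bar>\<kappa>\<bar> / \<bar>2 - \<kappa> * c l\<bar> \<le> 2 * \<kappa>c / (d / 2)"
      using den[OF a] d \<kappa>c by (intro frac_le) auto
    then show "\<bar>\<kappa> / (2 - \<kappa> * c l)\<bar> \<le> L" using L(2) by simp
  next
    fix \<kappa> \<kappa>' l assume a: "\<bar>\<kappa> - 2 / \<alpha>\<bar> \<le> \<eta>" "\<bar>\<kappa>' - 2 / \<alpha>\<bar> \<le> \<eta>" "l \<in> S"
    have "\<kappa> / (2 - \<kappa> * c l) - \<kappa>' / (2 - \<kappa>' * c l) = 2 * (\<kappa> - \<kappa>') / ((2 - \<kappa> * c l) * (2 - \<kappa>' * c l))"
      using den0[OF a(1,3)] den0[OF a(2,3)] by (simp add: field_simps)
    also have "\<bar>\<dots>\<bar> = 2 * \<bar>\<kappa> - \<kappa>'\<bar> / (\<bar>2 - \<kappa> * c l\<bar> * \<bar>2 - \<kappa>' * c l\<bar>)"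
      unfolding abs_divide abs_mult by simp
    also have "\<dots> \<le> 2 * \<bar>\<kappa> - \<kappa>'\<bar> / ((d / 2) * (d / 2))"
    proof (rule frac_le)
      show "d / 2 * (d / 2) \<le> \<bar>2 - \<kappa> * c l\<bar> * \<bar>2 - \<kappa>' * c l\<bar>"
        using den[OF a(1,3)] den[OF a(2,3)] d by (intro mult_mono) auto
    qed (use d in auto)
    also have "\<dots> = (2 / (d / 2)\<^sup>2) * \<bar>\<kappa> - \<kappa>'\<bar>" by (simp add: power2_eq_square)
    also have "\<dots> \<le> L * \<bar>\<kappa> - \<kappa>'\<bar>" using L(3) by (intro mult_right_mono) auto
    finally show "\<bar>\<kappa> / (2 - \<kappa> * c l) - \<kappa>' / (2 - \<kappa>' * c l)\<bar> \<le> L * \<bar>\<kappa> - \<kappa>'\<bar>" .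
  qed
qed

lemma sqrt_diff_le:
  assumes "0 \<le> x" "0 < y"
  shows "\<bar>sqrt x - sqrt y\<bar> \<le> \<bar>x - y\<bar> / sqrt y"
proof -
  have "\<bar>sqrt x - sqrt y\<bar> * sqrt y \<le> \<bar>sqrt x - sqrt y\<bar> * (sqrt x + sqrt y)"
    using assms by (intro mult_left_mono) auto
  also have "\<dots> = \<bar>(sqrt x - sqrt y) * (sqrt x + sqrt y)\<bar>" using assms by (simp add: abs_mult)
  also have "(sqrt x - sqrt y) * (sqrt x + sqrt y) = x - y" using assms by (simp add: algebra_simps)
  finally show ?thesis using assms by (simp add: pos_le_divide_eq)
qed

context mode_system
begin

text \<open>
  Uniform bounds in the weighted norm. In the sequence scaled \<kappa> t every nonzero mode contains at least one
  factor t, so the branch is at H^1 distance of order |t| from the uniform density.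
\<close>

lemma weighted_bound:
  shows "\<exists>M>0. \<forall>\<kappa> t. \<bar>\<kappa> - \<kappa>c\<bar> \<le> \<eta>0 \<and> \<bar>t\<bar> \<le> 1/2 \<longrightarrow>
    l1norm (\<lambda>n. of_int n * Y \<kappa> (t\<^sup>2) n) \<le> M \<and> l1norm (\<lambda>n. of_int n * scaled \<kappa> t n) \<le> \<bar>t\<bar> * M"
proof -
  have k0: "\<bar>\<kappa>c - \<kappa>c\<bar> \<le> \<eta>0" using eta0 by simp
  define M where "M = l1norm (\<lambda>n. of_int n * Y \<kappa>c 0 n) + 2 * \<rho> * (1/2 + \<eta>0) + 1"
  have M: "0 < M" unfolding M_def using l1norm_nonneg[of "\<lambda>n. of_int n * Y \<kappa>c 0 n"] rho eta0
    by (simp add: add_nonneg_pos)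
  have 1: "l1norm (\<lambda>n. of_int n * Y \<kappa> (t\<^sup>2) n) \<le> M" and t2: "0 \<le> t\<^sup>2" "t\<^sup>2 \<le> 1/2" "t\<^sup>2 \<le> 1"
    if k: "\<bar>\<kappa> - \<kappa>c\<bar> \<le> \<eta>0" and t: "\<bar>t\<bar> \<le> 1/2" for \<kappa> t
  proof -
    have "\<bar>t\<bar> * \<bar>t\<bar> \<le> 1/2 * 1" using t by (intro mult_mono) auto
    then show t2: "0 \<le> t\<^sup>2" "t\<^sup>2 \<le> 1/2" "t\<^sup>2 \<le> 1" by (auto simp: power2_eq_square)
    note yl = Y_lipschitz[OF k t2(1,2) k0 order_refl, simplified]
    have le: "\<bar>of_int n * Y \<kappa> (t\<^sup>2) n\<bar> \<le> 1 * \<bar>of_int n * Y \<kappa>c 0 n\<bar> + 1 * \<bar>of_int n * (Y \<kappa> (t\<^sup>2) n - Y \<kappa>c 0 n)\<bar>" for n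
      using abs_triangle_ineq[of "of_int n * Y \<kappa>c 0 n" "of_int n * (Y \<kappa> (t\<^sup>2) n - Y \<kappa>c 0 n)"]
      by (simp add: right_diff_distrib)
    have "l1norm (\<lambda>n. of_int n * Y \<kappa> (t\<^sup>2) n)
       \<le> 1 * l1norm (\<lambda>n. of_int n * Y \<kappa>c 0 n) + 1 * l1norm (\<lambda>n. of_int n * (Y \<kappa> (t\<^sup>2) n - Y \<kappa>c 0 n))"
      by (rule l1_add_le(2)[OF Y(7)[OF k0 order_refl zero_le_one] yl(1) le])
    moreover have "2 * \<rho> * (t\<^sup>2 + \<bar>\<kappa> - \<kappa>c\<bar>) \<le> 2 * \<rho> * (1/2 + \<eta>0)"
      using rho t2 k by (intro mult_left_mono add_mono) auto
    ultimately show "l1norm (\<lambda>n. of_int n * Y \<kappa> (t\<^sup>2) n) \<le> M" using yl(2) unfolding M_def by linarith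
  qed
  have 2: "l1norm (\<lambda>n. of_int n * scaled \<kappa> t n) \<le> \<bar>t\<bar> * M" if k: "\<bar>\<kappa> - \<kappa>c\<bar> \<le> \<eta>0" and t: "\<bar>t\<bar> \<le> 1/2" for \<kappa> t
  proof -
    note y = Y(7)[OF k t2(1,3)[OF k t]]
    have le: "\<bar>of_int n * scaled \<kappa> t n\<bar> \<le> \<bar>t\<bar> * \<bar>of_int n * Y \<kappa> (t\<^sup>2) n\<bar>" for n
    proof (cases "n = 0")
      case False
      then obtain j where j: "nat \<bar>n\<bar> = Suc j" using not0_implies_Suc[of "nat \<bar>n\<bar>"] by auto
      have "\<bar>t ^ nat \<bar>n\<bar>\<bar> \<le> \<bar>t\<bar>"
        unfolding j using t mult_left_le[of "\<bar>t\<bar> ^ j" "\<bar>t\<bar>"] by (simp add: abs_mult power_abs power_le_one)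
      then have "\<bar>t ^ nat \<bar>n\<bar>\<bar> * \<bar>of_int n * Y \<kappa> (t\<^sup>2) n\<bar> \<le> \<bar>t\<bar> * \<bar>of_int n * Y \<kappa> (t\<^sup>2) n\<bar>"
        by (intro mult_right_mono) auto
      then show ?thesis by (simp add: scaled_def abs_mult mult_ac)
    qed simp
    have "l1norm (\<lambda>n. of_int n * scaled \<kappa> t n) \<le> \<bar>t\<bar> * l1norm (\<lambda>n. of_int n * Y \<kappa> (t\<^sup>2) n)"
      by (rule l1_cmult_le(2)[OF y le])
    also have "\<dots> \<le> \<bar>t\<bar> * M" using 1[OF k t] by (intro mult_left_mono) auto
    finally show ?thesis .
  qed
  show ?thesis using M 1 2 by (intro exI[of _ M]) simp
qed

end

lemma spread_even:
  assumes m: "m > 0" and u: "\<And>n. u (- n) = u n"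
  shows "spread m u (- n) = spread m u n"
proof (cases "int m dvd n")
  case True
  then obtain k where k: "n = int m * k" by (auto simp: dvd_def)
  have "spread m u (int m * (- k)) = spread m u (int m * k)" unfolding spread_mult[OF m] by (rule u)
  then show ?thesis by (simp add: k)
qed (simp add: spread_def)

text \<open>
  The exponent series and the Fourier series of \<kappa> (W * p) are the same: the two-sided sum runs over each
  frequency twice, which cancels the factor 1/2 of the convolution. By uniqueness of the normalisation the
  exponential representation is therefore the density 1 + csum (spread m u).
\<close>

lemma branch_density_eq:
  assumes W: "cosine_potential W a" and aA: "\<And>l. l \<ge> 1 \<Longrightarrow> real l * \<bar>a l\<bar> \<le> A" and m: "m > 0"
    and u: "l1 (\<lambda>n. of_int n * u n)" "\<And>n. u (- n) = u n" "u 0 = 0"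
    and bal: "full_balance a \<kappa> (spread m u)"
    and trm: "\<And>l. l \<ge> 1 \<Longrightarrow> s \<kappa> ^ l * (z (l * m) \<kappa> + r (l * m) \<kappa>) = u (int l)"
  shows "summable (exponent_term a m z r s \<kappa> \<theta>)"
    and "branch_density a m z r s \<kappa> = (\<lambda>\<theta>. 1 + csum (spread m u) \<theta>)"
    and "stationary_solution W \<kappa> (\<lambda>\<theta>. 1 + csum (spread m u) \<theta>)"
    and "(\<lambda>\<theta>. 1 + csum (spread m u) \<theta>) \<in> H1s"
    and "l1 (\<lambda>n. of_int n * spread m u n)"
proof -
  define U where "U = spread m u"
  have ul: "l1 u" by (rule l1_weighted_le(1)[where x = u, OF u(1,3)])
  have Ul: "l1 U" unfolding U_def using ul spread_l1[OF m] by simp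
  have Uev: "U (- n) = U n" for n
    unfolding U_def by (rule spread_even[where u = u, OF m u(2)])
  have U0: "U 0 = 0" using u(3) by (simp add: U_def spread_def)
  have nU: "l1 (\<lambda>n. of_int n * U n)"
    unfolding U_def spread_weight spread_l1[OF m] by (rule l1_cmult_le(1)[OF u(1), of _ "real m"]) (simp add: abs_mult)
  then show "l1 (\<lambda>n. of_int n * spread m u n)" by (simp add: U_def)
  interpret trig_density W a A U
  proof unfold_locales
    show "cosine_potential W a" by (rule W)
    show "real l * \<bar>a l\<bar> \<le> A" if "1 \<le> l" for l by (rule aA[OF that])
    show "l1 U" by (rule Ul)
    show "U (- n) = U n" for n by (rule Uev)
    show "U 0 = 0" by (rule U0)
  qed
  note sol = solution_from_coefficients[OF bal[folded U_def] nU]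
  have "stationary_solution W \<kappa> (\<lambda>\<theta>. 1 + csum U \<theta>)" "(\<lambda>\<theta>. 1 + csum U \<theta>) \<in> H1s"
    using sol(1,2) unfolding p_def[abs_def] .
  then show "stationary_solution W \<kappa> (\<lambda>\<theta>. 1 + csum (spread m u) \<theta>)" "(\<lambda>\<theta>. 1 + csum (spread m u) \<theta>) \<in> H1s"
    unfolding U_def .
  define x where "x n = even_ext a (int m * n) * u n" for n
  have X: "X = (\<lambda>n. 1/2 * spread m x n)"
  proof
    fix n
    have "X n = even_ext a n * U n / 2" by (rule X_def)
    also have "\<dots> = 1/2 * spread m x n" unfolding U_def spread_def x_def using m by (auto elim!: dvdE)
    finally show "X n = 1/2 * spread m x n" .
  qed
  have xl: "l1 x"
  proof (rule l1_cmult_le(1)[OF ul])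
    show "\<bar>x n\<bar> \<le> A * \<bar>u n\<bar>" for n
      unfolding x_def abs_mult by (intro mult_right_mono even_ext_bounds(2)[OF aA]) auto
  qed
  have xev: "x (- n) = x n" for n using u(2) even_ext_minus[of a "int m * n"] by (simp add: x_def)
  have x0: "x 0 = 0" by (simp add: x_def u(3))
  have et: "exponent_term a m z r s \<kappa> \<theta> = (\<lambda>i. x (int (Suc i)) * cos (real (Suc i) * (real m * \<theta>)))" for \<theta>
  proof
    fix i
    have "nat \<bar>int m * int (Suc i)\<bar> = Suc i * m" by (simp add: abs_mult nat_mult_distrib mult.commute del: of_nat_Suc)
    then have "x (int (Suc i)) = a (Suc i * m) * u (int (Suc i))"
      using m by (simp add: x_def even_ext_def del: of_nat_Suc)
    also have "u (int (Suc i)) = s \<kappa> ^ Suc i * (z (Suc i * m) \<kappa> + r (Suc i * m) \<kappa>)" by (rule trm[symmetric]) simp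
    finally show "exponent_term a m z r s \<kappa> \<theta> i = x (int (Suc i)) * cos (real (Suc i) * (real m * \<theta>))"
      unfolding exponent_term_def by (simp only: of_nat_mult mult_ac)
  qed
  have sm: "exponent_term a m z r s \<kappa> \<theta> sums csum X \<theta>" for \<theta>
  proof -
    have eq: "csum X \<theta> = csum x (real m * \<theta>) / 2" unfolding X tsum_cmult spread_tsum[OF m] by simp
    show ?thesis unfolding et eq by (rule csum_nat_series[where x = x, OF xl xev x0])
  qed
  then show "summable (exponent_term a m z r s \<kappa> \<theta>)" by (rule sums_summable)
  have "(\<Sum>n. exponent_term a m z r s \<kappa> \<theta> n) = csum X \<theta>" for \<theta> using sums_unique[OF sm] by simp
  then have "branch_density a m z r s \<kappa> = p"
    unfolding branch_density_def Let_def by (simp only: sol(3)[symmetric])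
  then have "branch_density a m z r s \<kappa> = (\<lambda>\<theta>. 1 + csum U \<theta>)" by (simp add: p_def[abs_def])
  then show "branch_density a m z r s \<kappa> = (\<lambda>\<theta>. 1 + csum (spread m u) \<theta>)" unfolding U_def .
qed

text \<open>
  Both directions of the bifurcation at once: the parameter set I is the side of \<kappa>c on which
  (\<kappa> - \<kappa>c) R is positive. With \<tau> = T \<kappa> the solution of the scalar equation and t = \<surd>\<tau>, the two branches
  have the coefficients scaled \<kappa> (\<plusminus>t). In the notation of the expansion, s = \<plusminus>\<rho>t, while \<rho>^l z_l and
  \<rho>^l r_l are the value of Y \<kappa> \<tau> l at \<tau> = 0 and its increment up to \<tau> = T \<kappa>. Since T is Lipschitz, r is of
  order |\<kappa> - \<kappa>c|, and since T differs from its leading term by O(|\<kappa> - \<kappa>c|^2), its square root differs from the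
  amplitude by O(|\<kappa> - \<kappa>c|^(3/2)). The set I is introduced by an equation, so that it can be
  replaced by a half-open interval once the sign of R is known.
\<close>

lemma bifurcation_core:
  fixes W :: "real \<Rightarrow> real" and a :: "nat \<Rightarrow> real" and m :: nat
  assumes W: "cosine_potential W a"
    and bdd: "bdd_above ((\<lambda>l. real l * \<bar>a l\<bar>) ` {1..})"
    and m1: "m \<ge> 1" and am: "a m > 0"
    and nonres: "\<forall>l>1. a (l*m) \<noteq> a m"
    and R: "R_coeff a m \<noteq> 0"
  shows "\<exists>\<delta>>0. \<exists>\<eta>>0. \<exists>z r sp sm.
    \<forall>I. I = {\<kappa>. \<bar>\<kappa> - kappa_crit a m\<bar> \<le> \<eta> \<and> 0 < (\<kappa> - kappa_crit a m) * R_coeff a m} \<longrightarrow>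
      expansion_coefficients a m I z r sp sm \<and> two_solutions W a m \<delta> I z r sp sm \<and>
      bifurcating_branch W (kappa_crit a m) I (branch_density a m z r sp) \<and>
      bifurcating_branch W (kappa_crit a m) I (branch_density a m z r sm) \<and>
      ((\<forall>l\<ge>1. l \<noteq> m \<longrightarrow> a l \<noteq> a m) \<longrightarrow>
         only_solutions W \<delta> {kappa_crit a m - \<eta>..kappa_crit a m + \<eta>} I
           (branch_density a m z r sp) (branch_density a m z r sm))"
proof -
  have m: "m > 0" using m1 by simp
  obtain A where aA: "\<And>l. l \<ge> 1 \<Longrightarrow> real l * \<bar>a l\<bar> \<le> A" using bdd unfolding bdd_above_def by auto
  define b where "b l = a (l * m)" for l
  have bm: "b 1 = a m" "b (Suc 0) = a m" by (simp_all add: b_def)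
  have bA: "real l * \<bar>b l\<bar> \<le> A" if "l \<ge> 1" for l
  proof -
    have "real l * 1 \<le> real l * real m" using m1 by (intro mult_left_mono) auto
    then have "real l * \<bar>b l\<bar> \<le> real (l * m) * \<bar>a (l * m)\<bar>" unfolding b_def by (intro mult_right_mono) auto
    also have "\<dots> \<le> A" using that m by (intro aA) auto
    finally show ?thesis .
  qed
  have Sb: "\<forall>l\<in>{2..}. l \<ge> 1 \<and> b l \<noteq> a m" using nonres by (simp add: b_def)
  have bA': "\<forall>l\<ge>1. real l * \<bar>b l\<bar> \<le> A" using bA by simp
  have aA': "\<forall>l\<ge>1. real l * \<bar>a l\<bar> \<le> A" using aA by simp
  obtain \<eta>b L where \<eta>b: "0 < \<eta>b" "\<eta>b \<le> 1 / a m" and L: "1 \<le> L"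
    and nb1: "\<forall>\<kappa> l. \<bar>\<kappa> - 2 / a m\<bar> \<le> \<eta>b \<and> l \<in> {2..} \<longrightarrow> 2 - \<kappa> * b l \<noteq> 0 \<and> \<bar>\<kappa> / (2 - \<kappa> * b l)\<bar> \<le> L"
    and nb2: "\<forall>\<kappa> \<kappa>' l. \<bar>\<kappa> - 2 / a m\<bar> \<le> \<eta>b \<and> \<bar>\<kappa>' - 2 / a m\<bar> \<le> \<eta>b \<and> l \<in> {2..} \<longrightarrow>
       \<bar>\<kappa> / (2 - \<kappa> * b l) - \<kappa>' / (2 - \<kappa>' * b l)\<bar> \<le> L * \<bar>\<kappa> - \<kappa>'\<bar>"
    using nonresonance_bounds[where c = b and A = A and \<alpha> = "a m" and S = "{2..}", OF bA' am Sb] by (elim exE conjE)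
  define \<kappa>c where "\<kappa>c = kappa_crit a m"
  have kc: "\<kappa>c = 2 / b 1" by (simp add: \<kappa>c_def kappa_crit_def bm)
  have kc': "\<kappa>c = 2 / a m" using kc bm by simp
  have Apos: "0 < A" using bA[of 1] bm am by simp
  \<comment> \<open>The largest \<rho> allowed by the contraction condition.\<close>
  define \<rho> where "\<rho> = 1 / (16 * A * L)"
  have rho: "0 < \<rho>" "A * L * \<rho> \<le> 1/16" using Apos L by (simp_all add: \<rho>_def)
  interpret mode_system b A L \<kappa>c \<eta>b \<rho>
  proof unfold_locales
    show "0 < b 1" using am bm by simp
    show "\<eta>b \<le> \<kappa>c / 2" using \<eta>b by (simp add: kc')
    show "\<kappa>c = 2 / b 1" by (rule kc)
    show "real l * \<bar>b l\<bar> \<le> A" if "1 \<le> l" for l by (rule bA[OF that])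
    show "0 < \<eta>b" by (rule \<eta>b)
    fix \<kappa> \<kappa>' :: real and l :: nat
    assume k: "\<bar>\<kappa> - \<kappa>c\<bar> \<le> \<eta>b" and l: "2 \<le> l"
    show "2 - \<kappa> * b l \<noteq> 0" "\<bar>\<kappa> / (2 - \<kappa> * b l)\<bar> \<le> L"
      using nb1[rule_format, of \<kappa> l] k l by (simp_all add: kc')
    assume k': "\<bar>\<kappa>' - \<kappa>c\<bar> \<le> \<eta>b"
    show "\<bar>\<kappa> / (2 - \<kappa> * b l) - \<kappa>' / (2 - \<kappa>' * b l)\<bar> \<le> L * \<bar>\<kappa> - \<kappa>'\<bar>"
      using nb2[rule_format, of \<kappa> \<kappa>' l] k k' l by (simp add: kc')
  qed (rule rho)+
  define g where "g \<kappa> \<tau> = \<kappa> * H \<kappa> \<tau>" for \<kappa> \<tau>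
  define c where "c = \<rho> * b 1"
  have c: "0 < c" using rho am by (simp add: c_def bm)
  define Cg where "Cg = 2 * \<kappa>c * (32 * A * \<rho>\<^sup>2) + 16 * A * \<rho>\<^sup>2"
  have kpos: "0 < \<kappa>c" by (rule kc_pos)
  have Cg: "0 \<le> Cg" using kpos Apos by (simp add: Cg_def)
  have kle: "0 < \<kappa> \<and> \<bar>\<kappa>\<bar> \<le> 2 * \<kappa>c" if "\<bar>\<kappa> - \<kappa>c\<bar> \<le> \<eta>b" for \<kappa>
    using that eta0(2) kpos by linarith
  have glip: "\<bar>g \<kappa> \<tau> - g \<kappa>' \<tau>'\<bar> \<le> Cg * (\<bar>\<kappa> - \<kappa>'\<bar> + \<bar>\<tau> - \<tau>'\<bar>)"
    if "\<bar>\<kappa> - \<kappa>c\<bar> \<le> \<eta>b" "\<bar>\<kappa>' - \<kappa>c\<bar> \<le> \<eta>b" "0 \<le> \<tau>" "\<tau> \<le> 1/2" "0 \<le> \<tau>'" "\<tau>' \<le> 1/2" for \<kappa> \<kappa>' \<tau> \<tau>'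
  proof -
    note h = H_lipschitz(1)[OF that(1,3,4,2,5,6)] and h' = H_lipschitz(2)[OF that(2,5,6,2,5,6)]
    have "g \<kappa> \<tau> - g \<kappa>' \<tau>' = \<kappa> * (H \<kappa> \<tau> - H \<kappa>' \<tau>') + H \<kappa>' \<tau>' * (\<kappa> - \<kappa>')" by (simp add: g_def algebra_simps)
    also have "\<bar>\<dots>\<bar> \<le> \<bar>\<kappa>\<bar> * \<bar>H \<kappa> \<tau> - H \<kappa>' \<tau>'\<bar> + \<bar>H \<kappa>' \<tau>'\<bar> * \<bar>\<kappa> - \<kappa>'\<bar>"
      unfolding abs_mult[symmetric] by (rule abs_triangle_ineq)
    also have "\<dots> \<le> 2 * \<kappa>c * (32 * A * \<rho>\<^sup>2 * (\<bar>\<kappa> - \<kappa>'\<bar> + \<bar>\<tau> - \<tau>'\<bar>)) + 16 * A * \<rho>\<^sup>2 * (\<bar>\<kappa> - \<kappa>'\<bar> + \<bar>\<tau> - \<tau>'\<bar>)"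
      using kle[OF that(1)] h h' kpos Apos by (intro add_mono mult_mono) auto
    finally show ?thesis by (simp add: Cg_def algebra_simps)
  qed
  have b21: "b 2 = a (2 * m)" by (simp add: b_def)
  have ne: "a m \<noteq> a (2 * m)" using nonres[rule_format, of 2] by auto
  have k0: "\<bar>\<kappa>c - \<kappa>c\<bar> \<le> \<eta>b" using eta0 by simp
  \<comment> \<open>Since the other factors are positive, the sign of R is opposite to that of g at the critical point.\<close>
  have gc: "g \<kappa>c 0 = - (\<kappa>c * \<rho> ^ 3 * a m / 2) * R_coeff a m"
  proof -
    have ka: "\<kappa>c * a m = 2" using am by (simp add: kc')
    have "2 - \<kappa>c * b 2 = 2 * (a m - a (2 * m)) / a m" using am by (simp add: kc' b21 field_simps)
    then have "H \<kappa>c 0 = (2 * a (2*m) - a m) * \<rho> ^ 3 * (\<kappa>c * a m) / (2 * (2 * (a m - a (2 * m)) / a m))"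
      unfolding H_0[OF k0] by (simp add: bm b21[symmetric])
    also have "\<dots> = (2 * a (2*m) - a m) * \<rho> ^ 3 * a m / (2 * (a m - a (2 * m)))"
      unfolding ka using am ne by (simp add: field_simps)
    also have "\<dots> = - (\<rho> ^ 3 * a m / 2) * R_coeff a m"
      unfolding R_coeff_def using ne by (simp add: field_simps)
    finally show ?thesis by (simp add: g_def)
  qed
  have pf: "0 < \<kappa>c * \<rho> ^ 3 * a m / 2" using kpos rho am by simp
  have g0: "g \<kappa>c 0 \<noteq> 0" using gc R kpos rho am by simp
  have sgn: "0 < (\<kappa>c - \<kappa>) * g \<kappa>c 0 \<longleftrightarrow> 0 < (\<kappa> - \<kappa>c) * R_coeff a m" for \<kappa>
  proof -
    have "(x - y) * (- F * q) = F * ((y - x) * q)" for x y F q :: real by (simp add: algebra_simps)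
    then have "(\<kappa>c - \<kappa>) * g \<kappa>c 0 = (\<kappa>c * \<rho> ^ 3 * a m / 2) * ((\<kappa> - \<kappa>c) * R_coeff a m)" unfolding gc .
    then show ?thesis using pf by (simp only: zero_less_mult_iff) auto
  qed
  obtain \<eta>1 \<tau>1 D T where eta1: "0 < \<eta>1" "\<eta>1 \<le> \<eta>b" and tau1: "0 < \<tau>1" "\<tau>1 \<le> 1/2" and Dp: "0 < D"
    and T: "\<And>\<kappa>. \<lbrakk>\<bar>\<kappa> - \<kappa>c\<bar> \<le> \<eta>1; 0 < (\<kappa>c - \<kappa>) * g \<kappa>c 0\<rbrakk> \<Longrightarrow>
          0 < T \<kappa> \<and> T \<kappa> \<le> \<tau>1 \<and> c * (\<kappa>c - \<kappa>) = T \<kappa> * g \<kappa> (T \<kappa>) \<and> T \<kappa> \<le> D * \<bar>\<kappa> - \<kappa>c\<bar>"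
    and Tu: "\<And>\<kappa> \<tau>. \<lbrakk>\<bar>\<kappa> - \<kappa>c\<bar> \<le> \<eta>1; 0 < \<tau>; \<tau> \<le> \<tau>1; c * (\<kappa>c - \<kappa>) = \<tau> * g \<kappa> \<tau>\<rbrakk> \<Longrightarrow>
          0 < (\<kappa>c - \<kappa>) * g \<kappa>c 0 \<and> \<tau> = T \<kappa>"
    and Tl: "\<And>\<kappa> \<kappa>'. \<lbrakk>\<bar>\<kappa> - \<kappa>c\<bar> \<le> \<eta>1; 0 < (\<kappa>c - \<kappa>) * g \<kappa>c 0; \<bar>\<kappa>' - \<kappa>c\<bar> \<le> \<eta>1; 0 < (\<kappa>c - \<kappa>') * g \<kappa>c 0\<rbrakk> \<Longrightarrow>
          \<bar>T \<kappa> - T \<kappa>'\<bar> \<le> D * \<bar>\<kappa> - \<kappa>'\<bar>"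
    and Ta: "\<And>\<kappa>. \<lbrakk>\<bar>\<kappa> - \<kappa>c\<bar> \<le> \<eta>1; 0 < (\<kappa>c - \<kappa>) * g \<kappa>c 0\<rbrakk> \<Longrightarrow>
          \<bar>\<kappa> - \<kappa>c\<bar> \<le> D * (c * (\<kappa>c - \<kappa>) / g \<kappa> 0) \<and>
          \<bar>T \<kappa> - c * (\<kappa>c - \<kappa>) / g \<kappa> 0\<bar> \<le> D * \<bar>\<kappa> - \<kappa>c\<bar>\<^sup>2"
    by (rule scalar_branch[where g = g and \<kappa>c = \<kappa>c and c = c and C = Cg, OF c eta0(1) Cg g0 glip])
      (assumption | rule that)+
  obtain M where M: "0 < M"
    and MY: "\<And>\<kappa> t. \<bar>\<kappa> - \<kappa>c\<bar> \<le> \<eta>b \<Longrightarrow> \<bar>t\<bar> \<le> 1/2 \<Longrightarrow> l1norm (\<lambda>n. of_int n * Y \<kappa> (t\<^sup>2) n) \<le> M"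
    and MS: "\<And>\<kappa> t. \<bar>\<kappa> - \<kappa>c\<bar> \<le> \<eta>b \<Longrightarrow> \<bar>t\<bar> \<le> 1/2 \<Longrightarrow> l1norm (\<lambda>n. of_int n * scaled \<kappa> t n) \<le> \<bar>t\<bar> * M"
  proof -
    obtain M where M: "0 < M" "\<forall>\<kappa> t. \<bar>\<kappa> - \<kappa>c\<bar> \<le> \<eta>b \<and> \<bar>t\<bar> \<le> 1/2 \<longrightarrow>
        l1norm (\<lambda>n. of_int n * Y \<kappa> (t\<^sup>2) n) \<le> M \<and> l1norm (\<lambda>n. of_int n * scaled \<kappa> t n) \<le> \<bar>t\<bar> * M"
      using weighted_bound by (elim exE conjE)
    show ?thesis by (rule that[OF M(1)]) (use M(2) in simp_all)
  qed
  define nr where "nr \<longleftrightarrow> (\<forall>l\<ge>1. l \<noteq> m \<longrightarrow> a l \<noteq> a m)"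
  obtain \<eta>a La where ea: "0 < \<eta>a" "0 < La"
    and na: "\<And>\<kappa> l. nr \<Longrightarrow> \<bar>\<kappa> - \<kappa>c\<bar> \<le> \<eta>a \<Longrightarrow> l \<ge> 1 \<Longrightarrow> l \<noteq> m \<Longrightarrow>
        2 - \<kappa> * a l \<noteq> 0 \<and> \<bar>\<kappa> / (2 - \<kappa> * a l)\<bar> \<le> La"
  proof (cases nr)
    case True
    have Sa: "\<forall>l\<in>{l. l \<ge> 1 \<and> l \<noteq> m}. l \<ge> 1 \<and> a l \<noteq> a m" using True by (simp add: nr_def)
    obtain \<eta> L where el: "0 < \<eta>" "1 \<le> L"
      and n: "\<forall>\<kappa> l. \<bar>\<kappa> - 2 / a m\<bar> \<le> \<eta> \<and> l \<in> {l. l \<ge> 1 \<and> l \<noteq> m} \<longrightarrow> 2 - \<kappa> * a l \<noteq> 0 \<and> \<bar>\<kappa> / (2 - \<kappa> * a l)\<bar> \<le> L"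
      using nonresonance_bounds[where c = a and A = A and \<alpha> = "a m" and S = "{l. l \<ge> 1 \<and> l \<noteq> m}", OF aA' am Sa]
      by (elim exE conjE)
    show ?thesis
    proof (rule that[of \<eta> L])
      show "0 < \<eta>" "0 < L" using el by auto
      show "2 - \<kappa> * a l \<noteq> 0 \<and> \<bar>\<kappa> / (2 - \<kappa> * a l)\<bar> \<le> L" if "\<bar>\<kappa> - \<kappa>c\<bar> \<le> \<eta>" "l \<ge> 1" "l \<noteq> m" for \<kappa> l
        by (rule n[rule_format]) (use that in \<open>simp add: kc'\<close>)
    qed
  next
    case False
    \<comment> \<open>Default values: both constants are used only under the hypothesis nr of uniqueness.\<close>
    then show ?thesis by (intro that[of 1 1]) simp_all
  qed
  \<comment> \<open>The first bound puts the parameter t = u_1/\<rho> of a solution in the ball into the range where the root of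
    the scalar equation is unique; the second makes the modes not divisible by m vanish.\<close>
  define \<delta> where "\<delta> = min (\<rho> * \<tau>1) (1 / (4 * A * La))"
  have \<delta>: "0 < \<delta>" using rho tau1 Apos ea by (simp add: \<delta>_def)
  have \<delta>\<rho>: "\<delta> \<le> \<rho> * \<tau>1" and \<delta>A: "\<delta> \<le> 1 / (4 * A * La)" by (auto simp: \<delta>_def)
  \<comment> \<open>Amplitudes t \<le> e stay in the ball, and \<eta> is so small that T \<kappa> \<le> D \<eta> \<le> e^2.\<close>
  define e where "e = min (1/2) (\<delta> / (8 * real m * M))"
  have e: "0 < e" "e \<le> 1/2" "e \<le> \<delta> / (8 * real m * M)" using \<delta> m M by (auto simp: e_def)
  define \<eta> where "\<eta> = min \<eta>1 (min \<eta>a (e\<^sup>2 / D))"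
  have \<eta>: "0 < \<eta>" "\<eta> \<le> \<eta>1" "\<eta> \<le> \<eta>a" "\<eta> \<le> e\<^sup>2 / D" using eta1 ea e Dp by (auto simp: \<eta>_def)
  have \<eta>b': "\<eta> \<le> \<eta>b" using \<eta>(2) eta1(2) by simp
  define t where "t \<kappa> = sqrt (T \<kappa>)" for \<kappa>
  define I where "I = {\<kappa>. \<bar>\<kappa> - kappa_crit a m\<bar> \<le> \<eta> \<and> 0 < (\<kappa> - kappa_crit a m) * R_coeff a m}"
  have I: "\<bar>\<kappa> - \<kappa>c\<bar> \<le> \<eta>" "\<bar>\<kappa> - \<kappa>c\<bar> \<le> \<eta>1" "\<bar>\<kappa> - \<kappa>c\<bar> \<le> \<eta>b" "0 < (\<kappa>c - \<kappa>) * g \<kappa>c 0" if "\<kappa> \<in> I" for \<kappa>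
    using that \<eta> \<eta>b' by (auto simp: I_def sgn \<kappa>c_def[symmetric])
  have t: "0 < t \<kappa>" "(t \<kappa>)\<^sup>2 = T \<kappa>" "t \<kappa> \<le> e" "t \<kappa> \<le> 1/2" "t \<kappa> \<le> sqrt (D * \<bar>\<kappa> - \<kappa>c\<bar>)" if "\<kappa> \<in> I" for \<kappa>
  proof -
    note TT = T[OF I(2,4)[OF that]]
    show "0 < t \<kappa>" "(t \<kappa>)\<^sup>2 = T \<kappa>" using TT by (auto simp: t_def)
    show "t \<kappa> \<le> sqrt (D * \<bar>\<kappa> - \<kappa>c\<bar>)" using TT by (simp add: t_def)
    have "T \<kappa> \<le> D * \<eta>" using TT mult_left_mono[OF I(1)[OF that], of D] Dp by linarith
    also have "\<dots> \<le> e\<^sup>2" using \<eta>(4) Dp by (simp add: pos_le_divide_eq mult.commute)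
    finally have "sqrt (T \<kappa>) \<le> sqrt (e\<^sup>2)" by (rule real_sqrt_le_mono)
    then show "t \<kappa> \<le> e" using e by (simp add: t_def)
    then show "t \<kappa> \<le> 1/2" using e by simp
  qed
  \<comment> \<open>The families are indexed by the full mode number n = l m, hence the division by m.\<close>
  define z where "z n \<kappa> = Y \<kappa> 0 (int (n div m)) / \<rho> ^ (n div m)" for n \<kappa>
  define r where "r n \<kappa> = (Y \<kappa> (T \<kappa>) (int (n div m)) - Y \<kappa> 0 (int (n div m))) / \<rho> ^ (n div m)" for n \<kappa>
  define sp where "sp \<kappa> = \<rho> * t \<kappa>" for \<kappa>
  define sm where "sm \<kappa> = - (\<rho> * t \<kappa>)" for \<kappa>
  have dm: "l * m div m = l" for l using m by simp
  define P where "P s \<kappa> = (\<lambda>\<theta>. 1 + csum (spread m (scaled \<kappa> (s * t \<kappa>))) \<theta>)" for s \<kappa>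
  have S: "\<bar>s * t \<kappa>\<bar> = t \<kappa>" "\<bar>s * t \<kappa>\<bar> \<le> 1" "\<bar>s * t \<kappa>\<bar> \<le> 1/2" "(s * t \<kappa>)\<^sup>2 = T \<kappa>" if "\<bar>s\<bar> = 1" "\<kappa> \<in> I" for s \<kappa>
  proof -
    have "s\<^sup>2 = 1" using that(1) by (metis one_power2 power2_abs)
    then show "\<bar>s * t \<kappa>\<bar> = t \<kappa>" "\<bar>s * t \<kappa>\<bar> \<le> 1" "\<bar>s * t \<kappa>\<bar> \<le> 1/2" "(s * t \<kappa>)\<^sup>2 = T \<kappa>"
      using that t[OF that(2)] by (auto simp: abs_mult power_mult_distrib)
  qed
  have sol: "summable (exponent_term a m z r (\<lambda>\<kappa>. \<rho> * (s * t \<kappa>)) \<kappa> \<theta>)"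
     "branch_density a m z r (\<lambda>\<kappa>. \<rho> * (s * t \<kappa>)) \<kappa> = P s \<kappa>"
     "stationary_solution W \<kappa> (P s \<kappa>)" "P s \<kappa> \<in> H1s" "l1 (\<lambda>n. of_int n * spread m (scaled \<kappa> (s * t \<kappa>)) n)"
    if s: "\<bar>s\<bar> = 1" and k: "\<kappa> \<in> I" for s \<kappa> \<theta>
  proof -
    note sc = scaled[OF I(3)[OF k] S(2)[OF s k]]
    have "\<rho> * b 1 * (\<kappa>c - \<kappa>) = (s * t \<kappa>)\<^sup>2 * (\<kappa> * H \<kappa> ((s * t \<kappa>)\<^sup>2))"
      using T[OF I(2,4)[OF k]] unfolding S(4)[OF s k] by (simp add: c_def g_def)
    then have bal: "full_balance a \<kappa> (spread m (scaled \<kappa> (s * t \<kappa>)))"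
      unfolding spread_balance[where a = a, OF m b_def] by (rule scaled_balance[OF I(3)[OF k] S(2)[OF s k]])
    have trm: "(\<rho> * (s * t \<kappa>)) ^ l * (z (l * m) \<kappa> + r (l * m) \<kappa>) = scaled \<kappa> (s * t \<kappa>) (int l)" if "l \<ge> 1" for l
    proof -
      have "scaled \<kappa> (s * t \<kappa>) (int l) = (s * t \<kappa>) ^ l * Y \<kappa> (T \<kappa>) (int l)"
        unfolding scaled_def S(4)[OF s k] by simp
      moreover have "z (l * m) \<kappa> + r (l * m) \<kappa> = Y \<kappa> (T \<kappa>) (int l) / \<rho> ^ l"
        by (simp add: z_def r_def dm add_divide_distrib[symmetric])
      ultimately show ?thesis using rho by (simp add: power_mult_distrib)
    qed
    note bd = branch_density_eq[where a = a and m = m and A = A and z = z and r = r and s = "\<lambda>\<kappa>. \<rho> * (s * t \<kappa>)" and u = "scaled \<kappa> (s * t \<kappa>)" and \<kappa> = \<kappa>,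
        OF W aA m sc(6) sc(3) sc(4) bal trm]
    show "summable (exponent_term a m z r (\<lambda>\<kappa>. \<rho> * (s * t \<kappa>)) \<kappa> \<theta>)"
     "branch_density a m z r (\<lambda>\<kappa>. \<rho> * (s * t \<kappa>)) \<kappa> = P s \<kappa>"
     "stationary_solution W \<kappa> (P s \<kappa>)" "P s \<kappa> \<in> H1s" "l1 (\<lambda>n. of_int n * spread m (scaled \<kappa> (s * t \<kappa>)) n)"
      using bd unfolding P_def by blast+
  qed
  have spread0: "spread m u 0 = u 0" for u by (simp add: spread_def)
  have sev: "spread m (scaled \<kappa> (s * t \<kappa>)) (- n) = spread m (scaled \<kappa> (s * t \<kappa>)) n" if "\<bar>s\<bar> = 1" "\<kappa> \<in> I" for s \<kappa> n
    by (rule spread_even[where u = "scaled \<kappa> (s * t \<kappa>)", OF m scaled(3)[OF I(3)[OF that(2)] S(2)[OF that]]])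
  have sl1: "l1 (spread m (scaled \<kappa> (s * t \<kappa>)))" if "\<bar>s\<bar> = 1" "\<kappa> \<in> I" for s \<kappa>
    using scaled(1)[OF I(3)[OF that(2)] S(2)[OF that]] spread_l1[OF m] by simp
  have norm_spread: "l1norm (\<lambda>n. of_int n * spread m u n) = real m * l1norm (\<lambda>n. of_int n * u n)" for u
    unfolding spread_weight spread_l1norm[OF m] by (simp add: l1norm_def abs_mult infsum_cmult_right')
  have H1: "H1_norm (\<lambda>\<theta>. P s \<kappa> \<theta> - uniform_density \<theta>) \<le> 4 * (real m * (t \<kappa> * M))" if s: "\<bar>s\<bar> = 1" and k: "\<kappa> \<in> I" for s \<kappa>
  proof -
    note sc = scaled[OF I(3)[OF k] S(2)[OF s k]]
    have "(\<lambda>\<theta>. P s \<kappa> \<theta> - uniform_density \<theta>) = csum (spread m (scaled \<kappa> (s * t \<kappa>)))" by (simp add: P_def)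
    then have "H1_norm (\<lambda>\<theta>. P s \<kappa> \<theta> - uniform_density \<theta>) \<le> 4 * (real m * l1norm (\<lambda>n. of_int n * scaled \<kappa> (s * t \<kappa>) n))"
      using H1_norm_csum_le[OF sol(5)[OF s k]] sc(4) unfolding norm_spread by (simp add: spread0)
    also have "\<dots> \<le> 4 * (real m * (t \<kappa> * M))"
      using MS[OF I(3)[OF k] S(3)[OF s k]] unfolding S(1)[OF s k] by (intro mult_left_mono) auto
    finally show ?thesis .
  qed
  have ball: "P s \<kappa> \<in> H1s_ball uniform_density \<delta>" if s: "\<bar>s\<bar> = 1" and k: "\<kappa> \<in> I" for s \<kappa>
  proof -
    have "4 * (real m * (t \<kappa> * M)) \<le> 4 * (real m * (e * M))" using t(3)[OF k] M by (intro mult_left_mono mult_right_mono) auto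
    also have "\<dots> = (4 * real m * M) * e" by simp
    also have "\<dots> \<le> (4 * real m * M) * (\<delta> / (8 * real m * M))" using e(3) M by (intro mult_left_mono) auto
    also have "\<dots> = \<delta> / 2" using m M by simp
    also have "\<dots> < \<delta>" using \<delta> by simp
    finally show ?thesis using H1[OF s k] sol(4)[OF s k] by (simp add: H1s_ball_def)
  qed
  have mode_m: "spread m (scaled \<kappa> (s * t \<kappa>)) (int m) = \<rho> * (s * t \<kappa>)" if "\<bar>s\<bar> = 1" "\<kappa> \<in> I" for s \<kappa>
    using scaled(5)[OF I(3)[OF that(2)] S(2)[OF that]] m by (simp add: spread_def)
  have nontriv: "nontrivial_solution W \<kappa> (P s \<kappa>)" if s: "\<bar>s\<bar> = 1" and k: "\<kappa> \<in> I" for s \<kappa>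
    unfolding nontrivial_solution_def
  proof (intro conjI notI)
    show "stationary_solution W \<kappa> (P s \<kappa>)" by (rule sol(3)[OF s k])
    assume "AE \<theta> in lborel. P s \<kappa> \<theta> = uniform_density \<theta>"
    then have ae: "AE \<theta> in lborel. 1 + csum (spread m (scaled \<kappa> (s * t \<kappa>))) \<theta> = 1 + csum (\<lambda>_. 0) \<theta>"
      by (simp add: P_def tsum_def)
    have "l1 (\<lambda>_. 0)" by (simp add: l1_def)
    then have "spread m (scaled \<kappa> (s * t \<kappa>)) (int m) = 0"
      using csum_AE_coefficients[where U = "spread m (scaled \<kappa> (s * t \<kappa>))" and U' = "\<lambda>_. 0", OF sl1[OF s k] sev[OF s k] _ _ ae]
      by simp
    then show False using mode_m[OF s k] rho t(1)[OF k] s by auto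
  qed
  have distinct: "\<not> (AE \<theta> in lborel. P 1 \<kappa> \<theta> = P (-1) \<kappa> \<theta>)" if k: "\<kappa> \<in> I" for \<kappa>
  proof
    have s: "\<bar>1::real\<bar> = 1" "\<bar>-1::real\<bar> = 1" by auto
    assume "AE \<theta> in lborel. P 1 \<kappa> \<theta> = P (-1) \<kappa> \<theta>"
    then have "spread m (scaled \<kappa> (1 * t \<kappa>)) (int m) = spread m (scaled \<kappa> ((-1) * t \<kappa>)) (int m)"
      unfolding P_def
      by (rule csum_AE_coefficients[where U = "spread m (scaled \<kappa> (1 * t \<kappa>))" and U' = "spread m (scaled \<kappa> ((-1) * t \<kappa>))",
            OF sl1[OF s(1) k] sev[OF s(1) k] sl1[OF s(2) k] sev[OF s(2) k]])
    then show False unfolding mode_m[OF s(1) k] mode_m[OF s(2) k] using rho t(1)[OF k] by simp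
  qed
  have branch: "bifurcating_branch W \<kappa>c I (P s)" if s: "\<bar>s\<bar> = 1" for s
    unfolding bifurcating_branch_def
  proof (intro conjI ballI)
    have near: "((\<lambda>\<kappa>'. \<bar>\<kappa>' - \<kappa>\<bar>) \<longlongrightarrow> 0) (at \<kappa> within I)" for \<kappa>
      by (intro tendsto_eq_intros) auto
    show "((\<lambda>\<kappa>'. H1_norm (\<lambda>\<theta>. P s \<kappa>' \<theta> - uniform_density \<theta>)) \<longlongrightarrow> 0) (at \<kappa>c within I)"
    proof (rule Lim_null_comparison)
      have "norm (H1_norm (\<lambda>\<theta>. P s \<kappa> \<theta> - uniform_density \<theta>)) \<le> 4 * (real m * (sqrt (D * \<bar>\<kappa> - \<kappa>c\<bar>) * M))"
        if k: "\<kappa> \<in> I" for \<kappa>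
      proof -
        have "0 \<le> H1_norm (\<lambda>\<theta>. P s \<kappa> \<theta> - uniform_density \<theta>)" unfolding H1_norm_def circle_integral_circ by simp
        moreover have "4 * (real m * (t \<kappa> * M)) \<le> 4 * (real m * (sqrt (D * \<bar>\<kappa> - \<kappa>c\<bar>) * M))"
          using t(5)[OF k] M by (intro mult_left_mono mult_right_mono) auto
        ultimately show ?thesis using H1[OF s k] by simp
      qed
      then show "\<forall>\<^sub>F \<kappa> in at \<kappa>c within I. norm (H1_norm (\<lambda>\<theta>. P s \<kappa> \<theta> - uniform_density \<theta>)) \<le> 4 * (real m * (sqrt (D * \<bar>\<kappa> - \<kappa>c\<bar>) * M))"
        by (simp add: eventually_at_filter)
      have "((\<lambda>\<kappa>. 4 * (real m * (sqrt (D * \<bar>\<kappa> - \<kappa>c\<bar>) * M))) \<longlongrightarrow> 4 * (real m * (sqrt (D * 0) * M))) (at \<kappa>c within I)"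
        by (intro tendsto_intros near)
      then show "((\<lambda>\<kappa>. 4 * (real m * (sqrt (D * \<bar>\<kappa> - \<kappa>c\<bar>) * M))) \<longlongrightarrow> 0) (at \<kappa>c within I)" by simp
    qed
    fix \<kappa> assume k: "\<kappa> \<in> I"
    show "P s \<kappa> \<in> H1s" by (rule sol(4)[OF s k])
    show "nontrivial_solution W \<kappa> (P s \<kappa>)" by (rule nontriv[OF s k])
    have est: "norm (H1_norm (\<lambda>\<theta>. P s \<kappa>' \<theta> - P s \<kappa> \<theta>))
       \<le> 4 * (real m * (2 * \<rho> * (D * \<bar>\<kappa>' - \<kappa>\<bar> + \<bar>\<kappa>' - \<kappa>\<bar>) + (D * \<bar>\<kappa>' - \<kappa>\<bar> / t \<kappa>) * M))"
      if k': "\<kappa>' \<in> I" for \<kappa>'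
    proof -
      define u where "u n = scaled \<kappa>' (s * t \<kappa>') n - scaled \<kappa> (s * t \<kappa>) n" for n
      have nonneg: "0 \<le> s * t \<kappa>' * (s * t \<kappa>)"
      proof -
        have "s * s = 1" using s by (metis abs_mult_self_eq mult.right_neutral)
        moreover have "s * t \<kappa>' * (s * t \<kappa>) = (s * s) * (t \<kappa>' * t \<kappa>)" by (simp only: mult_ac)
        ultimately have eq: "s * t \<kappa>' * (s * t \<kappa>) = t \<kappa>' * t \<kappa>" by (simp only: mult_1_left)
        show ?thesis unfolding eq using t(1)[OF k] t(1)[OF k'] by simp
      qed
      note sd = scaled_diff[OF I(3)[OF k'] I(3)[OF k] S(3)[OF s k'] S(3)[OF s k] nonneg, folded u_def]
      have Tk: "\<bar>T \<kappa>' - T \<kappa>\<bar> \<le> D * \<bar>\<kappa>' - \<kappa>\<bar>" by (rule Tl[OF I(2,4)[OF k'] I(2,4)[OF k]])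
      have "\<bar>s * t \<kappa>' - s * t \<kappa>\<bar> = \<bar>t \<kappa>' - t \<kappa>\<bar>" using s by (simp add: right_diff_distrib[symmetric] abs_mult)
      also have "\<dots> \<le> \<bar>T \<kappa>' - T \<kappa>\<bar> / t \<kappa>"
        unfolding t_def using T[OF I(2,4)[OF k']] T[OF I(2,4)[OF k]] by (intro sqrt_diff_le) auto
      also have "\<dots> \<le> D * \<bar>\<kappa>' - \<kappa>\<bar> / t \<kappa>" using Tk t(1)[OF k] by (intro divide_right_mono) auto
      finally have td: "\<bar>s * t \<kappa>' - s * t \<kappa>\<bar> \<le> D * \<bar>\<kappa>' - \<kappa>\<bar> / t \<kappa>" .
      have "l1norm (\<lambda>n. of_int n * u n)
          \<le> 2 * \<rho> * (D * \<bar>\<kappa>' - \<kappa>\<bar> + \<bar>\<kappa>' - \<kappa>\<bar>) + (D * \<bar>\<kappa>' - \<kappa>\<bar> / t \<kappa>) * M"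
      proof (rule order_trans[OF sd(2)], intro add_mono mult_left_mono mult_mono)
        show "\<bar>(s * t \<kappa>')\<^sup>2 - (s * t \<kappa>)\<^sup>2\<bar> \<le> D * \<bar>\<kappa>' - \<kappa>\<bar>" unfolding S(4)[OF s k] S(4)[OF s k'] by (rule Tk)
        show "l1norm (\<lambda>n. of_int n * Y \<kappa>' ((s * t \<kappa>')\<^sup>2) n) \<le> M" by (rule MY[OF I(3)[OF k'] S(3)[OF s k']])
      qed (use td rho Dp t(1)[OF k] l1norm_nonneg in auto)
      then have 1: "4 * (real m * l1norm (\<lambda>n. of_int n * u n))
          \<le> 4 * (real m * (2 * \<rho> * (D * \<bar>\<kappa>' - \<kappa>\<bar> + \<bar>\<kappa>' - \<kappa>\<bar>) + (D * \<bar>\<kappa>' - \<kappa>\<bar> / t \<kappa>) * M))"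
        by (intro mult_left_mono) auto
      have su: "spread m u = (\<lambda>n. spread m (scaled \<kappa>' (s * t \<kappa>')) n - spread m (scaled \<kappa> (s * t \<kappa>)) n)"
        by (auto simp: spread_def u_def)
      have "(\<lambda>\<theta>. P s \<kappa>' \<theta> - P s \<kappa> \<theta>) = csum (spread m u)"
        unfolding su by (rule ext, subst tsum_diff[OF cos_bd sl1[OF s k'] sl1[OF s k]]) (simp add: P_def)
      moreover have "l1 (\<lambda>n. of_int n * spread m u n)"
        unfolding spread_weight spread_l1[OF m] by (rule l1_cmult_le(1)[OF sd(1), of _ "real m"]) (simp add: abs_mult)
      moreover have "spread m u 0 = 0"
        using scaled(4)[OF I(3)[OF k] S(2)[OF s k]] scaled(4)[OF I(3)[OF k'] S(2)[OF s k']] by (simp add: spread0 u_def)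
      ultimately have "H1_norm (\<lambda>\<theta>. P s \<kappa>' \<theta> - P s \<kappa> \<theta>) \<le> 4 * (real m * l1norm (\<lambda>n. of_int n * u n))"
        using H1_norm_csum_le[of "spread m u"] unfolding norm_spread by simp
      moreover have "0 \<le> H1_norm (\<lambda>\<theta>. P s \<kappa>' \<theta> - P s \<kappa> \<theta>)" unfolding H1_norm_def circle_integral_circ by simp
      ultimately show ?thesis using 1 by simp
    qed
    show "((\<lambda>\<kappa>'. H1_norm (\<lambda>\<theta>. P s \<kappa>' \<theta> - P s \<kappa> \<theta>)) \<longlongrightarrow> 0) (at \<kappa> within I)"
    proof (rule Lim_null_comparison)
      show "\<forall>\<^sub>F \<kappa>' in at \<kappa> within I. norm (H1_norm (\<lambda>\<theta>. P s \<kappa>' \<theta> - P s \<kappa> \<theta>))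
       \<le> 4 * (real m * (2 * \<rho> * (D * \<bar>\<kappa>' - \<kappa>\<bar> + \<bar>\<kappa>' - \<kappa>\<bar>) + (D * \<bar>\<kappa>' - \<kappa>\<bar> / t \<kappa>) * M))"
        using est by (simp add: eventually_at_filter)
      have "((\<lambda>\<kappa>'. 4 * (real m * (2 * \<rho> * (D * \<bar>\<kappa>' - \<kappa>\<bar> + \<bar>\<kappa>' - \<kappa>\<bar>) + (D * \<bar>\<kappa>' - \<kappa>\<bar> / t \<kappa>) * M)))
         \<longlongrightarrow> 4 * (real m * (2 * \<rho> * (D * 0 + 0) + (D * 0 / t \<kappa>) * M))) (at \<kappa> within I)"
        using t(1)[OF k] by (intro tendsto_intros near) auto
      then show "((\<lambda>\<kappa>'. 4 * (real m * (2 * \<rho> * (D * \<bar>\<kappa>' - \<kappa>\<bar> + \<bar>\<kappa>' - \<kappa>\<bar>) + (D * \<bar>\<kappa>' - \<kappa>\<bar> / t \<kappa>) * M))) \<longlongrightarrow> 0) (at \<kappa> within I)"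
        by simp
    qed
  qed
  have unique: "\<kappa> \<in> I \<and> ((AE \<theta> in lborel. q \<theta> = P 1 \<kappa> \<theta>) \<or> (AE \<theta> in lborel. q \<theta> = P (-1) \<kappa> \<theta>))"
    if nr: nr and k: "\<bar>\<kappa> - \<kappa>c\<bar> \<le> \<eta>" and q: "q \<in> H1s_ball uniform_density \<delta>" and nt: "nontrivial_solution W \<kappa> q" for \<kappa> q
  proof -
    have kb: "\<bar>\<kappa> - \<kappa>c\<bar> \<le> \<eta>b" "\<bar>\<kappa> - \<kappa>c\<bar> \<le> \<eta>1" "\<bar>\<kappa> - \<kappa>c\<bar> \<le> \<eta>a" using k \<eta> \<eta>b' by auto
    obtain U where U: "l1 U" "\<And>n. U (- n) = U n" "U 0 = 0" "l1norm U \<le> \<delta>"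
      "full_balance a \<kappa> U" "AE x in lborel. q x = 1 + csum U x"
      using coefficients_of_solution[OF W aA q, of \<kappa>] nt unfolding nontrivial_solution_def by blast
    have small: "2 * A * La * l1norm U < 1"
    proof -
      have "2 * A * La * l1norm U \<le> 2 * A * La * (1 / (4 * A * La))"
        using U(4) \<delta>A Apos ea by (intro mult_left_mono) auto
      also have "\<dots> = 1/2" using Apos ea by simp
      finally show ?thesis by simp
    qed
    have van: "U n = 0" if "\<not> int m dvd n" for n
      by (rule nonresonant_modes_vanish[OF aA U(1,5) m na[OF nr kb(3)] small that])
    define u where "u n = U (int m * n)" for n
    have Uu: "U = spread m u"
    proof
      fix n show "U n = spread m u n" using van[of n] by (auto simp: spread_def u_def)
    qed
    have u: "l1 u" "l1norm u = l1norm U" using U(1) spread_l1[OF m, of u] spread_l1norm[OF m, of u] by (simp_all add: Uu)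
    have "\<tau>1 * \<rho> \<le> 1 * \<rho>" using tau1 rho by (intro mult_right_mono) auto
    then have un: "l1norm u \<le> \<rho>" using u(2) U(4) \<delta>\<rho> by (simp add: mult.commute)
    have uev: "u (- n) = u n" for n using U(2)[of "int m * n"] by (simp add: u_def)
    have u0: "u 0 = 0" using U(3) by (simp add: u_def)
    have bal: "balance \<kappa> u" using U(5) unfolding Uu spread_balance[where a = a, OF m b_def] .
    define w where "w = u 1 / \<rho>"
    note bu = balance_unique[OF kb(1) u(1) un uev u0 bal, folded w_def]
    have qU: "AE x in lborel. q x = 1 + csum (spread m (scaled \<kappa> w)) x" using U(6) unfolding Uu bu(1)[symmetric] .
    have wle: "\<bar>w\<bar> \<le> \<tau>1"
    proof -
      have "l1norm u / \<rho> \<le> \<tau>1" using u(2) U(4) \<delta>\<rho> rho by (simp add: pos_divide_le_eq mult.commute)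
      then show ?thesis using bu(2) by simp
    qed
    have w0: "w \<noteq> 0"
    proof
      assume w: "w = 0"
      have un0: "u n = 0" for n
      proof (cases "n = 0")
        case False
        then show ?thesis using fun_cong[OF bu(1), of n] w by (simp add: scaled_def)
      qed (simp add: u0)
      have sp0: "spread m u = (\<lambda>_. 0)" by (auto simp: spread_def un0)
      have "csum (spread m (scaled \<kappa> w)) x = 0" for x
        unfolding bu(1)[symmetric] sp0 by (simp add: tsum_def)
      then have "AE x in lborel. q x = uniform_density x" using qU by simp
      then show False using nt by (simp add: nontrivial_solution_def)
    qed
    have "w\<^sup>2 = \<bar>w\<bar> * \<bar>w\<bar>" by (simp add: power2_eq_square)
    also have "\<dots> \<le> \<tau>1 * 1" using wle tau1 by (intro mult_mono) auto
    finally have w2: "0 < w\<^sup>2" "w\<^sup>2 \<le> \<tau>1" using w0 by auto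
    have "c * (\<kappa>c - \<kappa>) = w\<^sup>2 * g \<kappa> (w\<^sup>2)" using bu(3)[OF w0] by (simp add: c_def g_def)
    from Tu[OF kb(2) w2 this] have act: "0 < (\<kappa>c - \<kappa>) * g \<kappa>c 0" and wT: "w\<^sup>2 = T \<kappa>" by auto
    have kI: "\<kappa> \<in> I" using act k by (simp add: I_def sgn \<kappa>c_def[symmetric])
    have "w = 1 * t \<kappa> \<or> w = (-1) * t \<kappa>"
      using wT real_sqrt_abs[of w] by (simp add: t_def abs_if split: if_splits)
    then show ?thesis
    proof (elim disjE)
      assume w: "w = 1 * t \<kappa>"
      have "AE \<theta> in lborel. q \<theta> = P 1 \<kappa> \<theta>" using qU unfolding P_def w .
      then show ?thesis using kI by blast
    next
      assume w: "w = (-1) * t \<kappa>"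
      have "AE \<theta> in lborel. q \<theta> = P (-1) \<kappa> \<theta>" using qU unfolding P_def w .
      then show ?thesis using kI by blast
    qed
  qed
  have spP: "branch_density a m z r sp \<kappa> = P 1 \<kappa>" and smP: "branch_density a m z r sm \<kappa> = P (-1) \<kappa>"
    and spS: "summable (exponent_term a m z r sp \<kappa> \<theta>)" and smS: "summable (exponent_term a m z r sm \<kappa> \<theta>)"
    if "\<kappa> \<in> I" for \<kappa> \<theta>
  proof -
    have e1: "sp = (\<lambda>\<kappa>. \<rho> * (1 * t \<kappa>))" and e2: "sm = (\<lambda>\<kappa>. \<rho> * ((-1) * t \<kappa>))" by (auto simp: sp_def sm_def)
    show "branch_density a m z r sp \<kappa> = P 1 \<kappa>" "summable (exponent_term a m z r sp \<kappa> \<theta>)"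
      unfolding e1 by (rule sol(2)[OF _ that], simp, rule sol(1)[OF _ that], simp)
    show "branch_density a m z r sm \<kappa> = P (-1) \<kappa>" "summable (exponent_term a m z r sm \<kappa> \<theta>)"
      unfolding e2 by (rule sol(2)[OF _ that], simp, rule sol(1)[OF _ that], simp)
  qed
  have branch_cong: "bifurcating_branch W \<kappa>c I F" if "\<And>\<kappa>. \<kappa> \<in> I \<Longrightarrow> F \<kappa> = G \<kappa>" "bifurcating_branch W \<kappa>c I G" for F G
  proof -
    have "((\<lambda>\<kappa>'. H1_norm (\<lambda>\<theta>. F \<kappa>' \<theta> - h \<theta>)) \<longlongrightarrow> 0) (at \<kappa>0 within I) \<longleftrightarrow> ((\<lambda>\<kappa>'. H1_norm (\<lambda>\<theta>. G \<kappa>' \<theta> - h \<theta>)) \<longlongrightarrow> 0) (at \<kappa>0 within I)" for h \<kappa>0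
      by (rule tendsto_cong) (simp add: eventually_at_filter that(1))
    then show ?thesis using that unfolding bifurcating_branch_def by simp
  qed
  have ab: "\<bar>\<kappa> * a m - 2\<bar> = a m * \<bar>\<kappa> - \<kappa>c\<bar>" for \<kappa>
  proof -
    have "\<kappa> * a m - 2 = a m * (\<kappa> - \<kappa>c)" using am by (simp add: kc' field_simps)
    then show ?thesis using am by (simp add: abs_mult)
  qed
  have amp: "amplitude a m \<kappa> = \<rho> * sqrt (c * (\<kappa>c - \<kappa>) / g \<kappa> 0)" if k: "\<kappa> \<in> I" for \<kappa>
  proof -
    have d: "2 - \<kappa> * a (2*m) \<noteq> 0" using den[OF I(3)[OF k], of 2] by (simp add: b21)
    have k0: "\<kappa> \<noteq> 0" using kle[OF I(3)[OF k]] by simp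
    have n2: "a m - 2 * a (2*m) \<noteq> 0" using R by (auto simp: R_coeff_def)
    have n2': "2 * a (2*m) - a m \<noteq> 0" using n2 by simp
    have "\<kappa>c - \<kappa> = (2 - \<kappa> * a m) / a m" using am by (simp add: kc' field_simps)
    then have "c * (\<kappa>c - \<kappa>) / g \<kappa> 0 = \<rho> * (2 - \<kappa> * a m) / (\<kappa> * ((2 * a (2*m) - a m) * \<rho> ^ 3 * \<kappa> * a m / (2 * (2 - \<kappa> * a (2*m)))))"
      using am unfolding c_def g_def H_0[OF I(3)[OF k]] by (simp add: bm b21)
    also have "\<dots> = (2 * (\<kappa> * a m - 2) * (2 - \<kappa> * a (2*m)) / (\<kappa>\<^sup>2 * a m * (a m - 2 * a (2*m)))) / \<rho>\<^sup>2"
      using rho d k0 n2 n2' am by (simp add: divide_simps power2_eq_square power3_eq_cube) (simp add: algebra_simps)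
    finally have eq: "c * (\<kappa>c - \<kappa>) / g \<kappa> 0
        = (2 * (\<kappa> * a m - 2) * (2 - \<kappa> * a (2*m)) / (\<kappa>\<^sup>2 * a m * (a m - 2 * a (2*m)))) / \<rho>\<^sup>2" .
    have "\<rho> * sqrt (y / \<rho>\<^sup>2) = sqrt y" for y using rho by (simp add: real_sqrt_divide)
    then show ?thesis unfolding eq amplitude_def by (simp only:)
  qed
  have O1: "(\<lambda>\<kappa>. r (l*m) \<kappa>) \<in> O[at \<kappa>c within I](\<lambda>\<kappa>. \<bar>\<kappa> * a m - 2\<bar>)" for l
  proof (rule bigoI)
    have "norm (r (l*m) \<kappa>) \<le> (2 * \<rho> * D / \<rho> ^ l / a m) * norm \<bar>\<kappa> * a m - 2\<bar>" if k: "\<kappa> \<in> I" for \<kappa>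
    proof -
      have T2: "0 \<le> T \<kappa>" "T \<kappa> \<le> 1/2" "T \<kappa> \<le> D * \<bar>\<kappa> - \<kappa>c\<bar>" using T[OF I(2,4)[OF k]] tau1 by auto
      have yl: "l1norm (\<lambda>n. Y \<kappa> (T \<kappa>) n - Y \<kappa> 0 n) \<le> 2 * \<rho> * T \<kappa>"
        using Y_lipschitz(3)[OF I(3)[OF k] T2(1,2) I(3)[OF k] order_refl] T2 by simp
      have "l1 (\<lambda>n. Y \<kappa> (T \<kappa>) n - Y \<kappa> 0 n)"
        using T2 by (intro l1_diff Y(1)[OF I(3)[OF k]]) auto
      from l1_abs_le[OF this, of "int l"] yl have "\<bar>Y \<kappa> (T \<kappa>) (int l) - Y \<kappa> 0 (int l)\<bar> \<le> 2 * \<rho> * T \<kappa>" by linarith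
      also have "\<dots> \<le> 2 * \<rho> * (D * \<bar>\<kappa> - \<kappa>c\<bar>)" using T2(3) rho by (intro mult_left_mono) auto
      finally have "\<bar>Y \<kappa> (T \<kappa>) (int l) - Y \<kappa> 0 (int l)\<bar> / \<rho> ^ l \<le> 2 * \<rho> * (D * \<bar>\<kappa> - \<kappa>c\<bar>) / \<rho> ^ l"
        using rho by (intro divide_right_mono) auto
      moreover have "2 * \<rho> * (D * \<bar>\<kappa> - \<kappa>c\<bar>) / \<rho> ^ l = (2 * \<rho> * D / \<rho> ^ l / a m) * (a m * \<bar>\<kappa> - \<kappa>c\<bar>)"
        using am by simp
      moreover have "norm (r (l*m) \<kappa>) = \<bar>Y \<kappa> (T \<kappa>) (int l) - Y \<kappa> 0 (int l)\<bar> / \<rho> ^ l"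
        using rho by (simp add: r_def dm)
      moreover have "norm \<bar>\<kappa> * a m - 2\<bar> = a m * \<bar>\<kappa> - \<kappa>c\<bar>"
        unfolding real_norm_def abs_abs by (rule ab)
      ultimately show ?thesis by (simp only:)
    qed
    then show "\<forall>\<^sub>F \<kappa> in at \<kappa>c within I. norm (r (l*m) \<kappa>) \<le> (2 * \<rho> * D / \<rho> ^ l / a m) * norm \<bar>\<kappa> * a m - 2\<bar>"
      by (simp add: eventually_at_filter)
  qed
  define E where "E = \<rho> * (D * sqrt D) / a m powr (3/2)"
  have O2: "\<bar>\<rho> * t \<kappa> - amplitude a m \<kappa>\<bar> \<le> E * \<bar>\<kappa> * a m - 2\<bar> powr (3/2)" if k: "\<kappa> \<in> I" for \<kappa>
  proof -
    define x where "x = \<bar>\<kappa> - \<kappa>c\<bar>"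
    define y where "y = c * (\<kappa>c - \<kappa>) / g \<kappa> 0"
    have x: "0 < x" using I(4)[OF k] by (auto simp: x_def)
    have Txy: "x \<le> D * y" "\<bar>T \<kappa> - y\<bar> \<le> D * x\<^sup>2" using Ta[OF I(2,4)[OF k]] by (auto simp: x_def y_def)
    have y: "0 < y" using less_le_trans[OF x Txy(1)] Dp by (simp add: zero_less_mult_iff)
    have "\<bar>t \<kappa> - sqrt y\<bar> \<le> \<bar>T \<kappa> - y\<bar> / sqrt y"
      unfolding t_def using T[OF I(2,4)[OF k]] y by (intro sqrt_diff_le) auto
    also have "\<dots> \<le> (D * x\<^sup>2) / (sqrt x / sqrt D)"
    proof (rule frac_le)
      show "0 < sqrt x / sqrt D" using x Dp by simp
      have "sqrt x \<le> sqrt D * sqrt y" using Txy(1) by (simp add: real_sqrt_mult[symmetric])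
      then show "sqrt x / sqrt D \<le> sqrt y" using Dp by (simp add: pos_divide_le_eq mult.commute)
    qed (use Txy Dp in auto)
    also have "\<dots> = (D * sqrt D) * (x\<^sup>2 / sqrt x)" by simp
    also have "x\<^sup>2 / sqrt x = x powr (3/2)"
    proof -
      have "x\<^sup>2 / sqrt x = x powr 2 / x powr (1/2)" using x by (simp add: powr_half_sqrt)
      also have "\<dots> = x powr (3/2)" by (simp add: powr_diff[symmetric])
      finally show ?thesis .
    qed
    finally have "\<rho> * \<bar>t \<kappa> - sqrt y\<bar> \<le> \<rho> * ((D * sqrt D) * x powr (3/2))" using rho by (intro mult_left_mono) auto
    moreover have "\<rho> * ((D * sqrt D) * x powr (3/2)) = E * (a m * x) powr (3/2)"
      using am x by (simp add: E_def powr_mult)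
    moreover have "\<bar>\<rho> * t \<kappa> - amplitude a m \<kappa>\<bar> = \<rho> * \<bar>t \<kappa> - sqrt y\<bar>"
      unfolding amp[OF k] y_def[symmetric] using rho by (simp add: right_diff_distrib[symmetric] abs_mult)
    ultimately show ?thesis unfolding ab x_def[symmetric] by simp
  qed
  have rec: "convolution_recursion a m \<kappa> z" if k: "\<kappa> \<in> I" for \<kappa>
    unfolding convolution_recursion_def
  proof (intro conjI allI impI)
    show "z m \<kappa> = 1" using Y(6)[OF I(3)[OF k] order_refl zero_le_one] m rho by (simp add: z_def)
    fix l :: nat assume l: "2 \<le> l"
    have j: "real (j*m) * a (j*m) * z (j*m) \<kappa> * z ((l-j)*m) \<kappa>
       = real m / \<rho> ^ l * (real j * b j * Y \<kappa> 0 (int j) * Y \<kappa> 0 (int (l - j)))" if "j \<in> {1..l-1}" for j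
    proof -
      have "j + (l - j) = l" using that by (simp, linarith)
      then have "\<rho> ^ l = \<rho> ^ j * \<rho> ^ (l - j)" by (simp only: power_add[symmetric])
      then show ?thesis unfolding z_def dm by (simp add: b_def mult_ac)
    qed
    have "real (l*m) * (2 - \<kappa> * a (l*m)) * z (l*m) \<kappa> = real m / \<rho> ^ l * (real l * (2 - \<kappa> * b l) * Y \<kappa> 0 (int l))"
      unfolding z_def dm by (simp add: b_def mult_ac)
    also have "\<dots> = \<kappa> * (real m / \<rho> ^ l * (\<Sum>j=1..l-1. real j * b j * Y \<kappa> 0 (int j) * Y \<kappa> 0 (int (l - j))))"
      unfolding Y_recursion[OF I(3)[OF k] l] by (simp only: mult_ac)
    also have "real m / \<rho> ^ l * (\<Sum>j=1..l-1. real j * b j * Y \<kappa> 0 (int j) * Y \<kappa> 0 (int (l - j)))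
        = (\<Sum>j=1..l-1. real (j*m) * a (j*m) * z (j*m) \<kappa> * z ((l-j)*m) \<kappa>)"
      unfolding sum_distrib_left by (rule sum.cong[OF refl], rule j[symmetric])
    finally show "real (l*m) * (2 - \<kappa> * a (l*m)) * z (l*m) \<kappa>
        = \<kappa> * (\<Sum>j=1..l-1. real (j*m) * a (j*m) * z (j*m) \<kappa> * z ((l-j)*m) \<kappa>)" .
  qed
  have exp: "expansion_coefficients a m I z r sp sm"
    unfolding expansion_coefficients_def \<kappa>c_def[symmetric]
  proof (intro conjI ballI allI impI rec O1)
    have ev: "\<forall>\<^sub>F \<kappa> in at \<kappa>c within I. norm (\<rho> * t \<kappa> - amplitude a m \<kappa>) \<le> E * norm (\<bar>\<kappa> * a m - 2\<bar> powr (3/2))"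
      using O2 by (simp add: eventually_at_filter)
    show "(\<lambda>\<kappa>. sp \<kappa> - amplitude a m \<kappa>) \<in> O[at \<kappa>c within I](\<lambda>\<kappa>. \<bar>\<kappa> * a m - 2\<bar> powr (3/2))"
      unfolding sp_def by (rule bigoI[OF ev])
    have "norm (sm \<kappa> - - amplitude a m \<kappa>) = norm (\<rho> * t \<kappa> - amplitude a m \<kappa>)" for \<kappa>
      by (simp add: sm_def abs_minus_commute)
    then show "(\<lambda>\<kappa>. sm \<kappa> - - amplitude a m \<kappa>) \<in> O[at \<kappa>c within I](\<lambda>\<kappa>. \<bar>\<kappa> * a m - 2\<bar> powr (3/2))"
      using ev by (intro bigoI[where c = E]) (simp only:)
  qed
  have two: "two_solutions W a m \<delta> I z r sp sm"
    unfolding two_solutions_def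
  proof (intro ballI conjI)
    fix \<kappa> s assume k: "\<kappa> \<in> I" and "s \<in> {sp, sm}"
    then consider "s = sp" | "s = sm" by auto
    then show "\<forall>\<theta>. summable (exponent_term a m z r s \<kappa> \<theta>)"
      "nontrivial_solution W \<kappa> (branch_density a m z r s \<kappa>)"
      "branch_density a m z r s \<kappa> \<in> H1s_ball uniform_density \<delta>"
      by (cases; simp add: spS smS spP smP nontriv ball k)+
  next
    fix \<kappa> assume k: "\<kappa> \<in> I"
    show "\<not> (AE \<theta> in lborel. branch_density a m z r sp \<kappa> \<theta> = branch_density a m z r sm \<kappa> \<theta>)"
      unfolding spP[OF k] smP[OF k] by (rule distinct[OF k])
  qed
  have br: "bifurcating_branch W \<kappa>c I (branch_density a m z r sp)" "bifurcating_branch W \<kappa>c I (branch_density a m z r sm)"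
    by (rule branch_cong[OF spP branch], simp_all) (rule branch_cong[OF smP branch], simp_all)
  have only: "only_solutions W \<delta> {\<kappa>c - \<eta>..\<kappa>c + \<eta>} I (branch_density a m z r sp) (branch_density a m z r sm)" if nr
    unfolding only_solutions_def
  proof (intro ballI impI)
    fix \<kappa> q assume "\<kappa> \<in> {\<kappa>c - \<eta>..\<kappa>c + \<eta>}" "q \<in> H1s_ball uniform_density \<delta>" "nontrivial_solution W \<kappa> q"
    then have "\<kappa> \<in> I \<and> ((AE \<theta> in lborel. q \<theta> = P 1 \<kappa> \<theta>) \<or> (AE \<theta> in lborel. q \<theta> = P (-1) \<kappa> \<theta>))"
      by (intro unique[OF that]) auto
    then show "\<kappa> \<in> I \<and> ((AE \<theta> in lborel. q \<theta> = branch_density a m z r sp \<kappa> \<theta>) \<or>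
        (AE \<theta> in lborel. q \<theta> = branch_density a m z r sm \<kappa> \<theta>))"
      using spP smP by auto
  qed
  show ?thesis
    using exp two br only unfolding nr_def \<kappa>c_def I_def
    by (intro exI[of _ \<delta>] exI[of _ \<eta>] exI[of _ z] exI[of _ r] exI[of _ sp] exI[of _ sm] conjI[OF \<delta>] conjI[OF \<eta>(1)] allI impI)
      (simp only:, blast)
qed

theorem theorem2p5:
  fixes W :: "real \<Rightarrow> real" and a :: "nat \<Rightarrow> real" and m :: nat
  assumes "cosine_potential W a"
    and "bdd_above ((\<lambda>l. real l * \<bar>a l\<bar>) ` {1..})"
    and "m \<ge> 1"
    and "a m > 0"
    and "summable (\<lambda>n. \<bar>a (Suc n * m)\<bar>)"
    and "\<forall>l>1. a (l*m) \<noteq> a m"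
  shows "(R_coeff a m > 0 \<longrightarrow>
       (\<exists>\<delta>>0. \<exists>\<eta>>0. \<exists>z r sp sm.
          let \<kappa>m = kappa_crit a m; I = {\<kappa>m<..\<kappa>m + \<eta>};
              P = branch_density a m z r sp; Q = branch_density a m z r sm
          in expansion_coefficients a m I z r sp sm \<and>
             two_solutions W a m \<delta> I z r sp sm \<and>
             supercritical_branch W \<kappa>m P \<and> supercritical_branch W \<kappa>m Q \<and>
             ((\<forall>l\<ge>1. l \<noteq> m \<longrightarrow> a l \<noteq> a m) \<longrightarrow>
                only_solutions W \<delta> {\<kappa>m - \<eta>..\<kappa>m + \<eta>} I P Q)))
   \<and> (R_coeff a m < 0 \<longrightarrow>
       (\<exists>\<delta>>0. \<exists>\<eta>>0. \<exists>z r sp sm.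
          let \<kappa>m = kappa_crit a m; I = {\<kappa>m - \<eta>..<\<kappa>m};
              P = branch_density a m z r sp; Q = branch_density a m z r sm
          in expansion_coefficients a m I z r sp sm \<and>
             two_solutions W a m \<delta> I z r sp sm \<and>
             subcritical_branch W \<kappa>m P \<and> subcritical_branch W \<kappa>m Q \<and>
             ((\<forall>l\<ge>1. l \<noteq> m \<longrightarrow> a l \<noteq> a m) \<longrightarrow>
                only_solutions W \<delta> {\<kappa>m - \<eta>..\<kappa>m + \<eta>} I P Q)))"
proof -
  define \<kappa>m where "\<kappa>m = kappa_crit a m"
  define good where "good \<delta> \<eta> z r sp sm I \<longleftrightarrow>
      expansion_coefficients a m I z r sp sm \<and> two_solutions W a m \<delta> I z r sp sm \<and>
      bifurcating_branch W \<kappa>m I (branch_density a m z r sp) \<and>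
      bifurcating_branch W \<kappa>m I (branch_density a m z r sm) \<and>
      ((\<forall>l\<ge>1. l \<noteq> m \<longrightarrow> a l \<noteq> a m) \<longrightarrow>
         only_solutions W \<delta> {\<kappa>m - \<eta>..\<kappa>m + \<eta>} I
           (branch_density a m z r sp) (branch_density a m z r sm))" for \<delta> \<eta> z r sp sm I
  have core: "\<exists>\<delta>>0. \<exists>\<eta>>0. \<exists>z r sp sm.
      \<forall>I. I = {\<kappa>. \<bar>\<kappa> - \<kappa>m\<bar> \<le> \<eta> \<and> 0 < (\<kappa> - \<kappa>m) * R_coeff a m} \<longrightarrow> good \<delta> \<eta> z r sp sm I"
    if "R_coeff a m \<noteq> 0"
    unfolding good_def \<kappa>m_def by (rule bifurcation_core[OF assms(1-4,6) that])
  show ?thesis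
  proof (intro conjI impI)
    assume R: "R_coeff a m > 0"
    then obtain \<delta> \<eta> z r sp sm where d: "0 < \<delta>" "0 < \<eta>" and all:
      "\<forall>I. I = {\<kappa>. \<bar>\<kappa> - \<kappa>m\<bar> \<le> \<eta> \<and> 0 < (\<kappa> - \<kappa>m) * R_coeff a m} \<longrightarrow> good \<delta> \<eta> z r sp sm I"
      using core[OF less_imp_neq[OF R, THEN not_sym]] by (elim exE conjE)
    have "{\<kappa>m<..\<kappa>m + \<eta>} = {\<kappa>. \<bar>\<kappa> - \<kappa>m\<bar> \<le> \<eta> \<and> 0 < (\<kappa> - \<kappa>m) * R_coeff a m}"
      using R by (auto simp: zero_less_mult_iff abs_le_iff)
    note c = all[rule_format, OF this, unfolded good_def]
    show "\<exists>\<delta>>0. \<exists>\<eta>>0. \<exists>z r sp sm.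
          let \<kappa>m = kappa_crit a m; I = {\<kappa>m<..\<kappa>m + \<eta>};
              P = branch_density a m z r sp; Q = branch_density a m z r sm
          in expansion_coefficients a m I z r sp sm \<and>
             two_solutions W a m \<delta> I z r sp sm \<and>
             supercritical_branch W \<kappa>m P \<and> supercritical_branch W \<kappa>m Q \<and>
             ((\<forall>l\<ge>1. l \<noteq> m \<longrightarrow> a l \<noteq> a m) \<longrightarrow>
                only_solutions W \<delta> {\<kappa>m - \<eta>..\<kappa>m + \<eta>} I P Q)"
      unfolding Let_def supercritical_branch_def \<kappa>m_def[symmetric]
      using c d
      by (intro exI[of _ \<delta>] conjI[OF d(1)] exI[of _ \<eta>] conjI[OF d(2)] exI[of _ z] exI[of _ r] exI[of _ sp] exI[of _ sm]) blast
  next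
    assume R: "R_coeff a m < 0"
    then obtain \<delta> \<eta> z r sp sm where d: "0 < \<delta>" "0 < \<eta>" and all:
      "\<forall>I. I = {\<kappa>. \<bar>\<kappa> - \<kappa>m\<bar> \<le> \<eta> \<and> 0 < (\<kappa> - \<kappa>m) * R_coeff a m} \<longrightarrow> good \<delta> \<eta> z r sp sm I"
      using core[OF less_imp_neq[OF R]] by (elim exE conjE)
    have "{\<kappa>m - \<eta>..<\<kappa>m} = {\<kappa>. \<bar>\<kappa> - \<kappa>m\<bar> \<le> \<eta> \<and> 0 < (\<kappa> - \<kappa>m) * R_coeff a m}"
      using R by (auto simp: zero_less_mult_iff abs_le_iff)
    note c = all[rule_format, OF this, unfolded good_def]
    show "\<exists>\<delta>>0. \<exists>\<eta>>0. \<exists>z r sp sm.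
          let \<kappa>m = kappa_crit a m; I = {\<kappa>m - \<eta>..<\<kappa>m};
              P = branch_density a m z r sp; Q = branch_density a m z r sm
          in expansion_coefficients a m I z r sp sm \<and>
             two_solutions W a m \<delta> I z r sp sm \<and>
             subcritical_branch W \<kappa>m P \<and> subcritical_branch W \<kappa>m Q \<and>
             ((\<forall>l\<ge>1. l \<noteq> m \<longrightarrow> a l \<noteq> a m) \<longrightarrow>
                only_solutions W \<delta> {\<kappa>m - \<eta>..\<kappa>m + \<eta>} I P Q)"
      unfolding Let_def subcritical_branch_def \<kappa>m_def[symmetric]
      using c d
      by (intro exI[of _ \<delta>] conjI[OF d(1)] exI[of _ \<eta>] conjI[OF d(2)] exI[of _ z] exI[of _ r] exI[of _ sp] exI[of _ sm]) blast
  qed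
qed

end
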